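(* Let $\Omega$ be an irreducible bounded symmetric domain of dimension $d$ and genus $p$, let $\mu>0$ be real and $d_0\ge1$ an integer. Then the scalar curvature of the Cartan-Hartogs domain $(\Omega^{B^{d_0}}(\mu),g(\mu))$ is constant if and only if $g(\mu)$ is Kähler-Einstein, namely, $\mu=\frac{p}{d+1}$.
   Context: $\Omega$ is an irreducible bounded symmetric domain in $\mathbb{C}^d$ in its Harish-Chandra realization, of genus $p$. Its generic norm is $N(z,\overline{\xi}):=(V(\Omega)K(z,\overline{\xi}))^{-1/p}$, where $V(\Omega)$ is the Euclidean volume of $\Omega$ and $K$ is its (unweighted) Bergman kernel. The Cartan-Hartogs domain is $\Omega^{B^{d_0}}(\mu):=\{(z,w)\in\Omega\times\mathbb{C}^{d_0}: \|w\|^2<N(z,\overline{z})^{\mu}\}$, with $\|\cdot\|$ the standard Hermitian norm. Put $\Phi(z,w):=-\log(N(z,\overline{z})^{\mu}-\|w\|^2)$; $g(\mu)$ is the Kähler metric $ds^2=\sum_{i,j=1}^{n}\frac{\partial^2\Phi}{\partial z_i\partial\overline{z_j}}dz_i\otimes d\overline{z_j}$, where $n=d+d_0$, $z=(z_1,\dots,z_d)$, $w=(z_{d+1},\dots,z_n)$. The "namely" means that each of the conditions "constant scalar curvature" and "Kähler-Einstein" is equivalent to $\mu=\frac{p}{d+1}$. *)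

theory Defs
  imports "HOL-Analysis.Analysis"
begin

section \<open>Holomorphic maps in several variables\<close>

(* The derivative is taken within S so that the notion also makes sense for a relatively open
   subset S of a coordinate subspace; for open S this is ordinary complex differentiability. *)
definition holo_map_on :: "(complex ^ 'n \<Rightarrow> complex ^ 'm) \<Rightarrow> (complex ^ 'n) set \<Rightarrow> bool" where
  "holo_map_on f S \<longleftrightarrow>
     (\<forall>x\<in>S. \<exists>f'. (f has_derivative f') (at x within S) \<and> (\<forall>c v. f' (c *s v) = c *s f' v))"

definition holo_fun_on :: "(complex ^ 'n \<Rightarrow> complex) \<Rightarrow> (complex ^ 'n) set \<Rightarrow> bool" where
  "holo_fun_on f S \<longleftrightarrow>
     (\<forall>x\<in>S. \<exists>f'. (f has_derivative f') (at x within S) \<and> (\<forall>c v. f' (c *s v) = c * f' v))"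

definition biholo_map :: "(complex ^ 'n \<Rightarrow> complex ^ 'm) \<Rightarrow> (complex ^ 'n) set \<Rightarrow> (complex ^ 'm) set \<Rightarrow> bool" where
  "biholo_map f A B \<longleftrightarrow> bij_betw f A B \<and> holo_map_on f A \<and> holo_map_on (inv_into A f) B"


section \<open>Bounded symmetric domains\<close>

definition coord_space :: "'n set \<Rightarrow> (complex ^ 'n) set" where
  "coord_space I = {z. \<forall>i. i \<notin> I \<longrightarrow> z $ i = 0}"

definition bounded_domain_in :: "'n set \<Rightarrow> (complex ^ 'n) set \<Rightarrow> bool" where
  "bounded_domain_in I D \<longleftrightarrow>
     openin (top_of_set (coord_space I)) D \<and> connected D \<and> bounded D \<and> D \<noteq> {}"

(* Every point is an isolated fixed point of an involutive biholomorphic self-map. The ambient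
   space is the coordinate subspace C^I, so that the factors of a product (which have smaller
   dimension) can be spoken about; I = UNIV is the case of a domain in C^n itself. *)
definition bounded_symmetric_domain_in :: "'n set \<Rightarrow> (complex ^ 'n) set \<Rightarrow> bool" where
  "bounded_symmetric_domain_in I D \<longleftrightarrow>
     bounded_domain_in I D \<and>
     (\<forall>p\<in>D. \<exists>s. biholo_map s D D \<and> (\<forall>x\<in>D. s (s x) = x) \<and> p isolated_in {x \<in> D. s x = x})"

abbreviation bounded_symmetric_domain :: "(complex ^ 'n) set \<Rightarrow> bool" where
  "bounded_symmetric_domain \<equiv> bounded_symmetric_domain_in UNIV"

(* C^n is the direct sum of C^I and C^(-I), so {x + y} is the product of D1 and D2. *)
definition irreducible_bsd :: "(complex ^ 'n) set \<Rightarrow> bool" where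
  "irreducible_bsd \<Omega> \<longleftrightarrow> bounded_symmetric_domain \<Omega> \<and>
     \<not> (\<exists>I D1 D2. \<exists>f :: complex ^ 'n \<Rightarrow> complex ^ 'n. I \<noteq> {} \<and> I \<noteq> UNIV \<and>
           bounded_symmetric_domain_in I D1 \<and> bounded_symmetric_domain_in (- I) D2 \<and>
           biholo_map f \<Omega> {x + y |x y. x \<in> D1 \<and> y \<in> D2})"

(* The Harish-Chandra realization is, up to a complex linear change of coordinates, the unique
   realization of a bounded symmetric domain as a circular domain containing the origin. It is
   then automatically convex. *)
definition harish_chandra_realization :: "(complex ^ 'n) set \<Rightarrow> bool" where
  "harish_chandra_realization \<Omega> \<longleftrightarrow>
     bounded_symmetric_domain \<Omega> \<and> 0 \<in> \<Omega> \<and> (\<forall>z\<in>\<Omega>. \<forall>\<theta>. cis \<theta> *s z \<in> \<Omega>)"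


section \<open>Bergman kernel\<close>

(* Members are normalised to vanish off the domain, so that the kernel below is unique as a
   function on the whole type. *)
definition bergman_space :: "(complex ^ 'n) set \<Rightarrow> (complex ^ 'n \<Rightarrow> complex) set" where
  "bergman_space \<Omega> = {f. holo_fun_on f \<Omega> \<and> (\<forall>z. z \<notin> \<Omega> \<longrightarrow> f z = 0) \<and>
                         set_integrable lborel \<Omega> (\<lambda>z. (cmod (f z))\<^sup>2)}"

(* bergman_kernel \<Omega> z w is what is usually written K(z, conj w): it is holomorphic in z and
   antiholomorphic in w. *)
definition bergman_kernel :: "(complex ^ 'n) set \<Rightarrow> complex ^ 'n \<Rightarrow> complex ^ 'n \<Rightarrow> complex" where
  "bergman_kernel \<Omega> z w =
     (THE k. k \<in> bergman_space \<Omega> \<and>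
        (\<forall>f\<in>bergman_space \<Omega>. f w = (LINT \<zeta>:\<Omega>|lborel. f \<zeta> * cnj (k \<zeta>)))) z"


section \<open>Wirtinger derivatives\<close>

definition dir_deriv :: "complex ^ 'n \<Rightarrow> (complex ^ 'n \<Rightarrow> complex) \<Rightarrow> complex ^ 'n \<Rightarrow> complex" where
  "dir_deriv v f x = vector_derivative (\<lambda>t::real. f (x + t *\<^sub>R v)) (at 0)"

(* sum_i v_i df/dz_i *)
definition wirt :: "complex ^ 'n \<Rightarrow> (complex ^ 'n \<Rightarrow> complex) \<Rightarrow> complex ^ 'n \<Rightarrow> complex" where
  "wirt v f x = (dir_deriv v f x - \<i> * dir_deriv (\<i> *s v) f x) / 2"

(* sum_i (conj v_i) df/d(conj z_i) *)
definition wirt_bar :: "complex ^ 'n \<Rightarrow> (complex ^ 'n \<Rightarrow> complex) \<Rightarrow> complex ^ 'n \<Rightarrow> complex" where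
  "wirt_bar v f x = (dir_deriv v f x + \<i> * dir_deriv (\<i> *s v) f x) / 2"

abbreviation d_z :: "'n::finite \<Rightarrow> (complex ^ 'n \<Rightarrow> complex) \<Rightarrow> complex ^ 'n \<Rightarrow> complex" where
  "d_z i \<equiv> wirt (axis i 1)"

abbreviation d_zbar :: "'n::finite \<Rightarrow> (complex ^ 'n \<Rightarrow> complex) \<Rightarrow> complex ^ 'n \<Rightarrow> complex" where
  "d_zbar i \<equiv> wirt_bar (axis i 1)"


section \<open>Genus\<close>

text \<open>
  The genus is \<open>p = 2 + a (r - 1) + b\<close>, where \<open>r\<close> is the rank and \<open>a\<close>, \<open>b\<close> are the characteristic
  multiplicities of the domain. They are read off, following Loos, from the Jordan triple system
  that a circular bounded symmetric domain carries on \<open>\<complex>\<^sup>n\<close>: with \<open>L(z) = log K(z, z)\<close> and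
  \<open>h(u, v)\<close> the value at the origin of the mixed derivative of \<open>L\<close> in the directions \<open>u\<close>
  (holomorphic) and \<open>v\<close> (antiholomorphic), the triple product \<open>{u v w}\<close> is given by \<open>h({u v w}, y)\<close> = the mixed fourth derivative of \<open>L\<close> at the
  origin in the directions \<open>u\<close>, \<open>w\<close> (holomorphic) and \<open>v\<close>, \<open>y\<close> (antiholomorphic). In this
  normalisation the unit disc has \<open>{u v w} = 2 u (conj v) w\<close>, and \<open>{c c c} = 2 c\<close> defines tripotents.
\<close>

definition log_bergman :: "(complex ^ 'n) set \<Rightarrow> complex ^ 'n \<Rightarrow> complex" where
  "log_bergman \<Omega> z = of_real (ln (Re (bergman_kernel \<Omega> z z)))"

definition jordan_triple ::
  "(complex ^ 'n) set \<Rightarrow> complex ^ 'n \<Rightarrow> complex ^ 'n \<Rightarrow> complex ^ 'n \<Rightarrow> complex ^ 'n" where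
  "jordan_triple \<Omega> u v w =
     (THE t. \<forall>y. wirt t (wirt_bar y (log_bergman \<Omega>)) 0 =
                 wirt u (wirt_bar v (wirt w (wirt_bar y (log_bergman \<Omega>)))) 0)"

definition tripotent :: "(complex ^ 'n) set \<Rightarrow> complex ^ 'n \<Rightarrow> bool" where
  "tripotent \<Omega> c \<longleftrightarrow> jordan_triple \<Omega> c c c = 2 *s c"

definition orth_tripotents :: "(complex ^ 'n) set \<Rightarrow> complex ^ 'n \<Rightarrow> complex ^ 'n \<Rightarrow> bool" where
  "orth_tripotents \<Omega> c e \<longleftrightarrow> (\<forall>x. jordan_triple \<Omega> c e x = 0)"

definition primitive_tripotent :: "(complex ^ 'n) set \<Rightarrow> complex ^ 'n \<Rightarrow> bool" where
  "primitive_tripotent \<Omega> c \<longleftrightarrow> tripotent \<Omega> c \<and> c \<noteq> 0 \<and>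
     \<not> (\<exists>c1 c2. tripotent \<Omega> c1 \<and> tripotent \<Omega> c2 \<and> c1 \<noteq> 0 \<and> c2 \<noteq> 0 \<and>
                orth_tripotents \<Omega> c1 c2 \<and> c = c1 + c2)"

(* A maximal system of pairwise orthogonal primitive tripotents. *)
definition jordan_frame :: "(complex ^ 'n) set \<Rightarrow> (complex ^ 'n) list \<Rightarrow> bool" where
  "jordan_frame \<Omega> cs \<longleftrightarrow>
     (\<forall>c\<in>set cs. primitive_tripotent \<Omega> c) \<and>
     (\<forall>i<length cs. \<forall>j<length cs. i \<noteq> j \<longrightarrow> orth_tripotents \<Omega> (cs ! i) (cs ! j)) \<and>
     \<not> (\<exists>c. primitive_tripotent \<Omega> c \<and> (\<forall>e\<in>set cs. orth_tripotents \<Omega> e c))"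

(* Joint Peirce space V_ij of the frame c_1, ..., c_r; an index 0 matches no c_k, so that V_0i is
   peirce_space \<Omega> cs 0 i. *)
definition peirce_space :: "(complex ^ 'n) set \<Rightarrow> (complex ^ 'n) list \<Rightarrow> nat \<Rightarrow> nat \<Rightarrow> (complex ^ 'n) set" where
  "peirce_space \<Omega> cs i j =
     {x. \<forall>k\<in>{1..length cs}.
           jordan_triple \<Omega> (cs ! (k - 1)) (cs ! (k - 1)) x = (of_bool (k = i) + of_bool (k = j)) *s x}"

(* The value does not depend on the frame: for an irreducible domain all frames have the same
   length and dim V_ij (1 <= i < j <= r), dim V_0i (1 <= i <= r) are independent of the indices
   and of the frame. vec.dim is the dimension over the complex numbers. For rank one, a is
   irrelevant. *)
definition genus :: "(complex ^ 'n) set \<Rightarrow> nat" where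
  "genus \<Omega> =
     (let cs = (SOME cs. jordan_frame \<Omega> cs);
          r = length cs;
          a = vec.dim (peirce_space \<Omega> cs 1 2);
          b = vec.dim (peirce_space \<Omega> cs 0 1)
      in 2 + a * (r - 1) + b)"


section \<open>Kaehler metrics given by a potential\<close>

(* For a potential these forms are automatically closed. Entry (i, j) is the coefficient of dz_i \<otimes> d(conj z_j). *)
definition potential_metric :: "(complex ^ 'n \<Rightarrow> real) \<Rightarrow> complex ^ 'n \<Rightarrow> complex ^ 'n ^ 'n" where
  "potential_metric \<Phi> x = (\<chi> i j. d_z i (d_zbar j (\<lambda>y. complex_of_real (\<Phi> y))) x)"

definition ricci_tensor :: "(complex ^ 'n \<Rightarrow> complex ^ 'n ^ 'n) \<Rightarrow> complex ^ 'n \<Rightarrow> complex ^ 'n ^ 'n" where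
  "ricci_tensor g x = (\<chi> i j. - d_z i (d_zbar j (\<lambda>y. complex_of_real (ln (Re (det (g y)))))) x)"

(* g^(i, conj j) Ric_(i, conj j) summed over i and j, without a factor 2. *)
definition scalar_curvature :: "(complex ^ 'n \<Rightarrow> complex ^ 'n ^ 'n) \<Rightarrow> complex ^ 'n \<Rightarrow> complex" where
  "scalar_curvature g x = trace (matrix_inv (g x) ** ricci_tensor g x)"

definition kaehler_einstein_on :: "(complex ^ 'n \<Rightarrow> complex ^ 'n ^ 'n) \<Rightarrow> (complex ^ 'n) set \<Rightarrow> bool" where
  "kaehler_einstein_on g D \<longleftrightarrow>
     (\<exists>c::real. \<forall>x\<in>D. \<forall>i j. ricci_tensor g x $ i $ j = complex_of_real c * g x $ i $ j)"


section \<open>Cartan-Hartogs domains\<close>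

(* Only the diagonal values N(z, conj z) are needed; there the Bergman kernel is a positive real. *)
definition generic_norm :: "(complex ^ 'n) set \<Rightarrow> complex ^ 'n \<Rightarrow> real" where
  "generic_norm \<Omega> z =
     (measure lborel \<Omega> * Re (bergman_kernel \<Omega> z z)) powr (- 1 / real (genus \<Omega>))"

definition z_part :: "complex ^ ('d::finite + 'e::finite) \<Rightarrow> complex ^ 'd" where
  "z_part x = (\<chi> i. x $ Inl i)"

definition w_part :: "complex ^ ('d::finite + 'e::finite) \<Rightarrow> complex ^ 'e" where
  "w_part x = (\<chi> i. x $ Inr i)"

definition cartan_hartogs :: "(complex ^ 'd) set \<Rightarrow> real \<Rightarrow> (complex ^ ('d::finite + 'e::finite)) set" where
  "cartan_hartogs \<Omega> \<mu> =
     {x. z_part x \<in> \<Omega> \<and> (norm (w_part x))\<^sup>2 < generic_norm \<Omega> (z_part x) powr \<mu>}"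

definition ch_potential :: "(complex ^ 'd) set \<Rightarrow> real \<Rightarrow> complex ^ ('d::finite + 'e::finite) \<Rightarrow> real" where
  "ch_potential \<Omega> \<mu> x = - ln (generic_norm \<Omega> (z_part x) powr \<mu> - (norm (w_part x))\<^sup>2)"

definition ch_metric ::
  "(complex ^ 'd) set \<Rightarrow> real \<Rightarrow> complex ^ ('d::finite + 'e::finite) \<Rightarrow> complex ^ ('d + 'e) ^ ('d + 'e)" where
  "ch_metric \<Omega> \<mu> = potential_metric (ch_potential \<Omega> \<mu>)"

end

theory Submission
  imports Defs "HOL-Complex_Analysis.Cauchy_Integral_Formula"
begin

text \<open>
  Write \<open>u = N\<^sup>\<mu> = exp (- \<psi>)\<close> on \<open>\<Omega>\<close>, so that \<open>\<psi> = (\<mu> / p) log K + const\<close>, and \<open>t = u - |w|\<^sup>2\<close>;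
  let \<open>H\<close> denote the complex Hessian. Completing squares in that of \<open>\<Phi> = - log t\<close> gives, with \<open>n = d + d\<^sub>0\<close>,
  \<open>det g = u ^ (d + 1) det (H \<psi>) / t ^ (n + 1)\<close>. The Bergman metric of \<open>\<Omega>\<close> satisfies
  \<open>det (H (log K)) = c K\<close> with a constant \<open>c\<close>. Hence
  \<open>Ric = - (n + 1) g + (d + 1 - p / \<mu>) H \<psi>\<close> and the scalar curvature is
  \<open>- n (n + 1) + (d + 1 - p / \<mu>) d t / u\<close>, where \<open>t / u\<close> is not constant.

  Homogeneity of \<open>\<Omega>\<close> is not needed for \<open>c\<close> to be constant: the quotient \<open>det (H (log K)) / K\<close> is
  invariant under the symmetry at \<open>q\<close>, whose differential at \<open>q\<close> is \<open>- I\<close>, so the differential of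
  the quotient vanishes at every \<open>q\<close>.
\<close>

text \<open>The kernel is given by its reproducing property, so its existence and smoothness have to
  be earned before anything is differentiated. K_w = K(., w) comes from a least-norm argument.
  Regularity of the diagonal K(z, z) is harder, as K is at first known to be holomorphic only
  separately in z and conj w; a local bound on K makes it jointly holomorphic on a doubled domain,
  of which the diagonal is a real linear slice.

  Invariance of the quotient rests on the unitary map f -> (f o s) J, where J is the complex
  Jacobian of the symmetry s: it gives K(s z, s z) |J(z)|^2 = K(z, z), and H annihilates log |J|^2.

  The constant c must not vanish, for g to be nondegenerate and for the Einstein condition to detect
  the coefficient of H \<psi>. This is strict Cauchy-Schwarz: up to a positive factor, H (log K) in
  direction v at z is the Gram determinant of K_z and of the element representing the derivative
  along v at z.

  The genus enters through \<psi>: det (H \<psi>) is a constant times exp ((p / \<mu>) \<psi>),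
  which lowers the exponent d + 1 of u to d + 1 - p / \<mu>.\<close>

no_notation fps_nth (infixl "$" 75)


section \<open>Holomorphic functions of several variables\<close>

lemma norm_vector_scalar_mult: "norm (c *s v) = cmod c * norm (v :: complex ^ 'n)"
  by (simp add: norm_vec_def norm_mult L2_set_right_distrib)

lemma linear_vector_scalar_mult: "linear (\<lambda>\<zeta>. \<zeta> *s (v :: complex ^ 'n))"
  by (rule linearI) (auto simp: vec_eq_iff algebra_simps)

lemma dir_deriv_eq:
  assumes "(f has_derivative f') (at x)"
  shows "dir_deriv v f x = f' v"
proof -
  have *: "((\<lambda>t::real. x + t *\<^sub>R v) has_derivative (\<lambda>t. t *\<^sub>R v)) (at 0)"
    by (auto intro!: derivative_eq_intros)
  have "((\<lambda>t::real. f (x + t *\<^sub>R v)) has_derivative (\<lambda>t. f' (t *\<^sub>R v))) (at 0)"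
    using has_derivative_compose[OF *, of f f'] assms by simp
  moreover have "f' (t *\<^sub>R v) = t *\<^sub>R f' v" for t
    using assms by (metis has_derivative_linear linear_simps(5) has_derivative_bounded_linear)
  ultimately show ?thesis
    unfolding dir_deriv_def by (simp add: vector_derivative_at has_vector_derivative_def)
qed

text \<open>A remainder bound whose constant does not depend on \<open>h\<close> survives pointwise
  limits and can be assembled from estimates in separate variables. Limits of holomorphic functions
  and separately holomorphic functions are shown to be differentiable in this way.\<close>

lemma has_derivative_quadratic_remainder:
  fixes g :: "'a::euclidean_space \<Rightarrow> 'b::real_normed_vector"
  assumes "linear g'" "r > 0"
    and bound: "\<And>h. norm h \<le> r \<Longrightarrow> norm (g (x + h) - g x - g' h) \<le> C * (norm h)\<^sup>2"
  shows "(g has_derivative g') (at x)"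
proof -
  have C: "0 \<le> \<bar>C\<bar>" by simp
  have "bounded_linear g'"
    using assms(1) linear_conv_bounded_linear by blast
  moreover have "((\<lambda>h. norm (g (x + h) - g x - g' h) / norm h) \<longlongrightarrow> 0) (at 0)"
  proof (rule tendsto_sandwich[of "\<lambda>_. 0" _ _ "\<lambda>h. \<bar>C\<bar> * norm h"])
    have "\<forall>\<^sub>F h in at 0. norm h < r"
      using \<open>r > 0\<close> by (metis (mono_tags, lifting) dist_norm diff_zero eventually_at)
    then show "\<forall>\<^sub>F h in at 0. norm (g (x + h) - g x - g' h) / norm h \<le> \<bar>C\<bar> * norm h"
    proof (eventually_elim)
      case (elim h)
      have "norm (g (x + h) - g x - g' h) \<le> \<bar>C\<bar> * (norm h)\<^sup>2"
        using bound[of h] elim by (smt (verit) mult_right_mono zero_le_power2)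
      then show ?case
        by (simp add: divide_simps power2_eq_square)
    qed
  qed (auto intro!: tendsto_eq_intros)
  ultimately show ?thesis
    by (simp add: has_derivative_at)
qed

lemma holo_fun_on_iff:
  assumes "open S"
  shows "holo_fun_on f S \<longleftrightarrow>
    (\<forall>x\<in>S. \<exists>f'. (f has_derivative f') (at x) \<and> (\<forall>c v. f' (c *s v) = c * f' v))"
  unfolding holo_fun_on_def using assms at_within_open by (metis (no_types, lifting))

lemma holo_fun_on_has_derivative:
  assumes "holo_fun_on f S" "open S" "x \<in> S"
  shows "(f has_derivative (\<lambda>h. dir_deriv h f x)) (at x)"
  using assms by (metis (no_types, lifting) dir_deriv_eq ext holo_fun_on_iff)

lemma dir_deriv_scalar_mult:
  assumes "holo_fun_on f S" "open S" "x \<in> S"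
  shows "dir_deriv (c *s v) f x = c * dir_deriv v f x"
  using assms by (metis (no_types, lifting) dir_deriv_eq holo_fun_on_iff)

lemma dir_deriv_linear:
  assumes "holo_fun_on f S" "open S" "x \<in> S"
  shows "linear (\<lambda>h. dir_deriv h f x)"
  using holo_fun_on_has_derivative[OF assms] has_derivative_linear by blast

section \<open>Closure properties of holomorphic functions\<close>

lemma holo_fun_onI:
  assumes "open S" "\<And>x. x \<in> S \<Longrightarrow> (f has_derivative f' x) (at x)"
    "\<And>x c v. x \<in> S \<Longrightarrow> f' x (c *s v) = c * f' x v"
  shows "holo_fun_on f S"
  unfolding holo_fun_on_iff[OF assms(1)] using assms(2,3) by blast

lemma holo_fun_on_continuous_on:
  assumes "holo_fun_on f S" "open S"
  shows "continuous_on S f"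
  using holo_fun_on_has_derivative[OF assms]
  by (meson continuous_at_imp_continuous_on has_derivative_continuous)

lemma holo_fun_on_subset:
  assumes "holo_fun_on f S" "open S" "T \<subseteq> S" "open T"
  shows "holo_fun_on f T"
  using assms by (meson holo_fun_on_iff subset_eq)

lemma holo_fun_on_local:
  assumes "\<And>x. x \<in> S \<Longrightarrow> \<exists>T. open T \<and> x \<in> T \<and> holo_fun_on f T" "open S"
  shows "holo_fun_on f S"
  unfolding holo_fun_on_iff[OF assms(2)] using assms(1) by (meson holo_fun_on_iff)

lemma holo_fun_on_cong:
  assumes "holo_fun_on f S" "open S" "\<And>x. x \<in> S \<Longrightarrow> f x = g x"
  shows "holo_fun_on g S"
  using assms by (metis (no_types, lifting) has_derivative_transform_within_open holo_fun_on_iff)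

lemma holo_fun_on_const: "open S \<Longrightarrow> holo_fun_on (\<lambda>_. c) S"
  by (rule holo_fun_onI[where f' = "\<lambda>_ _. 0"]) auto

lemma holo_fun_on_component: "open S \<Longrightarrow> holo_fun_on (\<lambda>x. x $ i) S"
  by (rule holo_fun_onI[where f' = "\<lambda>_ h. h $ i"])
    (auto intro: bounded_linear_imp_has_derivative bounded_linear_vec_nth)

lemma holo_fun_on_add:
  assumes "holo_fun_on f S" "holo_fun_on g S" "open S"
  shows "holo_fun_on (\<lambda>x. f x + g x) S"
  by (rule holo_fun_onI[where f' = "\<lambda>x h. dir_deriv h f x + dir_deriv h g x"])
    (use assms in \<open>auto intro!: has_derivative_add holo_fun_on_has_derivative simp: dir_deriv_scalar_mult distrib_left\<close>)

lemma holo_fun_on_mult: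
  assumes "holo_fun_on f S" "holo_fun_on g S" "open S"
  shows "holo_fun_on (\<lambda>x. f x * g x) S"
proof (rule holo_fun_onI[where f' = "\<lambda>x h. f x * dir_deriv h g x + dir_deriv h f x * g x"])
  show "((\<lambda>x. f x * g x) has_derivative (\<lambda>h. f x * dir_deriv h g x + dir_deriv h f x * g x)) (at x)"
    if "x \<in> S" for x
    using assms that by (intro has_derivative_mult holo_fun_on_has_derivative)
qed (use assms in \<open>auto simp: dir_deriv_scalar_mult algebra_simps\<close>)

lemma holo_fun_on_cmult:
  assumes "holo_fun_on f S" "open S"
  shows "holo_fun_on (\<lambda>x. c * f x) S"
  using assms by (intro holo_fun_on_mult holo_fun_on_const)

lemma holo_fun_on_diff:
  assumes "holo_fun_on f S" "holo_fun_on g S" "open S"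
  shows "holo_fun_on (\<lambda>x. f x - g x) S"
  using holo_fun_on_add[OF assms(1) holo_fun_on_cmult[OF assms(2,3), of "-1"]] assms(3) by simp

lemma holo_fun_on_sum:
  assumes "\<And>i. i \<in> I \<Longrightarrow> holo_fun_on (f i) S" "open S"
  shows "holo_fun_on (\<lambda>x. \<Sum>i\<in>I. f i x) S"
  using assms by (induction I rule: infinite_finite_induct)
    (auto intro: holo_fun_on_const holo_fun_on_add)

lemma holo_fun_on_prod:
  assumes "\<And>i. i \<in> I \<Longrightarrow> holo_fun_on (f i) S" "open S"
  shows "holo_fun_on (\<lambda>x. \<Prod>i\<in>I. f i x) S"
  using assms by (induction I rule: infinite_finite_induct)
    (auto intro: holo_fun_on_const holo_fun_on_mult)

lemma holo_fun_on_det: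
  fixes A :: "complex ^ 'n \<Rightarrow> complex ^ 'm ^ 'm"
  assumes "\<And>i j. holo_fun_on (\<lambda>x. A x $ i $ j) S" "open S"
  shows "holo_fun_on (\<lambda>x. det (A x)) S"
  unfolding det_def using assms
  by (intro holo_fun_on_sum holo_fun_on_mult holo_fun_on_prod holo_fun_on_const)

lemma holo_fun_on_compose:
  assumes f: "holo_fun_on f T" "open T" and s: "\<And>x. x \<in> S \<Longrightarrow> (s has_derivative s' x) (at x)"
    and s': "\<And>x c v. x \<in> S \<Longrightarrow> s' x (c *s v) = c *s s' x v"
    and "open S" "\<And>x. x \<in> S \<Longrightarrow> s x \<in> T"
  shows "holo_fun_on (\<lambda>x. f (s x)) S"
proof (rule holo_fun_onI[where f' = "\<lambda>x h. dir_deriv (s' x h) f (s x)"])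
  show "((\<lambda>x. f (s x)) has_derivative (\<lambda>h. dir_deriv (s' x h) f (s x))) (at x)" if "x \<in> S" for x
    using has_derivative_compose[OF s[OF that] holo_fun_on_has_derivative] assms that by blast
qed (use assms in \<open>auto simp: dir_deriv_scalar_mult\<close>)

section \<open>Restriction to complex lines and Cauchy estimates\<close>

lemma holo_line_has_field_derivative:
  assumes "holo_fun_on f S" "open S" "x + \<zeta> *s v \<in> S"
  shows "((\<lambda>\<zeta>. f (x + \<zeta> *s v)) has_field_derivative dir_deriv v f (x + \<zeta> *s v)) (at \<zeta>)"
proof -
  have "((\<lambda>\<zeta>. x + \<zeta> *s v) has_derivative (\<lambda>\<zeta>. \<zeta> *s v)) (at \<zeta>)"
    using linear_vector_scalar_mult[of v]
    by (auto intro!: derivative_eq_intros bounded_linear_imp_has_derivative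
        simp: linear_conv_bounded_linear)
  from has_derivative_compose[OF this holo_fun_on_has_derivative[OF assms]]
  show ?thesis
    using dir_deriv_scalar_mult[OF assms]
    by (simp add: has_field_derivative_def mult.commute[of _ "dir_deriv v f (x + \<zeta> *s v)"] )
qed

lemma open_line_preimage: "open S \<Longrightarrow> open {\<zeta>. x + \<zeta> *s (v :: complex ^ 'n) \<in> S}"
proof -
  assume "open S"
  have "continuous_on UNIV (\<lambda>\<zeta>. x + \<zeta> *s v)"
    using linear_vector_scalar_mult[of v]
    by (intro continuous_on_add continuous_on_const linear_continuous_on)
      (simp add: linear_conv_bounded_linear)
  from open_vimage[OF \<open>open S\<close> this] show ?thesis by (simp add: vimage_def)
qed

lemma holo_line_holomorphic_on:
  assumes "holo_fun_on f S" "open S"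
  shows "(\<lambda>\<zeta>. f (x + \<zeta> *s v)) holomorphic_on {\<zeta>. x + \<zeta> *s v \<in> S}"
  using holo_line_has_field_derivative[OF assms] holomorphic_on_open[OF open_line_preimage[OF assms(2)]]
  by fastforce

text \<open>Cauchy's inequality for the one-variable function along the line through
  \<open>x\<close> in direction \<open>v\<close>, on the disc of radius \<open>r / norm v\<close>,
  the largest one that the line maps into \<open>cball x r\<close>.\<close>

lemma dir_deriv_Cauchy_bound:
  assumes f: "holo_fun_on f S" "open S" and r: "cball x r \<subseteq> S" "0 < r"
    and M: "\<And>y. y \<in> cball x r \<Longrightarrow> cmod (f y) \<le> M"
  shows "cmod (dir_deriv v f x) \<le> M * norm v / r"
proof (cases "v = 0")
  case True
  have "x \<in> S" using r by auto
  then show ?thesis using True linear_0[OF dir_deriv_linear[OF f \<open>x \<in> S\<close>]] by simp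
next
  case False
  let ?\<phi> = "\<lambda>\<zeta>::complex. f (x + \<zeta> *s v)"
  let ?\<rho> = "r / norm v"
  have sub: "cball 0 ?\<rho> \<subseteq> {\<zeta>. x + \<zeta> *s v \<in> S}"
  proof
    fix \<zeta> :: complex assume "\<zeta> \<in> cball 0 ?\<rho>"
    then have "x + \<zeta> *s v \<in> cball x r"
      using False by (simp add: dist_norm norm_vector_scalar_mult field_simps)
    then show "\<zeta> \<in> {\<zeta>. x + \<zeta> *s v \<in> S}" using r by auto
  qed
  have hol: "?\<phi> holomorphic_on cball 0 ?\<rho>"
    using holo_line_holomorphic_on[OF f] sub holomorphic_on_subset by blast
  have "norm ((deriv ^^ 1) ?\<phi> 0) \<le> fact 1 * M / ?\<rho> ^ 1"
  proof (rule Cauchy_inequality)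
    show "?\<phi> holomorphic_on ball 0 ?\<rho>"
      using hol ball_subset_cball holomorphic_on_subset by blast
    show "continuous_on (cball 0 ?\<rho>) ?\<phi>"
      using hol holomorphic_on_imp_continuous_on by blast
    show "0 < ?\<rho>" using False r by simp
    show "norm (?\<phi> \<zeta>) \<le> M" if "norm (0 - \<zeta>) = ?\<rho>" for \<zeta>
      using that False by (intro M) (simp add: dist_norm norm_vector_scalar_mult)
  qed
  moreover have "deriv ?\<phi> 0 = dir_deriv v f x"
    using holo_line_has_field_derivative[OF f, of x 0 v] r(2) centre_in_cball[of x r] r(1)
    by (intro DERIV_imp_deriv) (simp add: subset_iff)
  ultimately show ?thesis by simp
qed

text \<open>Taylor's formula of order one along the complex line through \<open>x\<close> and
  \<open>x + h\<close>, from parameter 0 to parameter 1. With \<rho> = r / (2 |h|), Cauchy's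
  inequality bounds the second derivative by 2 M / \<rho>^2 = 8 M |h|^2 / r^2.\<close>

lemma holo_quadratic_remainder:
  assumes f: "holo_fun_on f S" "open S" and r: "cball x r \<subseteq> S" "0 < r"
    and M: "\<And>y. y \<in> cball x r \<Longrightarrow> cmod (f y) \<le> M" and h: "norm h \<le> r / 2"
  shows "cmod (f (x + h) - f x - dir_deriv h f x) \<le> 8 * M / r\<^sup>2 * (norm h)\<^sup>2"
proof (cases "h = 0")
  case True
  have "x \<in> S" using r by auto
  then show ?thesis using True linear_0[OF dir_deriv_linear[OF f \<open>x \<in> S\<close>]] by simp
next
  case False
  let ?\<phi> = "\<lambda>\<zeta>::complex. f (x + \<zeta> *s h)"
  let ?\<rho> = "r / (2 * norm h)"
  define U where "U = {\<zeta>. x + \<zeta> *s h \<in> S}"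
  have "open U" unfolding U_def using f(2) by (rule open_line_preimage)
  have hol: "?\<phi> holomorphic_on U"
    unfolding U_def using holo_line_holomorphic_on[OF f] .
  \<comment> \<open>A disc of radius \<open>?\<rho>\<close> about a point of the unit disc therefore
    stays within radius \<open>2 * ?\<rho>\<close>, where the line has not left
    \<open>cball x r\<close>.\<close>
  have \<rho>: "?\<rho> \<ge> 1" using h False by (simp add: field_simps)
  have in_cball: "x + \<zeta> *s h \<in> cball x r" if "norm \<zeta> \<le> 2 * ?\<rho>" for \<zeta>
    using that False by (simp add: dist_norm norm_vector_scalar_mult field_simps)
  have B: "norm ((deriv ^^ 2) ?\<phi> \<zeta>) \<le> 2 * M / ?\<rho>\<^sup>2" if "\<zeta> \<in> cball 0 1" for \<zeta>
  proof -
    have *: "norm \<eta> \<le> 2 * ?\<rho>" if "\<eta> \<in> cball \<zeta> ?\<rho>" for \<eta>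
    proof -
      have "norm \<eta> \<le> norm \<zeta> + dist \<zeta> \<eta>"
        by (metis dist_norm norm_minus_commute norm_triangle_sub)
      then show ?thesis using that \<open>\<zeta> \<in> cball 0 1\<close> \<rho> by auto
    qed
    have sub: "cball \<zeta> ?\<rho> \<subseteq> U"
      unfolding U_def using * in_cball r by blast
    have "norm ((deriv ^^ 2) ?\<phi> \<zeta>) \<le> fact 2 * M / ?\<rho> ^ 2"
    proof (rule Cauchy_inequality)
      show "?\<phi> holomorphic_on ball \<zeta> ?\<rho>"
        using hol sub ball_subset_cball holomorphic_on_subset by blast
      show "continuous_on (cball \<zeta> ?\<rho>) ?\<phi>"
        using hol sub holomorphic_on_imp_continuous_on continuous_on_subset by blast
      show "0 < ?\<rho>" using \<rho> by simp
      show "norm (?\<phi> \<eta>) \<le> M" if "norm (\<zeta> - \<eta>) = ?\<rho>" for \<eta>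
        by (intro M in_cball *) (use that in \<open>simp add: dist_norm\<close>)
    qed
    then show ?thesis by simp
  qed
  have sub1: "cball 0 1 \<subseteq> U"
    unfolding U_def using in_cball r \<rho> by (smt (verit) mem_Collect_eq mem_cball_0 subset_iff)
  have "norm ((deriv ^^ 0) ?\<phi> 1 - (\<Sum>i\<le>1. (deriv ^^ i) ?\<phi> 0 * (1 - 0) ^ i / fact i))
    \<le> 2 * M / ?\<rho>\<^sup>2 * norm (1 - 0 :: complex) ^ (Suc 1) / fact 1"
  proof (rule complex_Taylor[where S = "cball 0 1"])
    show "((deriv ^^ i) ?\<phi> has_field_derivative (deriv ^^ Suc i) ?\<phi> \<zeta>) (at \<zeta> within cball 0 1)"
      if "\<zeta> \<in> cball 0 1" "i \<le> 1" for i \<zeta>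
      using holomorphic_derivI[OF holomorphic_higher_deriv[OF hol \<open>open U\<close>] \<open>open U\<close>] sub1 that
      by auto
    show "norm ((deriv ^^ Suc 1) ?\<phi> \<zeta>) \<le> 2 * M / ?\<rho>\<^sup>2" if "\<zeta> \<in> cball 0 1" for \<zeta>
      using B[OF that] by (simp add: numeral_2_eq_2)
  qed auto
  moreover have "deriv ?\<phi> 0 = dir_deriv h f x"
    using holo_line_has_field_derivative[OF f, of x 0 h] r(2) centre_in_cball[of x r] r(1)
    by (intro DERIV_imp_deriv) (simp add: subset_iff)
  ultimately show ?thesis using False by (simp add: power_divide power_mult_distrib field_simps)
qed

text \<open>The bound on \<open>h\<close> replaces one factor \<open>norm h\<close> of the quadratic
  remainder by r / 2, which yields 4 M / r; the Cauchy bound for the derivative adds M / r.\<close>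

lemma holo_Lipschitz_bound:
  assumes f: "holo_fun_on f S" "open S" and r: "cball x r \<subseteq> S" "0 < r"
    and M: "\<And>y. y \<in> cball x r \<Longrightarrow> cmod (f y) \<le> M" and h: "norm h \<le> r / 2"
  shows "cmod (f (x + h) - f x) \<le> 5 * M / r * norm h"
proof -
  have "0 \<le> M" using M[of x] r by (smt (verit) centre_in_cball norm_ge_zero)
  have "cmod (f (x + h) - f x) \<le> cmod (f (x + h) - f x - dir_deriv h f x) + cmod (dir_deriv h f x)"
    by (metis norm_triangle_sub add.commute)
  also have "\<dots> \<le> 8 * M / r\<^sup>2 * (norm h)\<^sup>2 + M * norm h / r"
    using holo_quadratic_remainder[OF assms] dir_deriv_Cauchy_bound[OF f r M, where v = h] by simp
  also have "8 * M / r\<^sup>2 * (norm h)\<^sup>2 \<le> 8 * M / r\<^sup>2 * (r / 2 * norm h)"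
    using h \<open>0 \<le> M\<close> unfolding power2_eq_square by (intro mult_left_mono mult_right_mono) auto
  also have "8 * M / r\<^sup>2 * (r / 2 * norm h) + M * norm h / r = 5 * M / r * norm h"
    using r by (simp add: field_simps power2_eq_square)
  finally show ?thesis by simp
qed

section \<open>Locally uniform limits and iterated derivatives\<close>

lemma linear_compose_limit:
  fixes L :: "nat \<Rightarrow> 'a::real_vector \<Rightarrow> 'b::real_normed_vector"
  assumes "\<And>n. linear (L n)" "\<And>h. (\<lambda>n. L n h) \<longlonglongrightarrow> L' h"
  shows "linear L'"
proof (rule linearI)
  show "L' (a + b) = L' a + L' b" for a b
    using LIMSEQ_unique[OF assms(2)[of "a + b"]] tendsto_add[OF assms(2)[of a] assms(2)[of b]]
    by (simp add: linear_add[OF assms(1)])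
  show "L' (r *\<^sub>R b) = r *\<^sub>R L' b" for r b
    using LIMSEQ_unique[OF assms(2)[of "r *\<^sub>R b"]] tendsto_scaleR[OF tendsto_const assms(2)[of b]]
    by (simp add: linear_cmul[OF assms(1)])
qed

text \<open>Weierstrass' theorem. The Cauchy estimate makes the derivatives of the
  \<open>f n\<close> at a point a Cauchy sequence; the quadratic remainder bound, uniform in
  \<open>n\<close>, then passes to the limit and identifies the limit of the derivatives with the
  derivative of the limit.\<close>

lemma uniform_limit_holo:
  assumes "open S" and f: "\<And>n. holo_fun_on (f n) S"
    and lim: "\<And>x. x \<in> S \<Longrightarrow> \<exists>r>0. cball x r \<subseteq> S \<and> uniform_limit (cball x r) f g sequentially"
  shows "holo_fun_on g S" "\<And>x v. x \<in> S \<Longrightarrow> (\<lambda>n. dir_deriv v (f n) x) \<longlonglongrightarrow> dir_deriv v g x"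
proof -
  have main: "\<exists>g'. (g has_derivative g') (at x) \<and> (\<forall>c v. g' (c *s v) = c * g' v) \<and>
    (\<forall>v. (\<lambda>n. dir_deriv v (f n) x) \<longlonglongrightarrow> g' v)" if xS: "x \<in> S" for x
  proof -
    obtain r where r: "r > 0" "cball x r \<subseteq> S" and ul: "uniform_limit (cball x r) f g sequentially"
      using lim[OF xS] by blast
    have "Cauchy (\<lambda>n. dir_deriv v (f n) x)" for v
    proof (rule CauchyI)
      fix e :: real assume "e > 0"
      \<comment> \<open>Makes the Cauchy bound \<open>d * norm v / r\<close> smaller than
        \<open>e\<close>; the summand 1 covers the case \<open>v = 0\<close>.\<close>
      define d where "d = e * r / (1 + norm v)"
      have "d > 0" using \<open>e > 0\<close> r unfolding d_def by (simp add: add_pos_nonneg)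
      have "uniformly_Cauchy_on (cball x r) f"
        using ul uniformly_convergent_Cauchy uniformly_convergent_on_def by blast
      then obtain N where N: "\<And>y m n. y \<in> cball x r \<Longrightarrow> m \<ge> N \<Longrightarrow> n \<ge> N \<Longrightarrow> dist (f m y) (f n y) < d"
        using \<open>d > 0\<close> unfolding uniformly_Cauchy_on_def by meson
      have "cmod (dir_deriv v (f m) x - dir_deriv v (f n) x) < e" if "m \<ge> N" "n \<ge> N" for m n
      proof -
        have "((\<lambda>y. f m y - f n y) has_derivative (\<lambda>h. dir_deriv h (f m) x - dir_deriv h (f n) x)) (at x)"
          using f \<open>x \<in> S\<close> \<open>open S\<close> by (intro has_derivative_diff holo_fun_on_has_derivative)
        then have eq: "dir_deriv v (\<lambda>y. f m y - f n y) x = dir_deriv v (f m) x - dir_deriv v (f n) x"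
          by (rule dir_deriv_eq)
        have "cmod (dir_deriv v (\<lambda>y. f m y - f n y) x) \<le> d * norm v / r"
          by (rule dir_deriv_Cauchy_bound[OF holo_fun_on_diff[OF f f \<open>open S\<close>] \<open>open S\<close> r(2,1)])
            (use N that in \<open>fastforce simp: dist_norm less_imp_le\<close>)
        also have "\<dots> < e"
          using \<open>e > 0\<close> r unfolding d_def by (simp add: field_simps add_pos_nonneg)
        finally show ?thesis using eq by simp
      qed
      then show "\<exists>N. \<forall>m\<ge>N. \<forall>n\<ge>N. cmod (dir_deriv v (f m) x - dir_deriv v (f n) x) < e" by blast
    qed
    then have "\<forall>v. \<exists>l. (\<lambda>n. dir_deriv v (f n) x) \<longlonglongrightarrow> l"
      using Cauchy_convergent_iff convergent_def by blast
    then obtain g' where g': "\<And>v. (\<lambda>n. dir_deriv v (f n) x) \<longlonglongrightarrow> g' v" by metis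
    have lin: "linear g'"
      by (rule linear_compose_limit[OF _ g']) (use dir_deriv_linear[OF f \<open>open S\<close> that] in blast)
    have sc: "g' (c *s v) = c * g' v" for c v
      using LIMSEQ_unique[OF g'[of "c *s v"]] tendsto_mult[OF tendsto_const g'[of v], of c]
      by (simp add: dir_deriv_scalar_mult[OF f \<open>open S\<close> that])
    have "continuous_on (cball x r) (f n)" for n
      using holo_fun_on_continuous_on[OF f \<open>open S\<close>] r continuous_on_subset by blast
    then have "continuous_on (cball x r) g"
      using uniform_limit_theorem[OF _ ul] by simp
    then have "bounded (g ` cball x r)"
      using compact_continuous_image compact_imp_bounded compact_cball by blast
    then obtain M where M: "\<And>y. y \<in> cball x r \<Longrightarrow> cmod (g y) \<le> M"
      unfolding bounded_iff by blast
    \<comment> \<open>Eventually the \<open>f n\<close> are bounded by \<open>M + 1\<close> on the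
      ball, so the constant of the remainder bound does not depend on \<open>n\<close>.\<close>
    have ev: "\<forall>\<^sub>F n in sequentially. \<forall>y\<in>cball x r. dist (f n y) (g y) < 1"
      using ul unfolding uniform_limit_iff by (meson zero_less_one)
    have pt: "(\<lambda>n. f n y) \<longlonglongrightarrow> g y" if "y \<in> cball x r" for y
      using tendsto_uniform_limitI[OF ul that] .
    have "cmod (g (x + h) - g x - g' h) \<le> 8 * (M + 1) / r\<^sup>2 * (norm h)\<^sup>2" if h: "norm h \<le> r / 2" for h
    proof (rule tendsto_upperbound)
      show "(\<lambda>n. cmod (f n (x + h) - f n x - dir_deriv h (f n) x)) \<longlonglongrightarrow> cmod (g (x + h) - g x - g' h)"
        using h r by (intro tendsto_intros pt g') (auto simp: dist_norm)
      show "\<forall>\<^sub>F n in sequentially. cmod (f n (x + h) - f n x - dir_deriv h (f n) x)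
        \<le> 8 * (M + 1) / r\<^sup>2 * (norm h)\<^sup>2"
        using ev
      proof eventually_elim
        case (elim n)
        show ?case
        proof (rule holo_quadratic_remainder[OF f \<open>open S\<close> r(2,1) _ h])
          fix y assume y: "y \<in> cball x r"
          then have "cmod (f n y - g y) < 1" using elim by (simp add: dist_norm)
          then show "cmod (f n y) \<le> M + 1"
            using M[OF y] norm_triangle_sub[of "f n y" "g y"] by linarith
        qed
      qed
    qed auto
    then have "(g has_derivative g') (at x)"
      by (intro has_derivative_quadratic_remainder[OF lin, of "r / 2", where C = "8 * (M + 1) / r\<^sup>2"])
        (use r in \<open>simp_all del: times_divide_eq_left\<close>)
    then show ?thesis using sc g' by blast
  qed
  show "holo_fun_on g S" unfolding holo_fun_on_iff[OF \<open>open S\<close>] using main by blast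
  show "(\<lambda>n. dir_deriv v (f n) x) \<longlonglongrightarrow> dir_deriv v g x" if "x \<in> S" for x v
    using main[OF that] dir_deriv_eq by metis
qed

text \<open>Difference quotients with real step \<open>t n\<close> are holomorphic, and by the
  quadratic remainder bound they converge uniformly near each point, with an error of order
  \<open>t n\<close>. Weierstrass' theorem applies to their limit.\<close>

lemma holo_fun_on_dir_deriv:
  assumes f: "holo_fun_on f S" "open S"
  shows "holo_fun_on (dir_deriv v f) S"
proof (rule holo_fun_on_local[OF _ \<open>open S\<close>])
  fix x assume "x \<in> S"
  obtain e where "e > 0" "cball x e \<subseteq> S"
    using \<open>open S\<close> \<open>x \<in> S\<close> open_contains_cball by meson
  define r where "r = e / 2"
  have r: "r > 0" "cball x (2 * r) \<subseteq> S" unfolding r_def using \<open>e > 0\<close> \<open>cball x e \<subseteq> S\<close> by auto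
  have "bounded (f ` cball x (2 * r))"
    by (intro compact_imp_bounded compact_continuous_image compact_cball
        continuous_on_subset[OF holo_fun_on_continuous_on[OF f] r(2)])
  then obtain M where M: "\<And>y. y \<in> cball x (2 * r) \<Longrightarrow> cmod (f y) \<le> M"
    unfolding bounded_iff by blast
  have "0 \<le> M" using M[of x] r(1) by (smt (verit) centre_in_cball norm_ge_zero)
  \<comment> \<open>The offset \<open>N\<close> keeps the step vector \<open>t n *\<^sub>R v\<close>
    within r / 2 from the very first \<open>n\<close>, so that shifted points never leave the larger
    ball.\<close>
  obtain N :: nat where N: "2 * norm v / r < N" using reals_Archimedean2 by blast
  define t where "t n = 1 / real (N + n + 1)" for n
  have t: "t n > 0" "norm (t n *\<^sub>R v) \<le> r / 2" for n
  proof -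
    have "2 * norm v / r \<le> real (N + n + 1)" using N by linarith
    then show "norm (t n *\<^sub>R v) \<le> r / 2" using r(1) unfolding t_def by (simp add: field_simps)
  qed (simp add: t_def)
  have tlim: "t \<longlonglongrightarrow> 0"
    unfolding t_def using LIMSEQ_ignore_initial_segment[OF lim_inverse_n, of "N + 1"]
    by (simp add: inverse_eq_divide add_ac)
  define F where "F n y = complex_of_real (1 / t n) * (f (y + t n *\<^sub>R v) - f y)" for n y
  have sub: "cball y r \<subseteq> cball x (2 * r)" if "y \<in> ball x r" for y
    using that by (auto simp: cball_subset_cball_iff dist_commute)
  have "holo_fun_on (dir_deriv v f) (ball x r)"
  proof (rule uniform_limit_holo(1)[where f = F])
    show "holo_fun_on (F n) (ball x r)" for n
      unfolding F_def
    proof (intro holo_fun_on_cmult holo_fun_on_diff open_ball)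
      show "holo_fun_on (\<lambda>y. f (y + t n *\<^sub>R v)) (ball x r)"
      proof (rule holo_fun_on_compose[OF f, where s' = "\<lambda>_ h. h"])
        show "y + t n *\<^sub>R v \<in> S" if "y \<in> ball x r" for y
          using r sub[OF that] t(2)[of n] by (auto simp: subset_iff dist_norm)
      qed (auto intro!: derivative_eq_intros)
      show "holo_fun_on f (ball x r)"
        using r sub[of x] by (intro holo_fun_on_subset[OF f]) auto
    qed
    have "uniform_limit (ball x r) F (dir_deriv v f) sequentially"
      unfolding uniform_limit_iff
    proof (intro allI impI)
      fix e :: real assume "e > 0"
      have "(\<lambda>n. 8 * M / r\<^sup>2 * (norm v)\<^sup>2 * t n) \<longlonglongrightarrow> 8 * M / r\<^sup>2 * (norm v)\<^sup>2 * 0"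
        by (intro tendsto_mult tendsto_const tlim)
      then have "\<forall>\<^sub>F n in sequentially. 8 * M / r\<^sup>2 * (norm v)\<^sup>2 * t n < e"
        using \<open>e > 0\<close> by (intro order_tendstoD(2)) auto
      then show "\<forall>\<^sub>F n in sequentially. \<forall>y\<in>ball x r. dist (F n y) (dir_deriv v f y) < e"
      proof (eventually_elim, intro ballI)
        fix n y assume e: "8 * M / r\<^sup>2 * (norm v)\<^sup>2 * t n < e" and y: "y \<in> ball x r"
        have yS: "cball y r \<subseteq> S" using r sub[OF y] by blast
        have "cmod (f (y + t n *\<^sub>R v) - f y - dir_deriv (t n *\<^sub>R v) f y) \<le> 8 * M / r\<^sup>2 * (norm (t n *\<^sub>R v))\<^sup>2"
          by (rule holo_quadratic_remainder[OF f yS r(1) _ t(2)]) (use M sub[OF y] in blast)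
        moreover have "dir_deriv (t n *\<^sub>R v) f y = t n *\<^sub>R dir_deriv v f y"
          by (rule linear_cmul[OF dir_deriv_linear[OF f]]) (use yS r(1) in auto)
        moreover have "F n y - dir_deriv v f y =
           complex_of_real (1 / t n) * (f (y + t n *\<^sub>R v) - f y - t n *\<^sub>R dir_deriv v f y)"
          unfolding F_def using t(1)[of n] by (simp add: field_simps scaleR_conv_of_real)
        ultimately have "cmod (F n y - dir_deriv v f y) \<le> 1 / t n * (8 * M / r\<^sup>2 * (norm (t n *\<^sub>R v))\<^sup>2)"
          using t(1)[of n] by (simp only: norm_mult norm_of_real abs_of_pos zero_less_divide_1_iff)
            (intro mult_left_mono, simp_all)
        also have "\<dots> = 8 * M / r\<^sup>2 * (norm v)\<^sup>2 * t n"
          using t(1)[of n] by (simp add: power2_eq_square)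
        finally show "dist (F n y) (dir_deriv v f y) < e" using e by (simp add: dist_norm)
      qed
    qed
    then show "\<exists>ra>0. cball y ra \<subseteq> ball x r \<and> uniform_limit (cball y ra) F (dir_deriv v f) sequentially"
      if "y \<in> ball x r" for y
      using that open_contains_cball[of "ball x r"] uniform_limit_on_subset by blast
  qed auto
  then show "\<exists>T. open T \<and> x \<in> T \<and> holo_fun_on (dir_deriv v f) T"
    using r(1) by (intro exI[of _ "ball x r"]) auto
qed


section \<open>Determinants of block matrices\<close>

text \<open>Permutations are products of transpositions, so a multiplicative map that sends
  transpositions to transpositions preserves signs. Injectivity of \<open>t\<close> keeps a
  transposition of distinct points from becoming the identity.\<close>

lemma sign_hom:
  fixes \<Phi> :: "('a::finite \<Rightarrow> 'a) \<Rightarrow> 'b::finite \<Rightarrow> 'b"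
  assumes "p permutes UNIV" and id: "\<Phi> id = id" and "inj t"
    and comp: "\<And>p q. p permutes UNIV \<Longrightarrow> q permutes UNIV \<Longrightarrow> \<Phi> (p \<circ> q) = \<Phi> p \<circ> \<Phi> q"
    and trans: "\<And>a b. \<Phi> (Transposition.transpose a b) = Transposition.transpose (t a) (t b)"
    and perm: "\<And>p. p permutes UNIV \<Longrightarrow> \<Phi> p permutes UNIV"
  shows "sign (\<Phi> p) = sign p"
  using assms(1) finite
proof (induction rule: permutes_induct)
  case id
  show ?case by (simp only: assms(2) sign_id)
next
  case (swap a b p)
  have tr: "Transposition.transpose a b permutes UNIV" by (simp add: permutes_swap_id)
  have "permutation (\<Phi> p)" "permutation p" "permutation (Transposition.transpose a b)"
    "permutation (Transposition.transpose (t a) (t b))"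
    using perm[OF \<open>p permutes UNIV\<close>] \<open>p permutes UNIV\<close>
    by (auto intro: permutes_imp_permutation[OF finite] permutation_swap_id)
  then show ?case
    using swap comp[OF tr \<open>p permutes UNIV\<close>] \<open>inj t\<close>
    by (simp add: trans sign_compose sign_swap_id inj_eq del: o_apply)
qed

lemma sum_UNIV_Plus:
  "(\<Sum>k\<in>UNIV. f k) = (\<Sum>i\<in>UNIV. f (Inl i)) + (\<Sum>j\<in>UNIV. f (Inr j))"
  for f :: "'a::finite + 'b::finite \<Rightarrow> 'c::comm_monoid_add"
  by (subst UNIV_Plus_UNIV[symmetric], subst Plus_def, subst sum.union_disjoint)
    (auto simp: sum.reindex)

lemma prod_UNIV_Plus:
  "(\<Prod>k\<in>UNIV. f k) = (\<Prod>i\<in>UNIV. f (Inl i)) * (\<Prod>j\<in>UNIV. f (Inr j))"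
  for f :: "'a::finite + 'b::finite \<Rightarrow> 'c::comm_monoid_mult"
  by (subst UNIV_Plus_UNIV[symmetric], subst Plus_def, subst prod.union_disjoint)
    (auto simp: prod.reindex)

lemma map_sum_transpose:
  "map_sum (Transposition.transpose a b) id = Transposition.transpose (Inl a) (Inl b)"
  "map_sum id (Transposition.transpose c d) = Transposition.transpose (Inr c) (Inr d)"
proof -
  show "map_sum (Transposition.transpose a b) id = Transposition.transpose (Inl a) (Inl b)"
  proof
    show "map_sum (Transposition.transpose a b) id x = Transposition.transpose (Inl a) (Inl b) x" for x
      by (cases x) (auto simp: Transposition.transpose_def)
  qed
  show "map_sum id (Transposition.transpose c d) = Transposition.transpose (Inr c) (Inr d)"
  proof
    show "map_sum id (Transposition.transpose c d) x = Transposition.transpose (Inr c) (Inr d) x" for x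
      by (cases x) (auto simp: Transposition.transpose_def)
  qed
qed

lemma inj_imp_permutes_UNIV: "inj p \<Longrightarrow> p permutes UNIV" for p :: "'a::finite \<Rightarrow> 'a"
  by (intro bij_imp_permutes) (auto simp: finite_UNIV_inj_surj bij_def)

lemma map_sum_permutes:
  fixes q :: "'a::finite \<Rightarrow> 'a" and r :: "'b::finite \<Rightarrow> 'b"
  assumes "q permutes UNIV" "r permutes UNIV"
  shows "map_sum q r permutes UNIV"
proof -
  have "inj q" "inj r" using assms permutes_inj by blast+
  then have "inj (map_sum q r)"
    by (intro injI) (rename_tac x y, case_tac x; case_tac y; simp add: inj_eq)
  then show ?thesis by (rule inj_imp_permutes_UNIV)
qed

lemma sign_map_sum:
  fixes q :: "'a::finite \<Rightarrow> 'a" and r :: "'b::finite \<Rightarrow> 'b"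
  assumes "q permutes UNIV" "r permutes UNIV"
  shows "sign (map_sum q r) = sign q * sign r"
proof -
  have "map_sum q r = map_sum q id \<circ> map_sum id r"
    by (simp add: map_sum.comp)
  moreover have "permutation (map_sum q (id :: 'b \<Rightarrow> 'b))" "permutation (map_sum (id :: 'a \<Rightarrow> 'a) r)"
    using map_sum_permutes[OF assms(1) permutes_id] map_sum_permutes[OF permutes_id assms(2)]
    by (auto intro: permutes_imp_permutation[OF finite])
  moreover have "sign (map_sum q (id :: 'b \<Rightarrow> 'b)) = sign q"
    by (rule sign_hom[where \<Phi> = "\<lambda>q. map_sum q id" and t = Inl, OF assms(1)])
      (auto simp: map_sum.comp map_sum_transpose map_sum_permutes permutes_id map_sum.id)
  moreover have "sign (map_sum (id :: 'a \<Rightarrow> 'a) r) = sign r"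
    by (rule sign_hom[where \<Phi> = "\<lambda>r. map_sum id r" and t = Inr, OF assms(2)])
      (auto simp: map_sum.comp map_sum_transpose map_sum_permutes permutes_id map_sum.id)
  ultimately show ?thesis by (simp add: sign_compose)
qed

text \<open>On the right summand \<open>p\<close> is injective into a finite set of the same size,
  hence onto it; injectivity of \<open>p\<close> then leaves only the left summand as target for the
  left one.\<close>

lemma permutes_Plus_cases:
  fixes p :: "'a::finite + 'b::finite \<Rightarrow> 'a + 'b"
  assumes p: "p permutes UNIV" and Inr: "\<And>b. p (Inr b) \<in> range Inr"
  obtains q r where "q permutes UNIV" "r permutes UNIV" "p = map_sum q r"
proof -
  have inj: "inj p" using p by (simp add: permutes_inj)
  define r where "r b = projr (p (Inr b))" for b
  have r: "p (Inr b) = Inr (r b)" for b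
    unfolding r_def using Inr[of b] by auto
  have "inj r" using inj r by (metis injI injD sum.inject(2))
  then have "surj r" by (simp add: finite_UNIV_inj_surj)
  have Inl: "p (Inl a) \<in> range Inl" for a
  proof (cases "p (Inl a)")
    case (Inr b)
    then obtain b' where "b = r b'" using \<open>surj r\<close> by (metis surjD)
    then have "p (Inl a) = p (Inr b')" using r Inr by simp
    then show ?thesis using inj by (simp add: inj_eq)
  qed auto
  define q where "q a = projl (p (Inl a))" for a
  have q: "p (Inl a) = Inl (q a)" for a
    unfolding q_def using Inl[of a] by auto
  have "inj q" using inj q by (metis injI injD sum.inject(1))
  have "q permutes UNIV" "r permutes UNIV"
    using \<open>inj q\<close> \<open>inj r\<close> by (simp_all add: inj_imp_permutes_UNIV)
  moreover have "p = map_sum q r"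
  proof
    show "p x = map_sum q r x" for x by (cases x) (auto simp: q r)
  qed
  ultimately show thesis using that by blast
qed

text \<open>A permutation with a nonzero term in the Leibniz sum avoids the zero block, so it
  preserves the right summand and splits into one permutation of each summand.\<close>

lemma det_block_triangular:
  fixes M :: "'c::comm_ring_1 ^ ('a::finite + 'b::finite) ^ ('a + 'b)"
  assumes zero: "\<And>b a. M $ Inr b $ Inl a = 0"
  shows "det M = det (\<chi> i j. M $ Inl i $ Inl j :: 'c ^ 'a ^ 'a) * det (\<chi> i j. M $ Inr i $ Inr j :: 'c ^ 'b ^ 'b)"
proof -
  let ?t = "\<lambda>p. of_int (sign p) * (\<Prod>i\<in>UNIV. M $ i $ p i)"
  let ?P = "{p :: 'a + 'b \<Rightarrow> 'a + 'b. p permutes UNIV}"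
  let ?Q = "(\<lambda>(q, r). map_sum q r) ` ({q :: 'a \<Rightarrow> 'a. q permutes UNIV} \<times> {r :: 'b \<Rightarrow> 'b. r permutes UNIV})"
  have inj: "inj_on (\<lambda>(q, r). map_sum q r) ({q :: 'a \<Rightarrow> 'a. q permutes UNIV} \<times> {r :: 'b \<Rightarrow> 'b. r permutes UNIV})"
    by (auto simp: inj_on_def fun_eq_iff) (metis map_sum.simps sum.inject)+
  have "det M = sum ?t ?P" by (simp add: det_def)
  also have "\<dots> = sum ?t ?Q"
  proof (rule sum.mono_neutral_right)
    show "?Q \<subseteq> ?P" using map_sum_permutes by auto
    show "\<forall>p\<in>?P - ?Q. ?t p = 0"
    proof
      fix p assume p: "p \<in> ?P - ?Q"
      then have "\<not> (\<forall>b. p (Inr b) \<in> range Inr)"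
        using permutes_Plus_cases[of p] by (auto simp: image_iff) (metis)
      then obtain b a where "p (Inr b) = Inl a" by (metis rangeI sum.exhaust)
      then have "M $ Inr b $ p (Inr b) = 0" using zero by simp
      then have "(\<Prod>i\<in>UNIV. M $ i $ p i) = 0" by (intro prod_zero) auto
      then show "?t p = 0" by simp
    qed
  qed auto
  also have "\<dots> = (\<Sum>(q, r)\<in>{q. q permutes UNIV} \<times> {r. r permutes UNIV}. ?t (map_sum q r))"
    by (subst sum.reindex[OF inj]) (simp add: case_prod_unfold)
  also have "\<dots> = (\<Sum>(q, r)\<in>{q. q permutes UNIV} \<times> {r. r permutes UNIV}.
      (of_int (sign q) * (\<Prod>i\<in>UNIV. M $ Inl i $ Inl (q i))) *
      (of_int (sign r) * (\<Prod>i\<in>UNIV. M $ Inr i $ Inr (r i))))"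
    by (intro sum.cong refl) (auto simp: sign_map_sum prod_UNIV_Plus)
  also have "\<dots> = det (\<chi> i j. M $ Inl i $ Inl j :: 'c ^ 'a ^ 'a) * det (\<chi> i j. M $ Inr i $ Inr j :: 'c ^ 'b ^ 'b)"
    by (simp add: det_def sum_product sum.cartesian_product)
  finally show ?thesis .
qed

text \<open>The two index types may differ; conjugating permutations by \<open>e\<close> transports
  the Leibniz sum from one to the other.\<close>

lemma det_reindex:
  fixes A :: "'c::comm_ring_1 ^ 'a ^ 'a" and e :: "'b::finite \<Rightarrow> 'a::finite"
  assumes "bij e"
  shows "det (\<chi> i j. A $ e i $ e j) = det A"
proof -
  let ?\<Phi> = "\<lambda>p. inv e \<circ> p \<circ> e"
  have ie: "inv e (e x) = x" "e (inv e y) = y" for x y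
    using assms by (simp_all add: bij_is_inj bij_is_surj surj_f_inv_f)
  have perm: "?\<Phi> p permutes UNIV" if "p permutes UNIV" for p
    using that assms by (intro inj_imp_permutes_UNIV inj_compose)
      (auto simp: bij_imp_bij_inv permutes_inj bij_is_inj)
  have s: "sign (?\<Phi> p) = sign p" if "p permutes UNIV" for p
  proof (rule sign_hom[where t = "inv e", OF that])
    show "inv e \<circ> Transposition.transpose a b \<circ> e = Transposition.transpose (inv e a) (inv e b)" for a b
    proof
      fix x
      have "(e x = a) = (x = inv e a)" "(e x = b) = (x = inv e b)" by (metis ie)+
      then show "(inv e \<circ> Transposition.transpose a b \<circ> e) x = Transposition.transpose (inv e a) (inv e b) x"
        by (simp add: Transposition.transpose_def ie)
    qed
    show "inj (inv e)" using assms bij_imp_bij_inv bij_is_inj by blast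
  qed (use perm in \<open>auto simp: fun_eq_iff ie comp_def\<close>)
  have bij: "bij_betw ?\<Phi> {p. p permutes UNIV} {p. p permutes UNIV}"
  proof (rule bij_betwI[where g = "\<lambda>p. e \<circ> p \<circ> inv e"])
    show "(\<lambda>p. e \<circ> p \<circ> inv e) \<in> {p. p permutes UNIV} \<rightarrow> {p. p permutes UNIV}"
      using assms by (auto intro!: inj_imp_permutes_UNIV inj_compose simp: bij_imp_bij_inv permutes_inj bij_is_inj)
  qed (use perm in \<open>auto simp: fun_eq_iff ie comp_def\<close>)
  have "det (\<chi> i j. A $ e i $ e j) = (\<Sum>p\<in>{p. p permutes UNIV}. of_int (sign p) * (\<Prod>i\<in>UNIV. A $ e i $ e (p i)))"
    by (simp add: det_def)
  also have "\<dots> = (\<Sum>p\<in>{p. p permutes UNIV}. of_int (sign (?\<Phi> p)) * (\<Prod>i\<in>UNIV. A $ e i $ e (?\<Phi> p i)))"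
    by (rule sum.reindex_bij_betw[OF bij, symmetric])
  also have "\<dots> = (\<Sum>p\<in>{p. p permutes UNIV}. of_int (sign p) * (\<Prod>i\<in>UNIV. A $ i $ p i))"
  proof (intro sum.cong refl, goal_cases)
    case (1 p)
    have "(\<Prod>i\<in>UNIV. A $ e i $ p (e i)) = (\<Prod>i\<in>UNIV. A $ i $ p i)"
      by (rule prod.reindex_bij_betw[OF assms])
    then show ?case using 1 s by (simp add: ie)
  qed
  finally show ?thesis by (simp add: det_def)
qed

lemma det_of_real: "det (\<chi> i j. complex_of_real (A $ i $ j)) = complex_of_real (det (A :: real ^ 'n ^ 'n))"
  by (simp add: det_def)

text \<open>The matrix determinant lemma by bordering. For M = [I, u; -v, 1] and L = [I, 0; v, 1],
  both products are block triangular: M L has diagonal blocks I + u v and 1, L M has diagonal blocks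
  I and 1 + v u. Their determinants agree. The border is indexed by the one-element type
  \<open>1\<close>.\<close>

lemma det_rank_one_update:
  fixes u v :: "'c::comm_ring_1 ^ 'n"
  shows "det (\<chi> i j. of_bool (i = j) + u $ i * v $ j) = 1 + (\<Sum>i\<in>UNIV. v $ i * u $ i)"
proof -
  let ?d = "\<lambda>x. (of_bool x :: 'c)"
  define M :: "'c ^ ('n + 1) ^ ('n + 1)" where
    "M = (\<chi> i j. case i of Inl a \<Rightarrow> (case j of Inl b \<Rightarrow> ?d (a = b) | Inr _ \<Rightarrow> u $ a)
       | Inr _ \<Rightarrow> (case j of Inl b \<Rightarrow> - v $ b | Inr _ \<Rightarrow> 1))"
  define L :: "'c ^ ('n + 1) ^ ('n + 1)" where
    "L = (\<chi> i j. case i of Inl a \<Rightarrow> (case j of Inl b \<Rightarrow> ?d (a = b) | Inr _ \<Rightarrow> 0)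
       | Inr _ \<Rightarrow> (case j of Inl b \<Rightarrow> v $ b | Inr _ \<Rightarrow> 1))"
  have delta: "(\<Sum>k\<in>UNIV. ?d (i = k) * f k) = f i" "(\<Sum>k\<in>UNIV. f k * ?d (k = i)) = f i"
    for f :: "'n \<Rightarrow> 'c" and i
    by (simp_all add: of_bool_def if_distrib[of "\<lambda>x. x * y" for y] if_distrib[of "\<lambda>x. y * x" for y]
        cong: if_cong)
  have one: "(\<chi> i j. ?d (i = j)) = (mat 1 :: 'c ^ 'm::finite ^ 'm)"
    by (simp add: mat_def vec_eq_iff)
  have zero: "(L ** M) $ Inr b $ Inl a = 0" for a b
  proof -
    have "(L ** M) $ Inr b $ Inl a = (\<Sum>i\<in>UNIV. v $ i * ?d (i = a)) - v $ a"
      by (simp add: M_def L_def matrix_matrix_mult_def sum_UNIV_Plus UNIV_1)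
    then show ?thesis by (simp only: delta diff_self)
  qed
  have zero': "(M ** L) $ Inr b $ Inl a = 0" for a b
  proof -
    have "(M ** L) $ Inr b $ Inl a = v $ a - (\<Sum>i\<in>UNIV. v $ i * ?d (i = a))"
      by (simp add: M_def L_def matrix_matrix_mult_def sum_UNIV_Plus UNIV_1 sum_negf)
    then show ?thesis by (simp only: delta diff_self)
  qed
  have "det (M ** L) = det (\<chi> i j. ?d (i = j) + u $ i * v $ j)"
    by (subst det_block_triangular[OF zero'])
      (simp add: M_def L_def matrix_matrix_mult_def sum_UNIV_Plus delta det_1 algebra_simps)
  moreover have "det (L ** M) = det (mat 1 :: 'c ^ 'n ^ 'n) * (1 + (\<Sum>i\<in>UNIV. v $ i * u $ i))"
    by (subst det_block_triangular[OF zero])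
      (simp add: M_def L_def matrix_matrix_mult_def sum_UNIV_Plus delta det_1 one algebra_simps)
  ultimately show ?thesis by (simp add: det_mul mult.commute)
qed


section \<open>Change of variables for holomorphic maps\<close>

text \<open>Real coordinates are indexed by \<open>'n bit0\<close>, which has twice as many elements
  as \<open>'n\<close> and carries a well-order of its own. Any bijection with
  \<open>'n + 'n\<close>, the real and imaginary parts, serves, so one is chosen.\<close>

definition real_index :: "'n::finite bit0 \<Rightarrow> 'n + 'n" where
  "real_index = (SOME e. bij e)"

lemma bij_real_index: "bij (real_index :: 'n::finite bit0 \<Rightarrow> 'n + 'n)"
proof -
  have "card (UNIV :: 'n bit0 set) = card (UNIV :: ('n + 'n) set)" by simp
  then have "\<exists>e. bij (e :: 'n bit0 \<Rightarrow> 'n + 'n)"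
    using finite_same_card_bij[of "UNIV :: 'n bit0 set" "UNIV :: ('n + 'n) set"] by auto
  then show ?thesis unfolding real_index_def by (rule someI_ex)
qed

lemma real_index_inv [simp]:
  "inv real_index (real_index k) = k" "real_index (inv real_index j) = j"
  by (simp_all add: bij_is_inj[OF bij_real_index] bij_is_surj[OF bij_real_index] surj_f_inv_f)

definition realify :: "complex ^ 'n \<Rightarrow> real ^ ('n bit0)" where
  "realify z = (\<chi> k. case real_index k of Inl i \<Rightarrow> Re (z $ i) | Inr i \<Rightarrow> Im (z $ i))"

definition unrealify :: "real ^ ('n bit0) \<Rightarrow> complex ^ 'n" where
  "unrealify x = (\<chi> i. Complex (x $ inv real_index (Inl i)) (x $ inv real_index (Inr i)))"

lemma unrealify_realify [simp]: "unrealify (realify z) = z"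
  by (simp add: vec_eq_iff unrealify_def realify_def complex_eq_iff)

lemma realify_unrealify [simp]: "realify (unrealify x) = x"
proof -
  have "realify (unrealify x) $ k = x $ k" for k
  proof -
    have "k = inv real_index (real_index k)" by simp
    then show ?thesis
      by (auto simp: unrealify_def realify_def split: sum.splits) (metis real_index_inv(1))+
  qed
  then show ?thesis by (simp add: vec_eq_iff)
qed

lemma linear_realify: "linear realify"
  by (rule linearI) (auto simp: realify_def vec_eq_iff split: sum.splits)

lemma linear_unrealify: "linear unrealify"
  by (rule linearI) (auto simp: unrealify_def vec_eq_iff complex_eq_iff)

lemma continuous_on_realify: "continuous_on A realify"
  by (simp add: linear_continuous_on linear_conv_bounded_linear[symmetric] linear_realify)

lemma continuous_on_unrealify: "continuous_on A unrealify"
  by (simp add: linear_continuous_on linear_conv_bounded_linear[symmetric] linear_unrealify)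

lemma realify_measurable [measurable]: "realify \<in> borel_measurable borel"
  by (simp add: borel_measurable_continuous_onI continuous_on_realify)

lemma unrealify_measurable [measurable]: "unrealify \<in> borel_measurable borel"
  by (simp add: borel_measurable_continuous_onI continuous_on_unrealify)

lemma realify_image: "realify ` A = unrealify -` A"
  by (auto simp: image_iff) (metis realify_unrealify)

lemma realify_image_borel: "A \<in> sets borel \<Longrightarrow> realify ` A \<in> sets borel"
  unfolding realify_image using measurable_sets[OF unrealify_measurable] by simp

lemma complex_Basis_bij:
  "bij_betw (case_sum (\<lambda>i. axis i 1) (\<lambda>i. axis i \<i>)) (UNIV :: ('n::finite + 'n) set)
    (Basis :: (complex ^ 'n) set)"
  unfolding bij_betw_def
proof
  show "inj (case_sum (\<lambda>i. axis i 1) (\<lambda>i. axis i \<i> :: complex ^ 'n))"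
    by (rule injI) (auto split: sum.splits simp: axis_eq_axis complex_eq_iff)
  show "range (case_sum (\<lambda>i. axis i 1) (\<lambda>i. axis i \<i>)) = (Basis :: (complex ^ 'n) set)"
    unfolding UNIV_sum image_Un image_image
    by (auto simp: Basis_vec_def Basis_complex_def)
qed

lemma real_Basis_bij:
  "bij_betw (\<lambda>k. axis k 1) UNIV (Basis :: (real ^ 'm) set)"
  by (auto simp: bij_betw_def inj_on_def axis_eq_axis Basis_vec_def)

text \<open>Taking real and imaginary parts matches boxes with boxes of the same side lengths, and
  Lebesgue measure is determined by its values on boxes.\<close>

lemma lborel_distr_realify: "lborel = distr lborel borel (realify :: complex ^ 'n \<Rightarrow> _)"
proof (rule lborel_eqI)
  fix l u :: "real ^ ('n bit0)"
  assume le: "\<And>b. b \<in> Basis \<Longrightarrow> l \<bullet> b \<le> u \<bullet> b"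
  have le': "l $ k \<le> u $ k" for k
    using le[of "axis k 1"] by (simp add: axis_in_Basis_iff inner_axis)
  have ind: "(\<forall>k. P (real_index k)) \<longleftrightarrow> (\<forall>j. P j)" for P :: "'n + 'n \<Rightarrow> bool"
    using bij_real_index by (metis real_index_inv(2))
  have "realify z \<in> box l u \<longleftrightarrow> z \<in> box (unrealify l) (unrealify u)" for z :: "complex ^ 'n"
  proof -
    let ?P = "\<lambda>j. l $ inv real_index j < (case j of Inl i \<Rightarrow> Re (z $ i) | Inr i \<Rightarrow> Im (z $ i)) \<and>
      (case j of Inl i \<Rightarrow> Re (z $ i) | Inr i \<Rightarrow> Im (z $ i)) < u $ inv real_index j"
    have "realify z \<in> box l u \<longleftrightarrow> (\<forall>k. ?P (real_index k))"
      by (simp add: mem_box_cart realify_def)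
    also have "\<dots> \<longleftrightarrow> (\<forall>j. ?P j)" by (rule ind)
    also have "\<dots> \<longleftrightarrow> (\<forall>b\<in>case_sum (\<lambda>i. axis i 1) (\<lambda>i. axis i \<i>) ` (UNIV :: ('n + 'n) set).
        unrealify l \<bullet> b < z \<bullet> b \<and> z \<bullet> b < unrealify u \<bullet> b)"
      unfolding ball_simps
      by (rule all_cong1 [THEN trans]) (auto split: sum.splits simp: inner_axis unrealify_def)
    finally show ?thesis
      unfolding bij_betw_imp_surj_on[OF complex_Basis_bij] mem_box .
  qed
  then have "emeasure (distr lborel borel (realify :: complex ^ 'n \<Rightarrow> _)) (box l u) =
      emeasure lborel (box (unrealify l :: complex ^ 'n) (unrealify u))"
    by (subst emeasure_distr) (auto intro!: arg_cong[where f = "emeasure lborel"])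
  also have "\<dots> = (\<Prod>b\<in>Basis. (unrealify u - unrealify l :: complex ^ 'n) \<bullet> b)"
  proof (rule emeasure_lborel_box)
    fix b :: "complex ^ 'n" assume "b \<in> Basis"
    then show "unrealify l \<bullet> b \<le> unrealify u \<bullet> b"
      by (auto simp: Basis_vec_def Basis_complex_def inner_axis unrealify_def le')
  qed
  also have "(\<Prod>b\<in>Basis. (unrealify u - unrealify l :: complex ^ 'n) \<bullet> b) =
      (\<Prod>j\<in>UNIV. (u - l) $ inv real_index (j :: 'n + 'n))"
    by (subst prod.reindex_bij_betw[OF complex_Basis_bij, symmetric])
      (auto intro!: prod.cong simp: inner_axis unrealify_def split: sum.splits)
  also have "\<dots> = (\<Prod>k\<in>UNIV. (u - l) $ k)"
    by (rule prod.reindex_bij_betw[OF bij_imp_bij_inv[OF bij_real_index]])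
  also have "\<dots> = (\<Prod>b\<in>Basis. (u - l) \<bullet> b)"
    by (subst prod.reindex_bij_betw[OF real_Basis_bij, symmetric]) (simp add: inner_axis)
  finally show "emeasure (distr lborel borel (realify :: complex ^ 'n \<Rightarrow> _)) (box l u) =
      (\<Prod>b\<in>Basis. (u - l) \<bullet> b)" by simp
qed simp

(* [I iI; I -iI] conjugates [X -Y; Y X], the real form of A = X + iY, to diag(A, conj A). *)
lemma det_realify:
  fixes A :: "complex ^ 'n \<Rightarrow> complex ^ 'n"
  assumes A: "\<And>c v. A (c *s v) = c *s A v"
  shows "det (matrix (realify \<circ> A \<circ> unrealify)) = (cmod (det (matrix A)))\<^sup>2"
proof -
  define R where "R = matrix (realify \<circ> A \<circ> unrealify)"
  define C :: "complex ^ ('n + 'n) ^ ('n + 'n)" where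
    "C = (\<chi> i j. complex_of_real (R $ inv real_index i $ inv real_index j))"
  define P :: "complex ^ ('n + 'n) ^ ('n + 'n)" where
    "P = (\<chi> i j. case i of
        Inl a \<Rightarrow> (case j of Inl b \<Rightarrow> (if a = b then 1 else 0) | Inr b \<Rightarrow> (if a = b then \<i> else 0))
      | Inr a \<Rightarrow> (case j of Inl b \<Rightarrow> (if a = b then 1 else 0) | Inr b \<Rightarrow> (if a = b then - \<i> else 0)))"
  define Q :: "complex ^ ('n + 'n) ^ ('n + 'n)" where
    "Q = (\<chi> i j. case i of
        Inl a \<Rightarrow> (case j of Inl b \<Rightarrow> (if a = b then 1 / 2 else 0) | Inr b \<Rightarrow> (if a = b then 1 / 2 else 0))
      | Inr a \<Rightarrow> (case j of Inl b \<Rightarrow> (if a = b then - \<i> / 2 else 0) | Inr b \<Rightarrow> (if a = b then \<i> / 2 else 0)))"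
  define B :: "complex ^ ('n + 'n) ^ ('n + 'n)" where
    "B = (\<chi> i j. case i of
        Inl a \<Rightarrow> (case j of Inl b \<Rightarrow> matrix A $ a $ b | Inr b \<Rightarrow> 0)
      | Inr a \<Rightarrow> (case j of Inl b \<Rightarrow> 0 | Inr b \<Rightarrow> cnj (matrix A $ a $ b)))"
  note delta = if_distrib[of "\<lambda>x. x * y" for y] if_distrib[of "\<lambda>x. y * x" for y]
  have axis_i: "axis j \<i> = \<i> *s (axis j 1 :: complex ^ 'n)" for j
    by (auto simp: vec_eq_iff axis_def)
  have un: "unrealify (axis (inv real_index (Inl j)) 1) = axis j 1"
    "unrealify (axis (inv real_index (Inr j)) 1) = axis j \<i>" for j :: 'n
    using bij_imp_bij_inv[OF bij_real_index[where 'n = 'n], THEN bij_is_inj]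
    by (auto simp: unrealify_def vec_eq_iff axis_def complex_eq_iff inj_eq)
  have R: "R $ k $ l = realify (A (unrealify (axis l 1))) $ k" for k l
    by (simp add: R_def matrix_def)
  have C_eq: "C $ Inl i $ Inl j = Re (matrix A $ i $ j)" "C $ Inr i $ Inl j = Im (matrix A $ i $ j)"
    "C $ Inl i $ Inr j = - Im (matrix A $ i $ j)" "C $ Inr i $ Inr j = Re (matrix A $ i $ j)" for i j
    by (simp_all add: C_def R un axis_i A realify_def matrix_def)
  have "P ** C = B ** P"
  proof -
    have "(P ** C) $ i $ j = (B ** P) $ i $ j" for i j
      by (cases i; cases j)
        (simp_all add: matrix_matrix_mult_def sum_UNIV_Plus P_def B_def C_eq delta cong: if_cong,
          simp_all add: complex_eq_iff)
    then show ?thesis by (simp add: vec_eq_iff)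
  qed
  moreover have "det P \<noteq> 0"
  proof -
    have "(P ** Q) $ i $ j = mat 1 $ i $ j" for i j
      by (cases i; cases j)
        (simp_all add: matrix_matrix_mult_def sum_UNIV_Plus P_def Q_def mat_def delta cong: if_cong)
    then have "P ** Q = mat 1" by (simp add: vec_eq_iff)
    then show ?thesis by (metis det_I det_mul mult_zero_left zero_neq_one)
  qed
  ultimately have "det C = det B" by (metis det_mul mult.commute mult_cancel_left)
  also have "\<dots> = det (matrix A) * cnj (det (matrix A))"
    by (subst det_block_triangular) (simp_all add: B_def det_def)
  finally have "det C = complex_of_real ((cmod (det (matrix A)))\<^sup>2)"
    by (simp only: complex_norm_square)
  moreover have "det C = complex_of_real (det R)"
    using det_reindex[OF bij_imp_bij_inv[OF bij_real_index], of R]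
      det_of_real[of "\<chi> i j. R $ inv real_index i $ inv real_index j"]
    by (simp add: C_def)
  ultimately show ?thesis unfolding R_def using of_real_eq_iff by metis
qed


section \<open>Substitution in integrals through real coordinates\<close>

lemma complex_linear_comp_realify:
  assumes "(s has_derivative s') (at (unrealify x))"
  shows "((realify \<circ> s \<circ> unrealify) has_derivative (realify \<circ> s' \<circ> unrealify)) (at x)"
proof -
  have "(unrealify has_derivative unrealify) (at x)"
    by (intro bounded_linear_imp_has_derivative) (simp add: linear_unrealify linear_conv_bounded_linear[symmetric])
  moreover have "(realify has_derivative realify) (at (s (unrealify x)))"
    by (intro bounded_linear_imp_has_derivative) (simp add: linear_realify linear_conv_bounded_linear[symmetric])
  ultimately show ?thesis
    using assms by (intro diff_chain_at) auto
qed

text \<open>The real substitution rule for the indicator of \<open>B\<close>, transported by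
  \<open>realify\<close>; \<open>det_realify\<close> turns the real Jacobian into the squared
  modulus of the complex one. Finite measure of \<open>B\<close> makes the indicator
  integrable.\<close>

lemma emeasure_holo_image:
  fixes s :: "complex ^ 'n \<Rightarrow> complex ^ 'n"
  assumes "open S" and s': "\<And>x. x \<in> S \<Longrightarrow> (s has_derivative s' x) (at x)"
    "\<And>x c v. x \<in> S \<Longrightarrow> s' x (c *s v) = c *s s' x v"
    and inj: "inj_on s S" and cont: "continuous_on S (\<lambda>x. det (matrix (s' x)))"
    and B: "B \<in> sets borel" "B \<subseteq> s ` S" "emeasure lborel B < \<infinity>"
  shows "emeasure lborel B =
    (\<integral>\<^sup>+x. ennreal (indicator S x * (cmod (det (matrix (s' x))))\<^sup>2 * indicator B (s x)) \<partial>lborel)"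
proof -
  define \<sigma> where "\<sigma> = realify \<circ> s \<circ> unrealify"
  define \<sigma>' where "\<sigma>' x = realify \<circ> s' (unrealify x) \<circ> unrealify" for x
  define L where "L = realify ` S"
  have L: "x \<in> L \<longleftrightarrow> unrealify x \<in> S" for x unfolding L_def realify_image by simp
  define h where "h x = indicator S x * (cmod (det (matrix (s' x))))\<^sup>2 * (indicator B (s x) :: real)" for x
  have contS: "continuous_on S s"
    using s'(1) by (meson continuous_at_imp_continuous_on has_derivative_continuous)
  have hmeas [measurable]: "h \<in> borel_measurable borel"
  proof -
    have 1: "(\<lambda>x. if x \<in> S then (cmod (det (matrix (s' x))))\<^sup>2 else 0) \<in> borel_measurable borel"
      using \<open>open S\<close> by (intro borel_measurable_continuous_on_if continuous_intros cont) auto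
    have 2: "(\<lambda>x. if x \<in> S then s x else 0) \<in> borel_measurable borel"
      using \<open>open S\<close> by (intro borel_measurable_continuous_on_if continuous_intros contS) auto
    have "(\<lambda>x. (if x \<in> S then (cmod (det (matrix (s' x))))\<^sup>2 else 0) *
        indicator B (if x \<in> S then s x else 0) :: real) \<in> borel_measurable borel"
      using B(1) by (intro borel_measurable_times 1 measurable_compose[OF 2] borel_measurable_indicator) simp
    moreover have "(\<lambda>x. (if x \<in> S then (cmod (det (matrix (s' x))))\<^sup>2 else 0) *
        indicator B (if x \<in> S then s x else 0) :: real) = h"
      by (auto simp: h_def fun_eq_iff)
    ultimately show ?thesis by simp
  qed
  have "S \<in> sets borel" using \<open>open S\<close> by simp
  then have Lb: "L \<in> sets borel" unfolding L_def by (rule realify_image_borel)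
  \<comment> \<open>The indicator takes values in \<open>real ^ 1\<close> because the real
    substitution rule is applied in its form for vector-valued functions.\<close>
  define f where "f y = indicator B (unrealify y) *\<^sub>R (1 :: real ^ 1)" for y
  define TB where "TB = realify ` B"
  have TB: "y \<in> TB \<longleftrightarrow> unrealify y \<in> B" for y unfolding TB_def realify_image by simp
  have TBb: "TB \<in> sets borel" unfolding TB_def using B(1) by (rule realify_image_borel)
  have TBe: "emeasure lborel TB = emeasure lborel B"
  proof -
    have "emeasure lborel TB = emeasure (distr lborel borel (realify :: complex ^ 'n \<Rightarrow> _)) TB"
      using lborel_distr_realify by metis
    also have "\<dots> = emeasure lborel (realify -` TB \<inter> space lborel)"
      using TBb by (intro emeasure_distr) auto
    also have "realify -` TB \<inter> space lborel = B"
      by (auto simp: TB)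
    finally show ?thesis .
  qed
  have f_ind: "f = (\<lambda>y. indicator TB y *\<^sub>R 1)" by (auto simp: f_def fun_eq_iff TB indicator_def)
  have \<sigma>L: "TB \<subseteq> \<sigma> ` L"
    using B(2) by (auto simp: TB_def \<sigma>_def L_def image_iff subset_iff) 
  have \<sigma>Lm: "\<sigma> ` L = realify ` s ` S" by (auto simp: \<sigma>_def L_def image_image)
  have int: "integrable lebesgue (\<lambda>y. indicator TB y *\<^sub>R (1 :: real ^ 1))"
    using TBb TBe B(3) by (intro integrable_indicator integrable_scaleR_left) auto
  have ind: "indicator (\<sigma> ` L) y *\<^sub>R f y = indicator TB y *\<^sub>R 1" for y
    using \<sigma>L by (auto simp: f_ind indicator_def)
  have sint: "f absolutely_integrable_on (\<sigma> ` L)"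
    unfolding set_integrable_def ind by (rule int)
  have "integral (\<sigma> ` L) f = (LINT y : \<sigma> ` L | lebesgue. f y)"
    using set_lebesgue_integral_eq_integral(2)[OF sint] by simp
  also have "\<dots> = measure lebesgue TB *\<^sub>R 1"
    unfolding set_lebesgue_integral_def ind
    using TBb TBe B(3) by (subst integral_scaleR_left) auto
  finally have int_f: "integral (\<sigma> ` L) f = measure lborel TB *\<^sub>R 1"
    using TBb by simp
  have "(\<lambda>x. \<bar>det (matrix (\<sigma>' x))\<bar> *\<^sub>R f (\<sigma> x)) absolutely_integrable_on L \<and>
      integral L (\<lambda>x. \<bar>det (matrix (\<sigma>' x))\<bar> *\<^sub>R f (\<sigma> x)) = measure lborel TB *\<^sub>R 1"
  proof (subst has_absolute_integral_change_of_variables)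
    show "L \<in> sets lebesgue" using Lb by simp
    show "(\<sigma> has_derivative \<sigma>' x) (at x within L)" if "x \<in> L" for x
      unfolding \<sigma>_def \<sigma>'_def
      by (rule has_derivative_at_withinI, rule complex_linear_comp_realify, rule s')
        (use that L in simp)
    show "inj_on \<sigma> L"
    proof (rule inj_onI)
      fix x y assume xy: "x \<in> L" "y \<in> L" "\<sigma> x = \<sigma> y"
      then have "s (unrealify x) = s (unrealify y)"
        unfolding \<sigma>_def o_def by (metis unrealify_realify)
      with xy have "unrealify x = unrealify y"
        using inj L by (simp add: inj_on_def)
      then show "x = y" by (metis realify_unrealify)
    qed
  qed (use sint int_f in blast)
  moreover have "indicator L x *\<^sub>R (\<bar>det (matrix (\<sigma>' x))\<bar> *\<^sub>R f (\<sigma> x)) = h (unrealify x) *\<^sub>R 1" for x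
    by (cases "x \<in> L") (simp_all add: L h_def f_def \<sigma>'_def \<sigma>_def det_realify s'(2))
  ultimately have i1: "integrable lebesgue (\<lambda>x. h (unrealify x) *\<^sub>R (1 :: real ^ 1))"
    and i2: "(LINT x|lebesgue. h (unrealify x) *\<^sub>R (1 :: real ^ 1)) = measure lborel TB *\<^sub>R 1"
    using set_lebesgue_integral_eq_integral(2)[of L "\<lambda>x. \<bar>det (matrix (\<sigma>' x))\<bar> *\<^sub>R f (\<sigma> x)"]
    unfolding set_integrable_def set_lebesgue_integral_def by simp_all
  have i3: "integrable lebesgue (\<lambda>x. h (unrealify x))"
    using integrable_bounded_linear[OF bounded_linear_vec_nth[of 1] i1] by simp
  have i4: "(LINT x|lebesgue. h (unrealify x)) = measure lborel TB"
    using integral_bounded_linear[OF bounded_linear_vec_nth[of 1] i1] i2 by simp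
  have "emeasure lborel B = ennreal (measure lborel TB)"
    using B(3) TBe by (metis emeasure_eq_ennreal_measure infinity_ennreal_def less_irrefl)
  also have "\<dots> = (\<integral>\<^sup>+x. ennreal (h (unrealify x)) \<partial>lebesgue)"
    unfolding i4[symmetric] by (rule nn_integral_eq_integral[symmetric, OF i3]) (simp add: h_def)
  also have "\<dots> = (\<integral>\<^sup>+x. ennreal (h (unrealify x)) \<partial>lborel)"
    by (rule nn_integral_completion)
  also have "\<dots> = (\<integral>\<^sup>+x. ennreal (h (unrealify x)) \<partial>distr lborel borel (realify :: complex ^ 'n \<Rightarrow> _))"
    using lborel_distr_realify by metis
  also have "\<dots> = (\<integral>\<^sup>+x. ennreal (h (unrealify (realify x))) \<partial>lborel)"
    by (rule nn_integral_distr) measurable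
  finally show ?thesis by (simp add: h_def)
qed

text \<open>At the level of measures the rule reads: \<open>s\<close> pushes the density |det s'|^2
  on \<open>S\<close> forward to Lebesgue measure on \<open>S\<close>. Integrability and the value
  of the integral, for every continuous \<open>g\<close>, follow from this one identity.\<close>

lemma holo_change_of_variables:
  fixes s :: "complex ^ 'n \<Rightarrow> complex ^ 'n" and g :: "complex ^ 'n \<Rightarrow> 'b::{banach, second_countable_topology}"
  assumes "open S" and s': "\<And>x. x \<in> S \<Longrightarrow> (s has_derivative s' x) (at x)"
    "\<And>x c v. x \<in> S \<Longrightarrow> s' x (c *s v) = c *s s' x v"
    and inj: "inj_on s S" and cont: "continuous_on S (\<lambda>x. det (matrix (s' x)))"
    and im: "s ` S = S" and fin: "emeasure lborel S < \<infinity>"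
    and g: "continuous_on S g"
  shows "set_integrable lborel S (\<lambda>x. (cmod (det (matrix (s' x))))\<^sup>2 *\<^sub>R g (s x)) \<longleftrightarrow> set_integrable lborel S g"
    and "(LINT x:S|lborel. (cmod (det (matrix (s' x))))\<^sup>2 *\<^sub>R g (s x)) = (LINT x:S|lborel. g x)"
proof -
  have Sb [measurable]: "S \<in> sets borel" using \<open>open S\<close> by simp
  have contS: "continuous_on S s"
    using s'(1) by (meson continuous_at_imp_continuous_on has_derivative_continuous)
  \<comment> \<open>Continuity is available on \<open>S\<close> only; the extensions by 0 are Borel
    on the whole space.\<close>
  define s0 where "s0 x = (if x \<in> S then s x else 0)" for x
  define \<rho> where "\<rho> x = (if x \<in> S then (cmod (det (matrix (s' x))))\<^sup>2 else 0)" for x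
  define g0 where "g0 x = (if x \<in> S then g x else 0)" for x
  have [measurable]: "s0 \<in> borel_measurable borel"
    unfolding s0_def by (intro borel_measurable_continuous_on_if continuous_intros contS Sb)
  have [measurable]: "\<rho> \<in> borel_measurable borel"
    unfolding \<rho>_def by (intro borel_measurable_continuous_on_if continuous_intros cont Sb)
  have [measurable]: "g0 \<in> borel_measurable borel"
    unfolding g0_def by (intro borel_measurable_continuous_on_if continuous_intros g Sb)
  have eq: "distr (density lborel \<rho>) borel s0 = density lborel (indicator S)"
  proof (rule measure_eqI)
    fix B assume "B \<in> sets (distr (density lborel \<rho>) borel s0)"
    then have B [measurable]: "B \<in> sets borel" by simp
    have fin': "emeasure lborel (B \<inter> S) < \<infinity>"
      using fin by (intro le_less_trans[OF emeasure_mono[of "B \<inter> S" S lborel]]) auto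
    have "emeasure (distr (density lborel \<rho>) borel s0) B = (\<integral>\<^sup>+x. ennreal (\<rho> x) * indicator (s0 -` B) x \<partial>lborel)"
    proof -
      have vB: "s0 -` B \<in> sets borel" by (rule measurable_sets_borel[of s0 borel]) auto
      have "emeasure (distr (density lborel \<rho>) borel s0) B = emeasure (density lborel \<rho>) (s0 -` B)"
        by (subst emeasure_distr) auto
      also have "\<dots> = (\<integral>\<^sup>+x. ennreal (\<rho> x) * indicator (s0 -` B) x \<partial>lborel)"
        by (rule emeasure_density) (use vB in auto)
      finally show ?thesis .
    qed
    also have "\<dots> = (\<integral>\<^sup>+x. ennreal (indicator S x * (cmod (det (matrix (s' x))))\<^sup>2 * indicator (B \<inter> S) (s x)) \<partial>lborel)"
      using im by (intro nn_integral_cong) (auto simp: \<rho>_def s0_def indicator_def)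
    also have "\<dots> = emeasure lborel (B \<inter> S)"
      by (rule emeasure_holo_image[OF assms(1) s' inj cont _ _ fin', symmetric]) (use im in auto)
    also have "\<dots> = emeasure (density lborel (indicator S)) B"
      by (subst emeasure_density) (auto simp: indicator_inter_arith[symmetric] Int_commute)
    finally show "emeasure (distr (density lborel \<rho>) borel s0) B = emeasure (density lborel (indicator S)) B" .
  qed simp
  have d: "density lborel (indicator S) = density lborel (\<lambda>x. ennreal (indicator S x))"
    by (simp add: ennreal_indicator)
  have e1: "\<rho> x *\<^sub>R g0 (s0 x) = indicator S x *\<^sub>R ((cmod (det (matrix (s' x))))\<^sup>2 *\<^sub>R g (s x))" for x
    using im by (auto simp: \<rho>_def g0_def s0_def)
  have e2: "indicator S x *\<^sub>R g0 x = indicator S x *\<^sub>R g x" for x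
    by (auto simp: g0_def)
  have "integrable (distr (density lborel \<rho>) borel s0) g0 \<longleftrightarrow>
      integrable lborel (\<lambda>x. \<rho> x *\<^sub>R g0 (s0 x))"
    by (subst integrable_distr_eq, simp_all, subst integrable_density) (auto simp: \<rho>_def)
  moreover have "integrable (density lborel (indicator S)) g0 \<longleftrightarrow>
      integrable lborel (\<lambda>x. indicator S x *\<^sub>R g0 x)"
    unfolding d by (subst integrable_density) auto
  ultimately show "set_integrable lborel S (\<lambda>x. (cmod (det (matrix (s' x))))\<^sup>2 *\<^sub>R g (s x)) \<longleftrightarrow> set_integrable lborel S g"
    unfolding set_integrable_def e1 e2 eq by simp
  have "integral\<^sup>L (distr (density lborel \<rho>) borel s0) g0 = (LINT x|lborel. \<rho> x *\<^sub>R g0 (s0 x))"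
    by (subst integral_distr, simp_all, subst integral_density) (auto simp: \<rho>_def)
  moreover have "integral\<^sup>L (density lborel (indicator S)) g0 = (LINT x|lborel. indicator S x *\<^sub>R g0 x)"
    unfolding d by (subst integral_density) auto
  ultimately show "(LINT x:S|lborel. (cmod (det (matrix (s' x))))\<^sup>2 *\<^sub>R g (s x)) = (LINT x:S|lborel. g x)"
    unfolding set_lebesgue_integral_def e1 e2 eq by simp
qed


section \<open>Mean value property on balls\<close>

text \<open>Cauchy's integral formula on the unit circle, where the velocity of the parametrisation
  cancels the denominator up to the factor 2 pi i.\<close>

lemma circle_mean_value:
  assumes "\<phi> holomorphic_on cball 0 1"
  shows "((\<lambda>t. \<phi> (exp (2 * of_real pi * \<i> * of_real t))) has_integral \<phi> 0) {0..1}"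
proof -
  have "((\<lambda>u. \<phi> u / (u - 0)) has_contour_integral (2 * of_real pi * \<i> * \<phi> 0)) (circlepath 0 1)"
    using assms by (intro Cauchy_integral_circlepath holomorphic_on_imp_continuous_on
        holomorphic_on_subset[OF assms]) auto
  then have "((\<lambda>t. 2 * of_real pi * \<i> * \<phi> (exp (2 * of_real pi * \<i> * of_real t)))
    has_integral (2 * of_real pi * \<i> * \<phi> 0)) {0..1}"
    unfolding has_contour_integral_def
    by (rule has_integral_eq[rotated]) (simp add: vector_derivative_circlepath01, simp add: circlepath)
  from has_integral_mult_right[OF this, of "1 / (2 * of_real pi * \<i>)"]
  show ?thesis by simp
qed

text \<open>Multiplication by \<open>c\<close> about the centre preserves the ball, and its
  determinant \<open>c ^ CARD('n)\<close> has modulus 1.\<close>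

lemma ball_rotation:
  fixes f :: "complex ^ 'n \<Rightarrow> complex"
  assumes c: "cmod c = 1" and f: "continuous_on (ball x r) f"
  shows "(LINT y:ball x r|lborel. f (x + c *s (y - x))) = (LINT y:ball x r|lborel. f y)"
proof -
  let ?s = "\<lambda>y. x + c *s (y - x)"
  have "c \<noteq> 0" using c by auto
  have lin: "bounded_linear (\<lambda>h :: complex ^ 'n. c *s h)"
    by (subst linear_conv_bounded_linear[symmetric], rule linearI) (auto simp: vec_eq_iff algebra_simps)
  have m: "det (matrix (\<lambda>h :: complex ^ 'n. c *s h)) = c ^ CARD('n)"
    by (subst det_diagonal) (auto simp: matrix_def axis_def)
  have d: "dist x (?s y) = dist x y" for y
  proof -
    have "x - ?s y = c *s (x - y)" by (simp add: vec_eq_iff algebra_simps)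
    then show ?thesis by (simp only: dist_norm norm_vector_scalar_mult c mult_1)
  qed
  have inv: "?s (x + (1 / c) *s (y - x)) = y" for y
    using \<open>c \<noteq> 0\<close> by (simp add: vec_eq_iff)
  have im: "?s ` ball x r = ball x r"
  proof
    show "ball x r \<subseteq> ?s ` ball x r"
    proof
      fix y assume "y \<in> ball x r"
      then have "x + (1 / c) *s (y - x) \<in> ball x r"
        using d[of "x + (1 / c) *s (y - x)"] inv[of y] by simp
      then show "y \<in> ?s ` ball x r" using inv[of y] by (metis imageI)
    qed
  qed (use d in auto)
  have "(LINT y:ball x r|lborel. (cmod (det (matrix (\<lambda>h :: complex ^ 'n. c *s h))))\<^sup>2 *\<^sub>R f (?s y)) =
      (LINT y:ball x r|lborel. f y)"
  proof (rule holo_change_of_variables(2)[where s = ?s and s' = "\<lambda>_ h. c *s h"])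
    show "(?s has_derivative (\<lambda>h. c *s h)) (at y)" for y
      by (rule has_derivative_eq_rhs, (rule derivative_intros bounded_linear.has_derivative[OF lin])+) auto
    show "inj_on ?s (ball x r)"
      using \<open>c \<noteq> 0\<close> by (auto simp: inj_on_def vec_eq_iff)
    show "emeasure lborel (ball x r) < \<infinity>" using emeasure_bounded_finite[of "ball x r"] by simp
    show "?s ` ball x r = ball x r" by (rule im)
  qed (auto simp: f vec_eq_iff)
  then show ?thesis by (simp add: m norm_power c)
qed

text \<open>Averaging the integral over all rotations exp (2 pi i t) about \<open>x\<close> does not
  change it. With the integrations exchanged, the inner integral is a circle mean on the complex
  line through \<open>x\<close> and \<open>y\<close>, hence equal to \<open>f x\<close> whatever
  \<open>y\<close> is.\<close>

lemma ball_mean_value: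
  fixes f :: "complex ^ 'n \<Rightarrow> complex"
  assumes f: "holo_fun_on f S" "open S" and r: "cball x r \<subseteq> S"
  shows "(LINT y:ball x r|lborel. f y) = measure lborel (ball x r) * f x"
proof -
  let ?e = "\<lambda>t::real. exp (2 * of_real pi * \<i> * of_real t)"
  let ?s = "\<lambda>t y. x + ?e t *s (y - x)"
  have e: "cmod (?e t) = 1" for t by (simp add: norm_exp_eq_Re)
  have d: "dist x (?s t y) = dist x y" for t y
  proof -
    have "x - ?s t y = ?e t *s (x - y)" by (simp add: vec_eq_iff algebra_simps)
    then show ?thesis by (simp only: dist_norm norm_vector_scalar_mult e mult_1)
  qed
  have cf: "continuous_on S f" using f by (rule holo_fun_on_continuous_on)
  have "bounded (f ` cball x r)"
    by (intro compact_imp_bounded compact_continuous_image compact_cball continuous_on_subset[OF cf r])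
  then obtain M where M: "\<And>y. y \<in> cball x r \<Longrightarrow> cmod (f y) \<le> M"
    unfolding bounded_iff by blast
  define g where "g = (\<lambda>t y. indicator ({0..1} \<times> ball x r) (t, y) *\<^sub>R f (?s t y))"
  have int: "integrable (lborel \<Otimes>\<^sub>M lborel) (case_prod g)"
  proof (rule integrableI_bounded_set[where A = "{0..1} \<times> ball x r" and B = M])
    show "{0..1::real} \<times> ball x r \<in> sets (lborel \<Otimes>\<^sub>M lborel)" by (intro pair_measureI) auto
    have cs: "continuous_on ({0..1} \<times> ball x r) (\<lambda>(t, y). ?s t y)"
      unfolding case_prod_unfold vector_scalar_mult_def
      by (intro continuous_intros)
    have "continuous_on ({0..1} \<times> ball x r) (\<lambda>z. f (case z of (t, y) \<Rightarrow> ?s t y))"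
    proof (rule continuous_on_compose2[OF cf cs])
      show "(\<lambda>(t, y). ?s t y) ` ({0..1} \<times> ball x r) \<subseteq> S"
      proof safe
        fix t :: real and y assume "y \<in> ball x r"
        then have "?s t y \<in> cball x r" using d[of t y] by simp
        then show "?s t y \<in> S" using r by blast
      qed
    qed
    then have "(\<lambda>z. indicator ({0..1} \<times> ball x r) z *\<^sub>R f (case z of (t, y) \<Rightarrow> ?s t y)) \<in> borel_measurable borel"
      by (intro borel_measurable_continuous_on_indicator) (auto intro: borel_closed borel_open borel_Times)
    then show "case_prod g \<in> borel_measurable (lborel \<Otimes>\<^sub>M lborel)"
      unfolding lborel_prod measurable_lborel2
      by (rule arg_cong[where f = "\<lambda>f. f \<in> borel_measurable borel", THEN iffD1, rotated])
        (auto simp: g_def fun_eq_iff)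
    show "emeasure (lborel \<Otimes>\<^sub>M lborel) ({0..1::real} \<times> ball x r) < \<infinity>"
      unfolding lborel_prod by (rule emeasure_bounded_finite) (intro bounded_Times, auto)
    show "AE z in lborel \<Otimes>\<^sub>M lborel. z \<in> {0..1} \<times> ball x r \<longrightarrow> norm (case_prod g z) \<le> M"
    proof (rule AE_I2, safe)
      fix t :: real and y assume "y \<in> ball x r"
      then have "?s t y \<in> cball x r" using d[of t y] by simp
      then have "cmod (f (?s t y)) \<le> M" by (rule M)
      moreover have "0 \<le> M" using calculation norm_ge_zero order_trans by blast
      ultimately show "norm (g t y) \<le> M" by (simp add: g_def indicator_def)
    qed
    show "AE z in lborel \<Otimes>\<^sub>M lborel. z \<notin> {0..1} \<times> ball x r \<longrightarrow> case_prod g z = 0"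
      by (intro AE_I2) (auto simp: g_def indicator_def)
  qed
  have 1: "(LINT y|lborel. g t y) = indicator {0..1} t *\<^sub>R (LINT y:ball x r|lborel. f y)" for t
  proof (cases "t \<in> {0..1}")
    case True
    then have "(LINT y|lborel. g t y) = (LINT y:ball x r|lborel. f (?s t y))"
      by (simp add: g_def set_lebesgue_integral_def indicator_times)
    also have "\<dots> = (LINT y:ball x r|lborel. f y)"
      by (rule ball_rotation[OF e continuous_on_subset[OF cf]]) (use r in auto)
    finally show ?thesis using True by simp
  qed (simp add: g_def indicator_times)
  have 2: "(LINT t|lborel. g t y) = indicator (ball x r) y *\<^sub>R f x" for y
  proof (cases "y \<in> ball x r")
    case True
    let ?\<phi> = "\<lambda>\<zeta>. f (x + \<zeta> *s (y - x))"
    have "?\<phi> holomorphic_on cball 0 1"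
    proof (rule holomorphic_on_subset[OF holo_line_holomorphic_on[OF f]], safe)
      fix \<zeta> :: complex assume "\<zeta> \<in> cball 0 1"
      then have "cmod \<zeta> * norm (y - x) \<le> 1 * norm (y - x)" by (intro mult_right_mono) auto
      moreover have "dist x (x + \<zeta> *s (y - x)) = cmod \<zeta> * norm (y - x)"
        unfolding norm_vector_scalar_mult[symmetric] by (simp add: dist_norm del: vector_ssub_ldistrib)
      ultimately have "x + \<zeta> *s (y - x) \<in> cball x r"
        using True by (simp add: dist_norm norm_minus_commute)
      then show "x + \<zeta> *s (y - x) \<in> S" using r by blast
    qed
    from circle_mean_value[OF this] have hi: "((\<lambda>t. f (?s t y)) has_integral f x) {0..1}" by simp
    have "set_integrable lborel {0..1} (\<lambda>t. f (?s t y))"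
    proof (rule borel_integrable_compact[unfolded set_integrable_def[symmetric]])
      show "continuous_on {0..1} (\<lambda>t. f (?s t y))"
      proof (rule continuous_on_compose2[OF cf])
        show "continuous_on {0..1} (\<lambda>t. ?s t y)"
          unfolding vector_scalar_mult_def by (intro continuous_intros)
        show "(\<lambda>t. ?s t y) ` {0..1} \<subseteq> S"
        proof safe
          fix t :: real
          have "?s t y \<in> cball x r" using d[of t y] True by simp
          then show "?s t y \<in> S" using r by blast
        qed
      qed
    qed auto
    from set_borel_integral_eq_integral(2)[OF this] integral_unique[OF hi]
    have "(LINT t:{0..1}|lborel. f (?s t y)) = f x" by simp
    then show ?thesis using True by (simp add: g_def set_lebesgue_integral_def indicator_times)
  qed (simp add: g_def indicator_times)
  have "(LINT y|lborel. (LINT t|lborel. g t y)) = (LINT t|lborel. (LINT y|lborel. g t y))"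
    by (rule lborel_pair.Fubini_integral[OF int])
  then have "(LINT y:ball x r|lborel. f x) = (LINT t:{0..1::real}|lborel. (LINT y:ball x r|lborel. f y))"
    unfolding 1 2 by (simp add: set_lebesgue_integral_def)
  moreover have "emeasure lborel (ball x r) < \<infinity>" using emeasure_bounded_finite[of "ball x r"] by simp
  ultimately show ?thesis by (simp add: set_integral_const scaleR_conv_of_real)
qed

text \<open>The mean value property is applied to f^2: the modulus of f^2 is already the integrand,
  so only the triangle inequality for integrals remains.\<close>

lemma square_cmod_sub_mean_value:
  fixes f :: "complex ^ 'n \<Rightarrow> complex"
  assumes f: "holo_fun_on f S" "open S" and r: "cball x r \<subseteq> S"
    and int: "set_integrable lborel S (\<lambda>y. (cmod (f y))\<^sup>2)"
  shows "(cmod (f x))\<^sup>2 * measure lborel (ball x r) \<le> (LINT y:S|lborel. (cmod (f y))\<^sup>2)"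
proof -
  have sub: "ball x r \<subseteq> S" using r by auto
  have eq: "(LINT y:ball x r|lborel. f y * f y) = measure lborel (ball x r) * (f x * f x)"
    by (rule ball_mean_value[OF holo_fun_on_mult[OF f(1) f(1,2)] f(2) r])
  have i: "set_integrable lborel (ball x r) (\<lambda>y. (cmod (f y))\<^sup>2)"
    by (rule set_integrable_subset[OF int]) (use sub in auto)
  have j: "set_integrable lborel (ball x r) (\<lambda>y. f y * f y)"
  proof (rule set_integrable_bound[OF i])
    show "set_borel_measurable lborel (ball x r) (\<lambda>y. f y * f y)"
      unfolding set_borel_measurable_def measurable_lborel2
      by (intro borel_measurable_continuous_on_indicator continuous_intros
          continuous_on_subset[OF holo_fun_on_continuous_on[OF f] sub]) auto
  qed (auto simp: norm_mult power2_eq_square)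
  have "(cmod (f x))\<^sup>2 * measure lborel (ball x r) = cmod (LINT y:ball x r|lborel. f y * f y)"
    unfolding eq by (simp add: norm_mult power2_eq_square)
  also have "\<dots> \<le> (LINT y:ball x r|lborel. cmod (f y * f y))"
    by (rule set_integral_norm_bound[OF j])
  also have "\<dots> = (LINT y:ball x r|lborel. (cmod (f y))\<^sup>2)"
    by (simp add: norm_mult power2_eq_square)
  also have "\<dots> \<le> (LINT y:S|lborel. (cmod (f y))\<^sup>2)"
    using i int sub unfolding set_lebesgue_integral_def set_integrable_def
    by (intro integral_mono) (auto simp: indicator_def)
  finally show ?thesis .
qed


section \<open>The Bergman space\<close>

text \<open>The mode of convergence that norm-Cauchy sequences in the Bergman space acquire;
  evaluations and derivatives at a point are continuous for it.\<close>

definition loc_uniform_limit :: "'a::metric_space set \<Rightarrow> (nat \<Rightarrow> 'a \<Rightarrow> 'b::metric_space) \<Rightarrow> ('a \<Rightarrow> 'b) \<Rightarrow> bool" where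
  "loc_uniform_limit S F f \<longleftrightarrow>
     (\<forall>x\<in>S. \<exists>r>0. cball x r \<subseteq> S \<and> uniform_limit (cball x r) F f sequentially)"

lemma loc_uniform_limit_imp_tendsto:
  assumes "loc_uniform_limit S F f" "x \<in> S"
  shows "(\<lambda>n. F n x) \<longlonglongrightarrow> f x"
proof -
  obtain r where r: "r > 0" and ul: "uniform_limit (cball x r) F f sequentially"
    using assms unfolding loc_uniform_limit_def by blast
  show ?thesis by (rule tendsto_uniform_limitI[OF ul]) (use r in simp)
qed

locale bounded_open_set =
  fixes \<Omega> :: "(complex ^ 'n) set"
  assumes open_\<Omega>: "open \<Omega>" and bounded_\<Omega>: "bounded \<Omega>"
begin

abbreviation A2 where "A2 \<equiv> bergman_space \<Omega>"

definition ip :: "(complex ^ 'n \<Rightarrow> complex) \<Rightarrow> (complex ^ 'n \<Rightarrow> complex) \<Rightarrow> complex" where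
  "ip f g = (LINT z:\<Omega>|lborel. f z * cnj (g z))"

definition sqn :: "(complex ^ 'n \<Rightarrow> complex) \<Rightarrow> real" where
  "sqn f = (LINT z:\<Omega>|lborel. (cmod (f z))\<^sup>2)"

lemma finite_\<Omega>: "emeasure lborel \<Omega> < \<infinity>"
  using emeasure_bounded_finite[OF bounded_\<Omega>] .

lemma A2_holo: "f \<in> A2 \<Longrightarrow> holo_fun_on f \<Omega>"
  and A2_int: "f \<in> A2 \<Longrightarrow> set_integrable lborel \<Omega> (\<lambda>z. (cmod (f z))\<^sup>2)"
  and A2_off: "f \<in> A2 \<Longrightarrow> z \<notin> \<Omega> \<Longrightarrow> f z = 0"
  by (auto simp: bergman_space_def)

lemma A2_cont: "f \<in> A2 \<Longrightarrow> continuous_on \<Omega> f"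
  using A2_holo holo_fun_on_continuous_on open_\<Omega> by blast

lemma set_measurable_continuous:
  fixes h :: "complex ^ 'n \<Rightarrow> 'b::real_normed_vector"
  assumes "continuous_on \<Omega> h"
  shows "set_borel_measurable lborel \<Omega> h"
  unfolding set_borel_measurable_def measurable_lborel2
  using assms open_\<Omega> by (intro borel_measurable_continuous_on_indicator) auto

text \<open>The source of test functions: constants and coordinate functions are bounded on a
  bounded set, and the cut-off to 0 matches the normalisation built into the space.\<close>

lemma A2_bounded:
  assumes "holo_fun_on f \<Omega>" "\<And>z. z \<in> \<Omega> \<Longrightarrow> cmod (f z) \<le> M"
  shows "(\<lambda>z. if z \<in> \<Omega> then f z else 0) \<in> A2"
proof -
  have "set_integrable lborel \<Omega> (\<lambda>z. M\<^sup>2)"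
    using finite_\<Omega> open_\<Omega> unfolding set_integrable_def by (intro integrable_scaleR_left integrable_indicator) auto
  then have "set_integrable lborel \<Omega> (\<lambda>z. (cmod (f z))\<^sup>2)"
  proof (rule set_integrable_bound)
    show "set_borel_measurable lborel \<Omega> (\<lambda>z. (cmod (f z))\<^sup>2)"
      using holo_fun_on_continuous_on[OF assms(1) open_\<Omega>]
      by (intro set_measurable_continuous continuous_intros)
    show "AE x in lborel. x \<in> \<Omega> \<longrightarrow> norm ((cmod (f x))\<^sup>2) \<le> norm (M\<^sup>2)"
      using assms(2) by (intro AE_I2) (auto intro!: power_mono)
  qed
  then have "set_integrable lborel \<Omega> (\<lambda>z. (cmod (if z \<in> \<Omega> then f z else 0))\<^sup>2)"
    by (rule set_integrable_cong[THEN iffD1, rotated -1]) auto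
  moreover have "holo_fun_on (\<lambda>z. if z \<in> \<Omega> then f z else 0) \<Omega>"
    by (rule holo_fun_on_cong[OF assms(1) open_\<Omega>]) simp
  ultimately show ?thesis by (simp add: bergman_space_def)
qed

lemma ip_int:
  assumes "f \<in> A2" "g \<in> A2"
  shows "set_integrable lborel \<Omega> (\<lambda>z. f z * cnj (g z))"
proof (rule set_integrable_bound)
  show "set_integrable lborel \<Omega> (\<lambda>z. (cmod (f z))\<^sup>2 + (cmod (g z))\<^sup>2)"
    using A2_int assms by (intro set_integral_add)
  show "set_borel_measurable lborel \<Omega> (\<lambda>z. f z * cnj (g z))"
    using assms by (intro set_measurable_continuous continuous_intros A2_cont)
  have "cmod (f z) * cmod (g z) \<le> (cmod (f z))\<^sup>2 + (cmod (g z))\<^sup>2" for z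
  proof -
    have "0 \<le> cmod (f z) * cmod (g z)" by simp
    moreover have "2 * (cmod (f z) * cmod (g z)) \<le> (cmod (f z))\<^sup>2 + (cmod (g z))\<^sup>2"
      using sum_squares_bound[of "cmod (f z)" "cmod (g z)"] by (simp only: mult.assoc)
    ultimately show ?thesis by linarith
  qed
  then show "AE x in lborel. x \<in> \<Omega> \<longrightarrow> norm (f x * cnj (g x)) \<le> norm ((cmod (f x))\<^sup>2 + (cmod (g x))\<^sup>2)"
    by (intro AE_I2) (auto simp: norm_mult)
qed

lemma A2_cmult: "f \<in> A2 \<Longrightarrow> (\<lambda>z. c * f z) \<in> A2"
  using open_\<Omega> by (auto simp: bergman_space_def norm_mult power_mult_distrib intro!: holo_fun_on_cmult)

lemma A2_add:
  assumes "f \<in> A2" "g \<in> A2"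
  shows "(\<lambda>z. f z + g z) \<in> A2"
proof -
  have "set_integrable lborel \<Omega> (\<lambda>z. (cmod (f z + g z))\<^sup>2)"
  proof (rule set_integrable_bound)
    show "set_integrable lborel \<Omega> (\<lambda>z. 2 * (cmod (f z))\<^sup>2 + 2 * (cmod (g z))\<^sup>2)"
      using A2_int assms by (intro set_integral_add set_integrable_mult_right)
    show "set_borel_measurable lborel \<Omega> (\<lambda>z. (cmod (f z + g z))\<^sup>2)"
      using assms by (intro set_measurable_continuous continuous_intros A2_cont)
    have "(cmod (f z + g z))\<^sup>2 \<le> 2 * (cmod (f z))\<^sup>2 + 2 * (cmod (g z))\<^sup>2" for z
    proof -
      have "(cmod (f z + g z))\<^sup>2 \<le> (cmod (f z) + cmod (g z))\<^sup>2"
        by (intro power_mono norm_triangle_ineq) auto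
      also have "\<dots> \<le> 2 * (cmod (f z))\<^sup>2 + 2 * (cmod (g z))\<^sup>2"
        using sum_squares_bound[of "cmod (f z)" "cmod (g z)"] by (simp add: power2_sum)
      finally show ?thesis .
    qed
    then show "AE x in lborel. x \<in> \<Omega> \<longrightarrow> norm ((cmod (f x + g x))\<^sup>2) \<le> norm (2 * (cmod (f x))\<^sup>2 + 2 * (cmod (g x))\<^sup>2)"
      by (intro AE_I2) auto
  qed
  then show ?thesis using assms open_\<Omega> by (auto simp: bergman_space_def intro!: holo_fun_on_add)
qed

lemma A2_diff: "f \<in> A2 \<Longrightarrow> g \<in> A2 \<Longrightarrow> (\<lambda>z. f z - g z) \<in> A2"
  using A2_add[OF _ A2_cmult[of g "-1"], of f] by simp

lemma ip_add_left: "f \<in> A2 \<Longrightarrow> g \<in> A2 \<Longrightarrow> h \<in> A2 \<Longrightarrow> ip (\<lambda>z. f z + g z) h = ip f h + ip g h"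
  unfolding ip_def by (subst set_integral_add(2)[symmetric]) (auto simp: ip_int distrib_right)

lemma ip_cmult_left: "ip (\<lambda>z. c * f z) h = c * ip f h"
  unfolding ip_def by (simp add: mult.assoc)

lemma ip_cnj: "ip g f = cnj (ip f g)"
proof -
  have "cnj (ip f g) = (LINT z|lborel. cnj (indicator \<Omega> z *\<^sub>R (f z * cnj (g z))))"
    unfolding ip_def set_lebesgue_integral_def by (rule Bochner_Integration.integral_cnj[symmetric])
  also have "\<dots> = ip g f"
    unfolding ip_def set_lebesgue_integral_def by (intro Bochner_Integration.integral_cong) (auto simp: mult.commute)
  finally show ?thesis by simp
qed

lemma ip_diff_left: "f \<in> A2 \<Longrightarrow> g \<in> A2 \<Longrightarrow> h \<in> A2 \<Longrightarrow> ip (\<lambda>z. f z - g z) h = ip f h - ip g h"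
  using ip_add_left[OF _ A2_cmult[of g "-1"], of f h] ip_cmult_left[of "-1" g h] by simp

lemma ip_cmult_right: "ip f (\<lambda>z. c * g z) = cnj c * ip f g"
  by (subst ip_cnj) (simp add: ip_cmult_left ip_cnj[of f g])

lemma ip_add_right: "f \<in> A2 \<Longrightarrow> g \<in> A2 \<Longrightarrow> h \<in> A2 \<Longrightarrow> ip h (\<lambda>z. f z + g z) = ip h f + ip h g"
  by (subst (1 2 3) ip_cnj) (simp add: ip_add_left)

lemma ip_diff_right: "f \<in> A2 \<Longrightarrow> g \<in> A2 \<Longrightarrow> h \<in> A2 \<Longrightarrow> ip h (\<lambda>z. f z - g z) = ip h f - ip h g"
  by (subst (1 2 3) ip_cnj) (simp add: ip_diff_left)

lemma ip_self: "ip f f = of_real (sqn f)"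
proof -
  have "f z * cnj (f z) = of_real ((cmod (f z))\<^sup>2)" for z
    by (rule complex_norm_square[symmetric])
  then show ?thesis unfolding ip_def sqn_def by (simp only: set_integral_complex_of_real)
qed

lemma sqn_nonneg: "0 \<le> sqn f"
  unfolding sqn_def set_lebesgue_integral_def by (intro integral_nonneg_AE AE_I2) auto

lemma sqn_cmult: "sqn (\<lambda>z. c * f z) = (cmod c)\<^sup>2 * sqn f"
  unfolding sqn_def by (simp add: norm_mult power_mult_distrib)

lemma sqn_add:
  assumes "f \<in> A2" "g \<in> A2"
  shows "sqn (\<lambda>z. f z + g z) = sqn f + sqn g + 2 * Re (ip f g)"
proof -
  have "complex_of_real (sqn (\<lambda>z. f z + g z)) = ip f f + ip g g + (ip f g + cnj (ip f g))"
    using assms by (simp add: ip_self[symmetric] ip_add_left ip_add_right A2_add ip_cnj[of g f])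
  also have "\<dots> = complex_of_real (sqn f + sqn g + 2 * Re (ip f g))"
    by (simp add: ip_self complex_add_cnj)
  finally show ?thesis using of_real_eq_iff by blast
qed

lemma sqn_diff:
  assumes "f \<in> A2" "g \<in> A2"
  shows "sqn (\<lambda>z. f z - g z) = sqn f + sqn g - 2 * Re (ip f g)"
  using sqn_add[OF assms(1) A2_cmult[OF assms(2), of "-1"]] sqn_cmult[of "-1" g] ip_cmult_right[of f "-1" g]
  by simp

text \<open>Evaluation is bounded in norm, uniformly over points at a fixed distance from the
  boundary; this is what turns norm convergence into locally uniform convergence.\<close>

lemma A2_bound:
  assumes "f \<in> A2" "cball x r \<subseteq> \<Omega>"
  shows "(cmod (f x))\<^sup>2 * measure lborel (ball x r) \<le> sqn f"
  unfolding sqn_def by (rule square_cmod_sub_mean_value[OF A2_holo open_\<Omega>]) (use assms A2_int in auto)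

lemma measure_ball: "measure lborel (ball x r) = measure lborel (ball (0 :: complex ^ 'n) r)" "r > 0 \<Longrightarrow> measure lborel (ball x r) > 0"
  for x :: "complex ^ 'n"
proof -
  show "measure lborel (ball x r) = measure lborel (ball (0 :: complex ^ 'n) r)"
  proof (cases "r \<ge> 0")
    case True
    show ?thesis
      by (rule trans[OF content_ball_conv_unit_ball[OF True] content_ball_conv_unit_ball[OF True, symmetric]])
  qed (simp add: ball_empty)
  show "r > 0 \<Longrightarrow> measure lborel (ball x r) > 0"
    using content_ball_pos[of r x] by simp
qed

lemma sqn_zero_imp: 
  assumes "f \<in> A2" "sqn f = 0"
  shows "f z = 0"
proof (cases "z \<in> \<Omega>")
  case True
  then obtain r where r: "r > 0" "cball z r \<subseteq> \<Omega>" using open_\<Omega> open_contains_cball by meson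
  show ?thesis
  proof (rule ccontr)
    assume "f z \<noteq> 0"
    then have "0 < (cmod (f z))\<^sup>2 * measure lborel (ball z r)"
      using measure_ball(2)[OF r(1)] by (intro mult_pos_pos) auto
    then show False using A2_bound[OF assms(1) r(2)] assms(2) by linarith
  qed
qed (use assms A2_off in auto)

text \<open>Completeness together with lower semicontinuity of the norm: Fatou's lemma makes the
  locally uniform limit square integrable and bounds its squared norm by \<open>C\<close>. A
  minimising sequence thus has a minimiser as its limit.\<close>

lemma A2_Cauchy_limit:
  assumes F: "\<And>n. F n \<in> A2"
    and Cauchy: "\<And>e. e > 0 \<Longrightarrow> \<exists>N. \<forall>m\<ge>N. \<forall>n\<ge>N. sqn (\<lambda>z. F m z - F n z) < e"
    and C: "\<And>e. e > 0 \<Longrightarrow> \<forall>\<^sub>F n in sequentially. sqn (F n) \<le> C + e"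
  obtains f where "f \<in> A2" "loc_uniform_limit \<Omega> F f" "sqn f \<le> C"
proof -
  have uc: "uniformly_Cauchy_on (cball x r) F" if r: "r > 0" "cball x (2 * r) \<subseteq> \<Omega>" for x r
    unfolding uniformly_Cauchy_on_def
  proof (intro allI impI)
    fix e :: real assume "e > 0"
    define V where "V = measure lborel (ball (0 :: complex ^ 'n) r)"
    have V: "V > 0" "measure lborel (ball y r) = V" for y :: "complex ^ 'n"
      unfolding V_def using r(1) measure_ball(2) measure_ball(1)[of y r] by auto
    obtain N where N: "\<And>m n. m \<ge> N \<Longrightarrow> n \<ge> N \<Longrightarrow> sqn (\<lambda>z. F m z - F n z) < e\<^sup>2 * V"
      using Cauchy[of "e\<^sup>2 * V"] \<open>e > 0\<close> V(1) by auto
    have "dist (F m y) (F n y) < e" if "y \<in> cball x r" "m \<ge> N" "n \<ge> N" for y m n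
    proof -
      have "cball y r \<subseteq> \<Omega>"
        using that(1) r(2) by (intro order_trans[OF _ r(2)]) (auto simp: cball_subset_cball_iff dist_commute)
      from A2_bound[OF A2_diff[OF F F] this, of m n]
      have "(cmod (F m y - F n y))\<^sup>2 * V < e\<^sup>2 * V" using N[OF that(2,3)] V(2) by simp
      then have "(cmod (F m y - F n y))\<^sup>2 < e\<^sup>2" using V(1) by simp
      then show ?thesis using \<open>e > 0\<close> by (simp add: dist_norm power2_less_imp_less)
    qed
    then show "\<exists>M. \<forall>y\<in>cball x r. \<forall>m\<ge>M. \<forall>n\<ge>M. dist (F m y) (F n y) < e" by blast
  qed
  have loc: "\<exists>r>0. cball x (2 * r) \<subseteq> \<Omega>" if x: "x \<in> \<Omega>" for x
  proof -
    obtain r where "r > 0" "cball x r \<subseteq> \<Omega>" using x open_\<Omega> open_contains_cball by meson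
    then show ?thesis by (intro exI[of _ "r / 2"]) auto
  qed
  have conv: "convergent (\<lambda>n. F n x)" for x
  proof (cases "x \<in> \<Omega>")
    case True
    then obtain r where r: "r > 0" "cball x (2 * r) \<subseteq> \<Omega>" using loc by blast
    obtain l where l: "uniform_limit (cball x r) F l sequentially"
      using Cauchy_uniformly_convergent[OF uc[OF r]] uniformly_convergent_on_def by blast
    have "(\<lambda>n. F n x) \<longlonglongrightarrow> l x" by (rule tendsto_uniform_limitI[OF l]) (use r(1) in simp)
    then show ?thesis by (rule convergentI)
  next
    case False
    then show ?thesis using A2_off[OF F] by (simp add: convergent_const)
  qed
  define f where "f x = lim (\<lambda>n. F n x)" for x
  have lim: "(\<lambda>n. F n x) \<longlonglongrightarrow> f x" for x
    unfolding f_def using conv convergent_LIMSEQ_iff by blast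
  have lul: "loc_uniform_limit \<Omega> F f"
    unfolding loc_uniform_limit_def
  proof
    fix x assume "x \<in> \<Omega>"
    then obtain r where r: "r > 0" "cball x (2 * r) \<subseteq> \<Omega>" using loc by blast
    obtain l where l: "uniform_limit (cball x r) F l sequentially"
      using Cauchy_uniformly_convergent[OF uc[OF r]] uniformly_convergent_on_def by blast
    have "l y = f y" if "y \<in> cball x r" for y
      using LIMSEQ_unique[OF tendsto_uniform_limitI[OF l that] lim] .
    then have "uniform_limit (cball x r) F f sequentially"
      using l by (metis (no_types, lifting) uniform_limit_cong')
    moreover have "cball x r \<subseteq> \<Omega>" using r by (auto simp: subset_iff)
    ultimately show "\<exists>r>0. cball x r \<subseteq> \<Omega> \<and> uniform_limit (cball x r) F f sequentially"
      using r(1) by blast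
  qed
  have holo: "holo_fun_on f \<Omega>"
    by (rule uniform_limit_holo(1)[where f = F, OF open_\<Omega> A2_holo[OF F]]) (use lul loc_uniform_limit_def in blast)
  have cont: "continuous_on \<Omega> f" using holo open_\<Omega> holo_fun_on_continuous_on by blast
  have nn: "(\<integral>\<^sup>+z. ennreal (indicator \<Omega> z * (cmod (h z))\<^sup>2) \<partial>lborel) = ennreal (sqn h)" if "h \<in> A2" for h
    unfolding sqn_def set_lebesgue_integral_def
    using A2_int[OF that, unfolded set_integrable_def] by (subst nn_integral_eq_integral) auto
  have meas: "(\<lambda>z. indicator \<Omega> z * (cmod (h z))\<^sup>2) \<in> borel_measurable lborel" if "continuous_on \<Omega> h" for h :: "complex ^ 'n \<Rightarrow> complex"
    using set_measurable_continuous[of "\<lambda>z. (cmod (h z))\<^sup>2"] that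
    by (simp add: set_borel_measurable_def continuous_intros)
  have bound: "(\<integral>\<^sup>+z. ennreal (indicator \<Omega> z * (cmod (f z))\<^sup>2) \<partial>lborel) \<le> ennreal (C + e)" if "e > 0" for e
  proof -
    have "(\<integral>\<^sup>+z. ennreal (indicator \<Omega> z * (cmod (f z))\<^sup>2) \<partial>lborel) =
        (\<integral>\<^sup>+z. liminf (\<lambda>n. ennreal (indicator \<Omega> z * (cmod (F n z))\<^sup>2)) \<partial>lborel)"
    proof (intro nn_integral_cong)
      fix z
      have "(\<lambda>n. ennreal (indicator \<Omega> z * (cmod (F n z))\<^sup>2)) \<longlonglongrightarrow> ennreal (indicator \<Omega> z * (cmod (f z))\<^sup>2)"
        by (intro tendsto_intros tendsto_ennrealI lim)
      then show "ennreal (indicator \<Omega> z * (cmod (f z))\<^sup>2) = liminf (\<lambda>n. ennreal (indicator \<Omega> z * (cmod (F n z))\<^sup>2))"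
        using lim_imp_Liminf[of sequentially] by (metis sequentially_bot)
    qed
    also have "\<dots> \<le> liminf (\<lambda>n. \<integral>\<^sup>+z. ennreal (indicator \<Omega> z * (cmod (F n z))\<^sup>2) \<partial>lborel)"
      by (intro nn_integral_liminf measurable_compose[OF meas measurable_ennreal] A2_cont F)
    also have "\<dots> \<le> ennreal (C + e)"
    proof -
      have "\<forall>\<^sub>F n in sequentially. (\<integral>\<^sup>+z. ennreal (indicator \<Omega> z * (cmod (F n z))\<^sup>2) \<partial>lborel) \<le> ennreal (C + e)"
        using C[OF that] by (rule eventually_mono) (simp add: nn[OF F] ennreal_leI)
      from Liminf_mono[OF this] show ?thesis by (simp add: Liminf_const)
    qed
    finally show ?thesis .
  qed
  have "integrable lborel (\<lambda>z. indicator \<Omega> z * (cmod (f z))\<^sup>2)"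
  proof (rule integrableI_bounded)
    show "(\<integral>\<^sup>+z. ennreal (norm (indicator \<Omega> z * (cmod (f z))\<^sup>2)) \<partial>lborel) < \<infinity>"
      using le_less_trans[OF bound[OF zero_less_one] ennreal_less_top] by simp
  qed (rule meas[OF cont])
  moreover have "f z = 0" if "z \<notin> \<Omega>" for z
    using lim[of z] A2_off[OF F that] by (simp add: LIMSEQ_const_iff)
  ultimately have f: "f \<in> A2"
    unfolding bergman_space_def set_integrable_def using holo by simp
  moreover have "sqn f \<le> C"
  proof (rule field_le_epsilon)
    fix e :: real assume "e > 0"
    then obtain n where "sqn (F n) \<le> C + e"
      using eventually_happens[OF C] by auto
    then have "0 \<le> C + e" using sqn_nonneg[of "F n"] by linarith
    then show "sqn f \<le> C + e" using bound[OF \<open>e > 0\<close>] unfolding nn[OF f] by simp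
  qed
  ultimately show thesis using that lul by blast
qed

lemma A2_zero: "(\<lambda>z. 0) \<in> A2"
  using A2_bounded[OF holo_fun_on_const[OF open_\<Omega>, of 0], of 0] by simp

text \<open>The element of least norm on the hyperplane \<open>\<l> = 1\<close> is orthogonal to the kernel of \<open>\<l>\<close>.\<close>

theorem A2_Riesz:
  assumes add: "\<And>f g. f \<in> A2 \<Longrightarrow> g \<in> A2 \<Longrightarrow> \<l> (\<lambda>z. f z + g z) = \<l> f + \<l> g"
    and cmult: "\<And>f c. f \<in> A2 \<Longrightarrow> \<l> (\<lambda>z. c * f z) = c * \<l> f"
    and cont: "\<And>F f. (\<And>n. F n \<in> A2) \<Longrightarrow> f \<in> A2 \<Longrightarrow> loc_uniform_limit \<Omega> F f \<Longrightarrow> (\<lambda>n. \<l> (F n)) \<longlonglongrightarrow> \<l> f"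
  obtains k where "k \<in> A2" "\<And>f. f \<in> A2 \<Longrightarrow> \<l> f = ip f k"
proof (cases "\<forall>f\<in>A2. \<l> f = 0")
  case True
  have "ip f (\<lambda>z. 0) = 0" for f by (simp add: ip_def)
  then show ?thesis using that[OF A2_zero] True by simp
next
  case False
  then obtain f0 where f0: "f0 \<in> A2" "\<l> f0 \<noteq> 0" by blast
  define E where "E = {f \<in> A2. \<l> f = 1}"
  have "\<l> (\<lambda>z. (1 / \<l> f0) * f0 z) = 1"
    using cmult[OF f0(1), of "1 / \<l> f0"] f0(2) by simp
  then have "(\<lambda>z. (1 / \<l> f0) * f0 z) \<in> E"
    unfolding E_def using A2_cmult[OF f0(1), of "1 / \<l> f0"] by blast
  then have "E \<noteq> {}" by blast
  define m where "m = Inf (sqn ` E)"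
  have bdd: "bdd_below (sqn ` E)" using sqn_nonneg by (auto intro!: bdd_belowI[of _ 0])
  have m_le: "m \<le> sqn f" if "f \<in> E" for f
    unfolding m_def using bdd that by (intro cInf_lower) auto
  have "\<exists>f\<in>E. sqn f < m + 1 / real (n + 1)" for n
  proof -
    have "m < m + 1 / real (n + 1)" by simp
    then show ?thesis unfolding m_def using cInf_lessD[of "sqn ` E"] \<open>E \<noteq> {}\<close> by blast
  qed
  then obtain F where F: "\<And>n. F n \<in> E" "\<And>n. sqn (F n) < m + 1 / real (n + 1)" by metis
  have FA: "F n \<in> A2" and Fl: "\<l> (F n) = 1" for n using F(1)[of n] by (auto simp: E_def)
  \<comment> \<open>The midpoint lies on the hyperplane, so its squared norm is at least
    \<open>m\<close>; the parallelogram law then forces a minimising sequence to be Cauchy.\<close>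
  have par: "sqn (\<lambda>z. F i z - F j z) \<le> 2 / real (i + 1) + 2 / real (j + 1)" for i j
  proof -
    let ?h = "\<lambda>z. (1 / 2) * (F i z + F j z)"
    have "\<l> ?h = 1"
      using cmult[OF A2_add[OF FA[of i] FA[of j]], of "1 / 2"] add[OF FA[of i] FA[of j]] Fl by simp
    then have "?h \<in> E"
      unfolding E_def using A2_cmult[OF A2_add[OF FA[of i] FA[of j]], of "1 / 2"] by blast
    then have "4 * m \<le> sqn (\<lambda>z. F i z + F j z)"
      using m_le[of ?h] sqn_cmult[of "1 / 2" "\<lambda>z. F i z + F j z"] by (simp add: power_divide norm_divide)
    then show ?thesis
      using sqn_add[OF FA[of i] FA[of j]] sqn_diff[OF FA[of i] FA[of j]] F(2)[of i] F(2)[of j] by simp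
  qed
  have ev: "\<exists>N. \<forall>n\<ge>N. 1 / real (n + 1) < e" if "e > 0" for e :: real
  proof -
    obtain N :: nat where N: "1 / e < real N" using reals_Archimedean2 by blast
    have "1 / real (n + 1) < e" if "n \<ge> N" for n
    proof -
      have "1 / e < real (n + 1)" using N that by linarith
      then show ?thesis using \<open>e > 0\<close> by (simp add: field_simps)
    qed
    then show ?thesis by blast
  qed
  obtain f where f: "f \<in> A2" "loc_uniform_limit \<Omega> F f" "sqn f \<le> m"
  proof (rule A2_Cauchy_limit[of F m, OF FA])
    fix e :: real assume "e > 0"
    then obtain N where N: "\<And>n. n \<ge> N \<Longrightarrow> 1 / real (n + 1) < e / 4" using ev[of "e / 4"] by auto
    have "sqn (\<lambda>z. F i z - F j z) < e" if "i \<ge> N" "j \<ge> N" for i j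
      using par[of i j] N[OF that(1)] N[OF that(2)] by simp
    then show "\<exists>N. \<forall>m\<ge>N. \<forall>n\<ge>N. sqn (\<lambda>z. F m z - F n z) < e" by blast
    show "\<forall>\<^sub>F n in sequentially. sqn (F n) \<le> m + e"
      unfolding eventually_sequentially using ev[OF \<open>e > 0\<close>] F(2) by (meson add_left_mono less_imp_le order_trans)
  qed
  have "(\<lambda>n. \<l> (F n)) \<longlonglongrightarrow> \<l> f" by (rule cont[OF FA f(1,2)])
  then have lf: "\<l> f = 1" unfolding Fl by (simp add: LIMSEQ_const_iff)
  have orth: "ip g f = 0" if g: "g \<in> A2" "\<l> g = 0" for g
  proof (rule ccontr)
    assume nz: "ip g f \<noteq> 0"
    let ?a = "ip g f"
    \<comment> \<open>With \<open>c\<close> = - t conj(a), moving from \<open>f\<close> to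
      \<open>f + c g\<close> changes the squared norm by t |a|^2 (t |g|^2 - 2). This is negative
      because t |g|^2 is at most 1, contradicting minimality.\<close>
    define t where "t = 1 / (1 + sqn g)"
    have t: "t > 0" "t * sqn g \<le> 1" using sqn_nonneg[of g] by (auto simp: t_def field_simps)
    define c where "c = - of_real t * cnj ?a"
    have "\<l> (\<lambda>z. f z + c * g z) = 1"
      using add[OF f(1) A2_cmult[OF g(1)], of c] cmult[OF g(1), of c] g(2) lf by simp
    then have "(\<lambda>z. f z + c * g z) \<in> E"
      unfolding E_def using A2_add[OF f(1) A2_cmult[OF g(1)], of c] by blast
    then have "m \<le> sqn (\<lambda>z. f z + c * g z)" by (rule m_le)
    then have "m \<le> sqn f + (cmod c)\<^sup>2 * sqn g + 2 * Re (cnj c * ip f g)"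
      using sqn_add[OF f(1) A2_cmult[OF g(1), of c]] by (simp add: sqn_cmult ip_cmult_right)
    also have "cnj c * ip f g = - of_real (t * (cmod ?a)\<^sup>2)"
      unfolding c_def ip_cnj[of f g] by (simp add: complex_norm_square[symmetric] del: of_real_power)
    also have "(cmod c)\<^sup>2 = t * t * (cmod ?a)\<^sup>2"
      using t(1) by (simp add: c_def norm_mult power2_eq_square)
    finally have "0 \<le> t * (cmod ?a)\<^sup>2 * (t * sqn g - 2)"
      using f(3) by (simp add: algebra_simps)
    moreover have "t * (cmod ?a)\<^sup>2 * (t * sqn g - 2) < 0"
      using t nz by (intro mult_pos_neg) auto
    ultimately show False by linarith
  qed
  have "sqn f \<noteq> 0"
  proof
    assume "sqn f = 0"
    then have "f = (\<lambda>z. 0 * f z)" using sqn_zero_imp[OF f(1)] by auto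
    then show False using cmult[OF f(1), of 0] lf by simp
  qed
  \<comment> \<open>Since \<open>\<l> f = 1\<close>, the function h - \<l>(h) f lies in the kernel
    of \<open>\<l>\<close> and is orthogonal to \<open>f\<close>; hence <h, f> = \<l>(h) |f|^2,
    which dictates the scaling.\<close>
  define k where "k z = of_real (1 / sqn f) * f z" for z
  have "\<l> h = ip h k" if h: "h \<in> A2" for h
  proof -
    have g: "(\<lambda>z. h z + (- \<l> h) * f z) \<in> A2" by (rule A2_add[OF h A2_cmult[OF f(1)]])
    have "\<l> (\<lambda>z. h z + (- \<l> h) * f z) = 0"
      using add[OF h A2_cmult[OF f(1)], of "- \<l> h"] cmult[OF f(1), of "- \<l> h"] lf by simp
    from orth[OF g this] have "ip h f = \<l> h * sqn f"
      using ip_add_left[OF h A2_cmult[OF f(1)] f(1), of "- \<l> h"] ip_cmult_left[of "- \<l> h" f f] ip_self[of f] by simp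
    then show ?thesis using \<open>sqn f \<noteq> 0\<close> unfolding k_def ip_cmult_right by simp
  qed
  moreover have "k \<in> A2" unfolding k_def by (rule A2_cmult[OF f(1)])
  ultimately show ?thesis using that by blast
qed

lemma A2_eval_cont:
  "loc_uniform_limit \<Omega> F f \<Longrightarrow> f \<in> A2 \<Longrightarrow> (\<And>n. F n \<in> A2) \<Longrightarrow> (\<lambda>n. F n w) \<longlonglongrightarrow> f w"
  by (cases "w \<in> \<Omega>") (auto simp: loc_uniform_limit_imp_tendsto A2_off[where f = f] A2_off[where f = "F n" for n])

text \<open>The arguments are swapped against \<open>bergman_kernel\<close>, so that the partial
  application \<open>ker w\<close> is the element representing evaluation at
  \<open>w\<close>.\<close>

definition ker :: "complex ^ 'n \<Rightarrow> complex ^ 'n \<Rightarrow> complex" where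
  "ker w z = bergman_kernel \<Omega> z w"

text \<open>Riesz gives a representing element, and the difference of two such elements is
  orthogonal to itself; the definite description in \<open>bergman_kernel\<close> therefore denotes
  it. For \<open>w\<close> outside \<Omega> the functional is zero and the argument is the
  same.\<close>

lemma ker_reproducing: "ker w \<in> A2" "f \<in> A2 \<Longrightarrow> f w = ip f (ker w)"
proof -
  let ?P = "\<lambda>k. k \<in> A2 \<and> (\<forall>f\<in>A2. f w = (LINT \<zeta>:\<Omega>|lborel. f \<zeta> * cnj (k \<zeta>)))"
  obtain k where k: "k \<in> A2" "\<And>f. f \<in> A2 \<Longrightarrow> f w = ip f k"
    by (rule A2_Riesz[of "\<lambda>f. f w"]) (use A2_eval_cont in auto)
  have "?P k" using k by (simp add: ip_def)
  moreover have "k' = k" if "?P k'" for k'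
  proof -
    have d: "(\<lambda>z. k' z - k z) \<in> A2" using that k by (intro A2_diff) auto
    have "ip (\<lambda>z. k' z - k z) (\<lambda>z. k' z - k z) = 0"
      using k(2)[OF d] that d ip_diff_right[OF _ k(1) d, of k'] by (simp add: ip_def)
    then have "sqn (\<lambda>z. k' z - k z) = 0" by (simp add: ip_self)
    from sqn_zero_imp[OF d this] show ?thesis by auto
  qed
  ultimately have "(THE k. ?P k) = k" by (rule the_equality)
  then have "ker w = k" unfolding ker_def bergman_kernel_def by (intro ext) simp
  then show "ker w \<in> A2" "f \<in> A2 \<Longrightarrow> f w = ip f (ker w)" using k by auto
qed

end


section \<open>The Bergman kernel on the doubled domain\<close>

definition join :: "complex ^ 'a \<Rightarrow> complex ^ 'b \<Rightarrow> complex ^ ('a::finite + 'b::finite)" where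
  "join z w = (\<chi> i. case i of Inl a \<Rightarrow> z $ a | Inr b \<Rightarrow> w $ b)"

definition cnjv :: "complex ^ 'n \<Rightarrow> complex ^ 'n" where
  "cnjv v = (\<chi> i. cnj (v $ i))"

lemma join_simps [simp]: "z_part (join z w) = z" "w_part (join z w) = w" "join (z_part x) (w_part x) = x"
  by (auto simp: join_def z_part_def w_part_def vec_eq_iff split: sum.splits)

lemma join_nth [simp]: "join z w $ Inl a = z $ a" "join z w $ Inr b = w $ b"
  by (simp_all add: join_def)

lemma cnjv_simps [simp]: "cnjv (cnjv v) = v" "cnjv v $ i = cnj (v $ i)" "norm (cnjv v) = norm v"
  "cnjv (a + b) = cnjv a + cnjv b" "cnjv (c *s v) = cnj c *s cnjv v" "cnjv 0 = 0"
  by (simp_all add: cnjv_def vec_eq_iff norm_vec_def)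

lemma parts_linear:
  "z_part (x + y) = z_part x + z_part y" "w_part (x + y) = w_part x + w_part y"
  "z_part (c *s x) = c *s z_part x" "w_part (c *s x) = c *s w_part x"
  "z_part (r *\<^sub>R x) = r *\<^sub>R z_part x" "w_part (r *\<^sub>R x) = r *\<^sub>R w_part x"
  by (simp_all add: z_part_def w_part_def vec_eq_iff)

lemma bounded_linear_z_part: "bounded_linear z_part"
  by (subst linear_conv_bounded_linear[symmetric]) (auto intro!: linearI simp: parts_linear)

lemma bounded_linear_w_part: "bounded_linear w_part"
  by (subst linear_conv_bounded_linear[symmetric]) (auto intro!: linearI simp: parts_linear)

lemma bounded_linear_cnjv: "bounded_linear cnjv"
  by (subst linear_conv_bounded_linear[symmetric]) (auto intro!: linearI simp: cnjv_def vec_eq_iff)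

lemma bounded_linear_join_cnjv: "bounded_linear (\<lambda>z. join z (cnjv z))"
  by (subst linear_conv_bounded_linear[symmetric])
    (auto intro!: linearI simp: join_def vec_eq_iff split: sum.splits)

lemma norm_parts: "norm (z_part x) \<le> norm x" "norm (w_part x) \<le> norm x"
proof -
  have "(norm x)\<^sup>2 = (norm (z_part x))\<^sup>2 + (norm (w_part x))\<^sup>2"
    by (simp add: norm_vec_def L2_set_def sum_nonneg sum_UNIV_Plus z_part_def w_part_def)
  then show "norm (z_part x) \<le> norm x" "norm (w_part x) \<le> norm x"
    by (metis norm_ge_zero power2_le_imp_le le_add_same_cancel1 zero_le_power2)
      (metis \<open>(norm x)\<^sup>2 = (norm (z_part x))\<^sup>2 + (norm (w_part x))\<^sup>2\<close> norm_ge_zero power2_le_imp_le le_add_same_cancel2 zero_le_power2)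
qed

lemma open_parts:
  assumes "open A" "open B"
  shows "open {x. z_part x \<in> A \<and> w_part x \<in> B}"
proof -
  have "{x. z_part x \<in> A \<and> w_part x \<in> B} = z_part -` A \<inter> w_part -` B" by auto
  then show ?thesis
    using assms by (auto intro!: open_Int open_vimage linear_continuous_on bounded_linear_z_part bounded_linear_w_part)
qed

text \<open>Osgood's lemma. The remainder splits into the Taylor remainder in \<open>z\<close> at
  height \<open>y + h2\<close>, the change of the \<open>z\<close>-derivative between the heights
  \<open>y\<close> and \<open>y + h2\<close>, and the Taylor remainder in \<open>w\<close> above
  \<open>x\<close>. The local bound makes all three quadratic in the increment.\<close>

lemma Osgood:
  fixes G :: "complex ^ 'a::finite \<Rightarrow> complex ^ 'b::finite \<Rightarrow> complex"
  assumes A: "open A" and B: "open B"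
    and G1: "\<And>w. w \<in> B \<Longrightarrow> holo_fun_on (\<lambda>z. G z w) A"
    and G2: "\<And>z. z \<in> A \<Longrightarrow> holo_fun_on (G z) B"
    and bdd: "\<And>z w. z \<in> A \<Longrightarrow> w \<in> B \<Longrightarrow> \<exists>r>0. \<exists>M. cball z r \<subseteq> A \<and> cball w r \<subseteq> B \<and>
      (\<forall>z'\<in>cball z r. \<forall>w'\<in>cball w r. cmod (G z' w') \<le> M)"
  shows "holo_fun_on (\<lambda>x. G (z_part x) (w_part x)) {x. z_part x \<in> A \<and> w_part x \<in> B}"
proof (rule holo_fun_onI[OF open_parts[OF A B],
      where f' = "\<lambda>x h. dir_deriv (z_part h) (\<lambda>z. G z (w_part x)) (z_part x)
        + dir_deriv (w_part h) (G (z_part x)) (w_part x)"])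
  fix p :: "complex ^ ('a + 'b)"
  assume "p \<in> {x. z_part x \<in> A \<and> w_part x \<in> B}"
  then have x: "z_part p \<in> A" and y: "w_part p \<in> B" by auto
  define x where "x = z_part p"
  define y where "y = w_part p"
  have xA: "x \<in> A" and yB: "y \<in> B" using x y by (auto simp: x_def y_def)
  obtain r M where r: "r > 0" "cball x r \<subseteq> A" "cball y r \<subseteq> B"
    and M: "\<And>z w. z \<in> cball x r \<Longrightarrow> w \<in> cball y r \<Longrightarrow> cmod (G z w) \<le> M"
    using bdd[OF xA yB] by blast
  define r2 where "r2 = r / 2"
  have r2: "r2 > 0" "cball y r2 \<subseteq> B" "cball x r2 \<subseteq> A" using r by (auto simp: r2_def)
  have "0 \<le> M" using M[of x y] r(1) norm_ge_zero order_trans by (metis centre_in_cball less_imp_le)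
  let ?D1 = "\<lambda>h. dir_deriv (z_part h) (\<lambda>z. G z y) x"
  let ?D2 = "\<lambda>h. dir_deriv (w_part h) (G x) y"
  have lin: "linear (\<lambda>h. ?D1 h + ?D2 h)"
  proof (rule linear_compose_add)
    show "linear ?D1" using linear_compose[OF bounded_linear.linear[OF bounded_linear_z_part] dir_deriv_linear[OF G1[OF yB] A xA]]
      by (simp add: o_def)
    show "linear ?D2" using linear_compose[OF bounded_linear.linear[OF bounded_linear_w_part] dir_deriv_linear[OF G2[OF xA] B yB]]
      by (simp add: o_def)
  qed
  have "((\<lambda>x. G (z_part x) (w_part x)) has_derivative (\<lambda>h. ?D1 h + ?D2 h)) (at p)"
  \<comment> \<open>The three parts add up to 8 + 5 + 8 = 21; the constant 100 is a comfortable
    bound for that.\<close>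
  proof (rule has_derivative_quadratic_remainder[OF lin, where r = "r / 4" and C = "100 * M / r\<^sup>2"])
    fix h :: "complex ^ ('a + 'b)" assume h: "norm h \<le> r / 4"
    define h1 where "h1 = z_part h"
    define h2 where "h2 = w_part h"
    have n: "norm h1 \<le> norm h" "norm h2 \<le> norm h" by (simp_all add: h1_def h2_def norm_parts)
    have yh: "y + h2 \<in> cball y r" using n h r by (simp add: dist_norm)
    then have yhB: "y + h2 \<in> B" using r by blast
    have T1: "cmod (G (x + h1) (y + h2) - G x (y + h2) - dir_deriv h1 (\<lambda>z. G z (y + h2)) x)
        \<le> 8 * M / r\<^sup>2 * (norm h1)\<^sup>2"
      by (rule holo_quadratic_remainder[OF G1[OF yhB] A r(2,1)]) (use M yh n h r in auto)
    have T3: "cmod (G x (y + h2) - G x y - dir_deriv h2 (G x) y) \<le> 8 * M / r\<^sup>2 * (norm h2)\<^sup>2"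
      by (rule holo_quadratic_remainder[OF G2[OF xA] B r(3,1)]) (use M n h r in auto)
    have L: "cmod (G z (y + h2) - G z y) \<le> 5 * M / r * norm h2" if "z \<in> cball x r" for z
      by (rule holo_Lipschitz_bound[OF G2 B r(3,1)]) (use M n h r that in auto)
    have "((\<lambda>z. G z (y + h2) - G z y) has_derivative
        (\<lambda>h. dir_deriv h (\<lambda>z. G z (y + h2)) x - dir_deriv h (\<lambda>z. G z y) x)) (at x)"
      using G1 A xA yB yhB by (intro has_derivative_diff holo_fun_on_has_derivative)
    from dir_deriv_eq[OF this, of h1]
    \<comment> \<open>The two slices differ by at most 5 M |h2| / r on the whole ball, by the
      Lipschitz bound; Cauchy's inequality for their difference supplies the second factor |h1| /
      r.\<close>
    have T2: "cmod (dir_deriv h1 (\<lambda>z. G z (y + h2)) x - dir_deriv h1 (\<lambda>z. G z y) x)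
        \<le> 5 * M / r * norm h2 * norm h1 / r"
      using dir_deriv_Cauchy_bound[OF holo_fun_on_diff[OF G1[OF yhB] G1[OF yB] A] A r(2,1) L, of h1] by simp
    have "cmod (G (x + h1) (y + h2) - G x y - (dir_deriv h1 (\<lambda>z. G z y) x + dir_deriv h2 (G x) y))
      \<le> 8 * M / r\<^sup>2 * (norm h1)\<^sup>2 + 5 * M / r * norm h2 * norm h1 / r + 8 * M / r\<^sup>2 * (norm h2)\<^sup>2"
    proof -
      have "G (x + h1) (y + h2) - G x y - (dir_deriv h1 (\<lambda>z. G z y) x + dir_deriv h2 (G x) y) =
        (G (x + h1) (y + h2) - G x (y + h2) - dir_deriv h1 (\<lambda>z. G z (y + h2)) x)
        + (dir_deriv h1 (\<lambda>z. G z (y + h2)) x - dir_deriv h1 (\<lambda>z. G z y) x)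
        + (G x (y + h2) - G x y - dir_deriv h2 (G x) y)" by (simp add: algebra_simps)
      also have "cmod \<dots> \<le> 8 * M / r\<^sup>2 * (norm h1)\<^sup>2 + 5 * M / r * norm h2 * norm h1 / r + 8 * M / r\<^sup>2 * (norm h2)\<^sup>2"
        by (intro norm_triangle_le add_mono T1 T2 T3)
      finally show ?thesis .
    qed
    also have "\<dots> \<le> 8 * M / r\<^sup>2 * (norm h)\<^sup>2 + 5 * M / r\<^sup>2 * (norm h)\<^sup>2 + 8 * M / r\<^sup>2 * (norm h)\<^sup>2"
    proof (intro add_mono)
      have "5 * M / r * norm h2 * norm h1 / r = 5 * M / r\<^sup>2 * (norm h2 * norm h1)"
        by (simp add: power2_eq_square)
      also have "\<dots> \<le> 5 * M / r\<^sup>2 * (norm h)\<^sup>2"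
        unfolding power2_eq_square[of "norm h"] using \<open>0 \<le> M\<close> n by (intro mult_left_mono mult_mono) auto
      finally show "5 * M / r * norm h2 * norm h1 / r \<le> 5 * M / r\<^sup>2 * (norm h)\<^sup>2" .
    qed (use \<open>0 \<le> M\<close> n in \<open>auto intro!: mult_left_mono divide_right_mono power_mono\<close>)
    also have "\<dots> = 21 * M / r\<^sup>2 * (norm h)\<^sup>2" by (simp add: field_simps)
    also have "\<dots> \<le> 100 * M / r\<^sup>2 * (norm h)\<^sup>2"
      using \<open>0 \<le> M\<close> by (intro mult_right_mono divide_right_mono) auto
    finally show "cmod (G (z_part (p + h)) (w_part (p + h)) - G (z_part p) (w_part p) - (?D1 h + ?D2 h))
      \<le> 100 * M / r\<^sup>2 * (norm h)\<^sup>2"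
      by (simp add: parts_linear x_def y_def h1_def h2_def)
  qed (use r in simp)
  then show "((\<lambda>x. G (z_part x) (w_part x)) has_derivative (\<lambda>h. dir_deriv (z_part h) (\<lambda>z. G z (w_part p)) (z_part p)
        + dir_deriv (w_part h) (G (z_part p)) (w_part p))) (at p)"
    by (simp add: x_def y_def)
  show "dir_deriv (z_part (c *s v)) (\<lambda>z. G z (w_part p)) (z_part p) + dir_deriv (w_part (c *s v)) (G (z_part p)) (w_part p)
    = c * (dir_deriv (z_part v) (\<lambda>z. G z (w_part p)) (z_part p) + dir_deriv (w_part v) (G (z_part p)) (w_part p))" for c v
    unfolding parts_linear dir_deriv_scalar_mult[OF G1[OF y] A x] dir_deriv_scalar_mult[OF G2[OF x] B y]
    by (simp add: distrib_left)
qed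

lemma open_cnjv: "open S \<Longrightarrow> open {w. cnjv w \<in> S}"
  using open_vimage[OF _ linear_continuous_on[OF bounded_linear_cnjv], of S] by (simp add: vimage_def)

lemma holo_fun_on_cnj_cnjv:
  assumes "holo_fun_on f S" "open S"
  shows "holo_fun_on (\<lambda>w. cnj (f (cnjv w))) {w. cnjv w \<in> S}"
proof (rule holo_fun_onI[OF open_cnjv[OF assms(2)], where f' = "\<lambda>w h. cnj (dir_deriv (cnjv h) f (cnjv w))"])
  fix w assume w: "w \<in> {w. cnjv w \<in> S}"
  have "((\<lambda>w. f (cnjv w)) has_derivative (\<lambda>h. dir_deriv (cnjv h) f (cnjv w))) (at w)"
    by (rule has_derivative_compose[OF bounded_linear.has_derivative[OF bounded_linear_cnjv has_derivative_ident]])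
      (use w assms holo_fun_on_has_derivative in auto)
  then show "((\<lambda>w. cnj (f (cnjv w))) has_derivative (\<lambda>h. cnj (dir_deriv (cnjv h) f (cnjv w)))) (at w)"
    by (rule has_derivative_cnj)
  show "cnj (dir_deriv (cnjv (c *s v)) f (cnjv w)) = c * cnj (dir_deriv (cnjv v) f (cnjv w))" for c v
    using w dir_deriv_scalar_mult[OF assms] by simp
qed

context bounded_open_set
begin

lemma ker_ip: "ker w z = ip (ker w) (ker z)"
  using ker_reproducing by simp

lemma ker_cnj: "ker w z = cnj (ker z w)"
  unfolding ker_ip[of w z] ker_ip[of z w] by (rule ip_cnj)

definition \<kappa> :: "complex ^ 'n \<Rightarrow> real" where
  "\<kappa> z = Re (bergman_kernel \<Omega> z z)"

lemma ker_diag: "ker z z = of_real (\<kappa> z)" "\<kappa> z = sqn (ker z)"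
proof -
  have "ker z z = of_real (sqn (ker z))" unfolding ker_ip[of z z] by (rule ip_self)
  then show "ker z z = of_real (\<kappa> z)" "\<kappa> z = sqn (ker z)" by (simp_all add: \<kappa>_def ker_def)
qed

text \<open>K(z, z) is the squared norm of K_z. Were it zero, evaluation at \<open>z\<close> would
  vanish identically, but the constant function 1 belongs to the space.\<close>

lemma \<kappa>_pos:
  assumes "z \<in> \<Omega>"
  shows "\<kappa> z > 0"
proof (rule ccontr)
  assume "\<not> \<kappa> z > 0"
  then have "sqn (ker z) = 0" using ker_diag sqn_nonneg by (metis antisym not_le)
  then have "ker z = (\<lambda>_. 0)" using sqn_zero_imp[OF ker_reproducing(1)] by blast
  moreover have "(\<lambda>z. if z \<in> \<Omega> then 1 else 0) \<in> A2"
    by (rule A2_bounded[OF holo_fun_on_const[OF open_\<Omega>], of 1 1]) simp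
  from ker_reproducing(2)[OF this, of z] have "ip (\<lambda>z. if z \<in> \<Omega> then 1 else 0) (ker z) = 1" using assms by simp
  ultimately show False by (simp add: ip_def)
qed

text \<open>Let V be the volume of a ball of radius \<open>r\<close>. The evaluation bound for K_w
  at \<open>w\<close> reads K(w, w)^2 V \<le> K(w, w), so K(w, w) \<le> 1 / V; the same bound at
  \<open>z\<close> then gives the claim. This is the local boundedness that Osgood's lemma asks
  for.\<close>

lemma ker_bound:
  assumes "cball w r \<subseteq> \<Omega>" "cball z r \<subseteq> \<Omega>" "r > 0"
  shows "cmod (ker w z) \<le> 1 / measure lborel (ball (0 :: complex ^ 'n) r)"
proof -
  define V where "V = measure lborel (ball (0 :: complex ^ 'n) r)"
  have V: "V > 0" "measure lborel (ball y r) = V" for y :: "complex ^ 'n"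
    unfolding V_def using assms(3) measure_ball(2) measure_ball(1)[of y r] by auto
  have "(cmod (ker w w))\<^sup>2 * V \<le> \<kappa> w"
    using A2_bound[OF ker_reproducing(1) assms(1)] V(2) ker_diag(2) by simp
  then have "\<kappa> w * (\<kappa> w * V) \<le> \<kappa> w * 1"
    unfolding ker_diag(1) by (simp add: power2_eq_square mult.assoc)
  moreover have "\<kappa> w > 0" using assms by (intro \<kappa>_pos) auto
  ultimately have "\<kappa> w * V \<le> 1" using mult_le_cancel_left_pos by blast
  then have k: "\<kappa> w \<le> 1 / V" using V(1) by (simp add: field_simps)
  have "(cmod (ker w z))\<^sup>2 * V \<le> 1 / V"
    using A2_bound[OF ker_reproducing(1) assms(2), of w] V(2) ker_diag(2) k by simp
  then have "(cmod (ker w z))\<^sup>2 \<le> (1 / V)\<^sup>2"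
    using V(1) by (simp add: field_simps power2_eq_square)
  then show ?thesis unfolding V_def[symmetric]
    using V(1) power2_le_imp_le by fastforce
qed

text \<open>
  \<open>K(z, w)\<close> is antiholomorphic in \<open>w\<close>; as a function of \<open>(z, conj w)\<close> it is jointly holomorphic, and
  \<open>K(z, z)\<close> is its restriction to the real subspace of the points \<open>(z, conj z)\<close>.
\<close>

definition kerc :: "complex ^ ('n + 'n) \<Rightarrow> complex" where
  "kerc x = ker (cnjv (w_part x)) (z_part x)"

definition \<Omega>c :: "(complex ^ ('n + 'n)) set" where
  "\<Omega>c = {x. z_part x \<in> \<Omega> \<and> w_part x \<in> {w. cnjv w \<in> \<Omega>}}"

lemma open_\<Omega>c: "open \<Omega>c"
  unfolding \<Omega>c_def using open_parts open_cnjv open_\<Omega> by blast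

lemma kerc_holo: "holo_fun_on kerc \<Omega>c"
proof -
  have "holo_fun_on (\<lambda>x. (\<lambda>z w. ker (cnjv w) z) (z_part x) (w_part x)) \<Omega>c"
    unfolding \<Omega>c_def
  proof (rule Osgood[OF open_\<Omega> open_cnjv[OF open_\<Omega>]])
    show "holo_fun_on (ker (cnjv w)) \<Omega>" for w by (rule A2_holo[OF ker_reproducing(1)])
    show "holo_fun_on (\<lambda>w. ker (cnjv w) z) {w. cnjv w \<in> \<Omega>}" for z
      unfolding ker_cnj[of _ z] by (rule holo_fun_on_cnj_cnjv[OF A2_holo[OF ker_reproducing(1)] open_\<Omega>])
    fix z w assume z: "z \<in> \<Omega>" and w: "w \<in> {w. cnjv w \<in> \<Omega>}"
    obtain r1 where r1: "r1 > 0" "cball z r1 \<subseteq> \<Omega>" using z open_\<Omega> open_contains_cball by meson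
    obtain r2 where r2: "r2 > 0" "cball w r2 \<subseteq> {w. cnjv w \<in> \<Omega>}"
      using w open_cnjv[OF open_\<Omega>] open_contains_cball by meson
    \<comment> \<open>Halving leaves room for a further ball of radius \<open>r\<close> about each
      point of the two balls, as the kernel bound requires.\<close>
    define r where "r = min r1 r2 / 2"
    have r: "r > 0" "2 * r \<le> r1" "2 * r \<le> r2" using r1 r2 by (auto simp: r_def min_def)
    have sub: "cball z' r \<subseteq> cball y R" if "z' \<in> cball y r" "2 * r \<le> R" for z' y :: "complex ^ 'n" and R
      using that by (auto simp: cball_subset_cball_iff dist_commute)
    have bound: "cmod (ker (cnjv w') z') \<le> 1 / measure lborel (ball (0 :: complex ^ 'n) r)"
      if "z' \<in> cball z r" "w' \<in> cball w r" for z' w'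
    proof (rule ker_bound)
      show "cball z' r \<subseteq> \<Omega>" using sub[OF that(1) r(2)] r1 by blast
      show "cball (cnjv w') r \<subseteq> \<Omega>"
      proof
        fix a assume a: "a \<in> cball (cnjv w') r"
        have "dist w' (cnjv a) = norm (cnjv (cnjv w' + (- 1) *s a))"
          by (simp only: cnjv_simps) (simp add: dist_norm)
        also have "\<dots> = dist (cnjv w') a" unfolding cnjv_simps(3) by (simp add: dist_norm)
        finally have "cnjv a \<in> cball w' r" using a by simp
        then have "cnjv a \<in> {w. cnjv w \<in> \<Omega>}" using sub[OF that(2) r(3)] r2 by blast
        then show "a \<in> \<Omega>" by simp
      qed
    qed (use r in auto)
    have "cball z r \<subseteq> \<Omega>" "cball w r \<subseteq> {w. cnjv w \<in> \<Omega>}"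
      using r r1 r2 by (meson order_trans subset_cball less_imp_le mult_le_cancel_right1 order.trans one_le_numeral mult_2 le_add_same_cancel1)+
    then show "\<exists>r>0. \<exists>M. cball z r \<subseteq> \<Omega> \<and> cball w r \<subseteq> {w. cnjv w \<in> \<Omega>} \<and>
        (\<forall>z'\<in>cball z r. \<forall>w'\<in>cball w r. cmod (ker (cnjv w') z') \<le> M)"
      using r(1) bound by blast
  qed
  then show ?thesis by (simp add: kerc_def[abs_def])
qed

end


section \<open>Wirtinger calculus\<close>

lemma differentiable_dir_deriv:
  fixes f :: "complex ^ 'n \<Rightarrow> complex"
  assumes "f differentiable (at x)"
  shows "(f has_derivative (\<lambda>h. dir_deriv h f x)) (at x)"
proof -
  obtain f' where f': "(f has_derivative f') (at x)" using assms unfolding differentiable_def by blast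
  moreover have "f' = (\<lambda>h. dir_deriv h f x)" using dir_deriv_eq[OF f'] by auto
  ultimately show ?thesis by simp
qed

lemma dir_deriv_cong:
  assumes "open S" "x \<in> S" "\<And>y. y \<in> S \<Longrightarrow> f y = g y"
  shows "dir_deriv v f x = dir_deriv v g x"
  unfolding dir_deriv_def
proof (rule vector_derivative_cong_eq)
  have "continuous_on UNIV (\<lambda>t::real. x + t *\<^sub>R v)" by (intro continuous_intros)
  then have "open ((\<lambda>t::real. x + t *\<^sub>R v) -` S)" using assms(1) open_vimage by blast
  then have "\<forall>\<^sub>F t in nhds 0. t \<in> (\<lambda>t::real. x + t *\<^sub>R v) -` S"
    using assms(2) by (intro eventually_nhds_in_open) auto
  then show "\<forall>\<^sub>F t in nhds 0. t \<in> UNIV \<longrightarrow> f (x + t *\<^sub>R v) = g (x + t *\<^sub>R v)"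
    by (rule eventually_mono) (use assms(3) in auto)
qed auto

lemma dir_deriv_const: "dir_deriv v (\<lambda>_. c) x = 0"
  by (rule dir_deriv_eq[of _ "\<lambda>_. 0"]) simp

lemma dir_deriv_add:
  assumes "f differentiable (at x)" "g differentiable (at x)"
  shows "dir_deriv v (\<lambda>y. f y + g y) x = dir_deriv v f x + dir_deriv v g x"
  by (rule dir_deriv_eq[OF has_derivative_add[OF assms[THEN differentiable_dir_deriv]]])

lemma dir_deriv_mult:
  assumes "f differentiable (at x)" "g differentiable (at x)"
  shows "dir_deriv v (\<lambda>y. f y * g y) x = f x * dir_deriv v g x + dir_deriv v f x * g x"
  by (rule dir_deriv_eq[OF has_derivative_mult[OF assms[THEN differentiable_dir_deriv]]])

lemma dir_deriv_cnj:
  assumes "f differentiable (at x)"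
  shows "dir_deriv v (\<lambda>y. cnj (f y)) x = cnj (dir_deriv v f x)"
  by (rule dir_deriv_eq[OF has_derivative_cnj[OF differentiable_dir_deriv[OF assms]]])

lemma dir_deriv_field_compose:
  assumes "f differentiable (at x)" "(\<phi> has_field_derivative d) (at (f x))"
  shows "dir_deriv v (\<lambda>y. \<phi> (f y)) x = d * dir_deriv v f x" "(\<lambda>y. \<phi> (f y)) differentiable (at x)"
proof -
  have "((\<lambda>y. \<phi> (f y)) has_derivative (\<lambda>h. d * dir_deriv h f x)) (at x)"
    using has_derivative_compose[OF differentiable_dir_deriv[OF assms(1)] assms(2)[unfolded has_field_derivative_def]] .
  then show "dir_deriv v (\<lambda>y. \<phi> (f y)) x = d * dir_deriv v f x" "(\<lambda>y. \<phi> (f y)) differentiable (at x)"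
    using dir_deriv_eq differentiableI by blast+
qed

lemma dir_deriv_compose:
  assumes "f differentiable (at (s x))" "(s has_derivative s') (at x)"
  shows "dir_deriv v (\<lambda>y. f (s y)) x = dir_deriv (s' v) f (s x)" "(\<lambda>y. f (s y)) differentiable (at x)"
proof -
  have "((\<lambda>y. f (s y)) has_derivative (\<lambda>h. dir_deriv (s' h) f (s x))) (at x)"
    using has_derivative_compose[OF assms(2) differentiable_dir_deriv[OF assms(1)]] .
  then show "dir_deriv v (\<lambda>y. f (s y)) x = dir_deriv (s' v) f (s x)" "(\<lambda>y. f (s y)) differentiable (at x)"
    using dir_deriv_eq differentiableI by blast+
qed

text \<open>Counts how often directional derivatives can be taken: \<open>Ck k\<close> is
  \<open>k\<close>-fold differentiability, with no continuity claim on the top derivatives, and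
  \<open>Ck 0\<close> is void. Smoothness is expressed as \<open>Ck k\<close> for all
  \<open>k\<close>.\<close>

primrec Ck :: "nat \<Rightarrow> (complex ^ 'n \<Rightarrow> complex) \<Rightarrow> (complex ^ 'n) set \<Rightarrow> bool" where
  "Ck 0 f S \<longleftrightarrow> True"
| "Ck (Suc k) f S \<longleftrightarrow> (\<forall>x\<in>S. f differentiable (at x)) \<and> (\<forall>v. Ck k (dir_deriv v f) S)"

lemma Ck_differentiable: "Ck (Suc k) f S \<Longrightarrow> x \<in> S \<Longrightarrow> f differentiable (at x)"
  by simp

lemma Ck_cong:
  assumes "Ck k f S" "open S" "\<And>x. x \<in> S \<Longrightarrow> f x = g x"
  shows "Ck k g S"
  using assms
proof (induction k arbitrary: f g)
  case (Suc k)
  have "g differentiable (at x)" if x: "x \<in> S" for x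
  proof -
    have "(f has_derivative (\<lambda>h. dir_deriv h f x)) (at x)"
      using Suc.prems(1) x by (intro differentiable_dir_deriv) auto
    then have "(g has_derivative (\<lambda>h. dir_deriv h f x)) (at x)"
      by (rule has_derivative_transform_within_open[OF _ Suc.prems(2) x]) (use Suc.prems(3) in auto)
    then show ?thesis by (rule differentiableI)
  qed
  moreover have "Ck k (dir_deriv v g) S" for v
    by (rule Suc.IH[of "dir_deriv v f"])
      (use Suc.prems in \<open>auto intro: dir_deriv_cong[OF Suc.prems(2) _ Suc.prems(3)]\<close>)
  ultimately show ?case by simp
qed simp

lemma Ck_SucD: "Ck (Suc k) f S \<Longrightarrow> Ck k f S"
  by (induction k arbitrary: f) auto

lemma Ck_const: "open S \<Longrightarrow> Ck k (\<lambda>_. c) S"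
proof (induction k arbitrary: c)
  case (Suc k)
  have "dir_deriv v (\<lambda>_. c) = (\<lambda>_. 0)" for v :: "complex ^ 'a" using dir_deriv_const by blast
  then show ?case using Suc by simp
qed simp

lemma Ck_add:
  assumes "Ck k f S" "Ck k g S" "open S"
  shows "Ck k (\<lambda>x. f x + g x) S"
  using assms
proof (induction k arbitrary: f g)
  case (Suc k)
  have "Ck k (dir_deriv v (\<lambda>x. f x + g x)) S" for v
    by (rule Ck_cong[of k "\<lambda>x. dir_deriv v f x + dir_deriv v g x"])
      (use Suc in \<open>auto simp: dir_deriv_add\<close>)
  then show ?case using Suc.prems by auto
qed simp

lemma Ck_mult:
  assumes "Ck k f S" "Ck k g S" "open S"
  shows "Ck k (\<lambda>x. f x * g x) S"
  using assms
proof (induction k arbitrary: f g)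
  case (Suc k)
  have "Ck k (dir_deriv v (\<lambda>x. f x * g x)) S" for v
    by (rule Ck_cong[of k "\<lambda>x. f x * dir_deriv v g x + dir_deriv v f x * g x"])
      (use Suc Suc.prems(1,2)[THEN Ck_SucD] in \<open>auto simp: dir_deriv_mult intro!: Ck_add\<close>)
  then show ?case using Suc.prems by auto
qed simp

lemma Ck_cmult: "Ck k f S \<Longrightarrow> open S \<Longrightarrow> Ck k (\<lambda>x. c * f x) S"
  by (intro Ck_mult Ck_const)

lemma Ck_diff:
  assumes "Ck k f S" "Ck k g S" "open S"
  shows "Ck k (\<lambda>x. f x - g x) S"
  using Ck_add[OF assms(1) Ck_cmult[OF assms(2,3), of "-1"] assms(3)] by simp

lemma Ck_sum: "(\<And>i. i \<in> I \<Longrightarrow> Ck k (f i) S) \<Longrightarrow> open S \<Longrightarrow> Ck k (\<lambda>x. \<Sum>i\<in>I. f i x) S"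
  by (induction I rule: infinite_finite_induct) (auto intro: Ck_const Ck_add)

lemma Ck_prod: "(\<And>i. i \<in> I \<Longrightarrow> Ck k (f i) S) \<Longrightarrow> open S \<Longrightarrow> Ck k (\<lambda>x. \<Prod>i\<in>I. f i x) S"
  by (induction I rule: infinite_finite_induct) (auto intro: Ck_const Ck_mult)

lemma Ck_det:
  fixes A :: "complex ^ 'n \<Rightarrow> complex ^ 'm ^ 'm"
  assumes "\<And>i j. Ck k (\<lambda>x. A x $ i $ j) S" "open S"
  shows "Ck k (\<lambda>x. det (A x)) S"
  unfolding det_def using assms by (intro Ck_sum Ck_mult Ck_prod Ck_const)

lemma Ck_cnj:
  assumes "Ck k f S" "open S"
  shows "Ck k (\<lambda>x. cnj (f x)) S"
  using assms
proof (induction k arbitrary: f)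
  case (Suc k)
  have "Ck k (dir_deriv v (\<lambda>x. cnj (f x))) S" for v
    by (rule Ck_cong[of k "\<lambda>x. cnj (dir_deriv v f x)"])
      (use Suc in \<open>auto simp: dir_deriv_cnj\<close>)
  moreover have "(\<lambda>x. cnj (f x)) differentiable (at x)" if "x \<in> S" for x
    by (rule differentiableI[OF has_derivative_cnj[OF differentiable_dir_deriv[OF Ck_differentiable[OF Suc.prems(1) that]]]])
  ultimately show ?case by simp
qed simp

text \<open>The induction generalises over the outer function, since the chain rule replaces it by
  its derivative, which is again holomorphic.\<close>

lemma Ck_field_compose:
  assumes "Ck k f S" "open S" "\<phi> holomorphic_on T" "open T" "\<And>x. x \<in> S \<Longrightarrow> f x \<in> T"
  shows "Ck k (\<lambda>x. \<phi> (f x)) S"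
  using assms
proof (induction k arbitrary: \<phi>)
  case (Suc k)
  have d: "(\<phi> has_field_derivative deriv \<phi> (f x)) (at (f x))" if "x \<in> S" for x
    using Suc.prems that by (intro holomorphic_derivI) auto
  have f: "f differentiable (at x)" if "x \<in> S" for x using Suc.prems(1) that by simp
  have "Ck k (dir_deriv v (\<lambda>x. \<phi> (f x))) S" for v
  proof (rule Ck_cong[of k "\<lambda>x. deriv \<phi> (f x) * dir_deriv v f x"])
    have "Ck k (\<lambda>x. deriv \<phi> (f x)) S"
      by (rule Suc.IH[OF Ck_SucD[OF Suc.prems(1)] Suc.prems(2) holomorphic_deriv[OF Suc.prems(3,4)] Suc.prems(4,5)])
    then show "Ck k (\<lambda>x. deriv \<phi> (f x) * dir_deriv v f x) S"
      using Suc.prems(1,2) by (intro Ck_mult) simp_all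
  qed (simp_all add: dir_deriv_field_compose(1)[OF f d] Suc.prems(2))
  then show ?case using dir_deriv_field_compose(2)[OF f d] by simp
qed simp

lemma Ck_holo:
  assumes "holo_fun_on f S" "open S"
  shows "Ck k f S"
  using assms
proof (induction k arbitrary: f)
  case (Suc k)
  then show ?case
    using holo_fun_on_dir_deriv[OF Suc.prems] differentiableI[OF holo_fun_on_has_derivative[OF Suc.prems]] by auto
qed simp

lemma Ck_compose_linear:
  assumes "Ck k f T" "bounded_linear L" "open S" "\<And>x. x \<in> S \<Longrightarrow> L x \<in> T"
  shows "Ck k (\<lambda>x. f (L x)) S"
  using assms
proof (induction k arbitrary: f)
  case (Suc k)
  have L: "(L has_derivative L) (at x)" for x
    using Suc.prems(2) by (intro bounded_linear_imp_has_derivative)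
  have f: "f differentiable (at (L x))" if "x \<in> S" for x using Suc.prems that by simp
  have "Ck k (dir_deriv v (\<lambda>x. f (L x))) S" for v
    by (rule Ck_cong[of k "\<lambda>x. dir_deriv (L v) f (L x)"])
      (use Suc dir_deriv_compose(1)[OF f L] in auto)
  then show ?case using dir_deriv_compose(2)[OF f L] by simp
qed simp

section \<open>Rules for Wirtinger derivatives\<close>

lemma Ck_wirt: "Ck (Suc k) f S \<Longrightarrow> open S \<Longrightarrow> Ck k (wirt v f) S"
  using Ck_cmult[OF Ck_diff[OF _ Ck_cmult], of k "dir_deriv v f" S "dir_deriv (\<i> *s v) f" "1 / 2" \<i>]
  by (simp add: wirt_def[abs_def])

lemma Ck_wirt_bar: "Ck (Suc k) f S \<Longrightarrow> open S \<Longrightarrow> Ck k (wirt_bar v f) S"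
  using Ck_cmult[OF Ck_add[OF _ Ck_cmult], of k "dir_deriv v f" S "dir_deriv (\<i> *s v) f" "1 / 2" \<i>]
  by (simp add: wirt_bar_def[abs_def])

lemma wirt_cong:
  assumes "open S" "x \<in> S" "\<And>y. y \<in> S \<Longrightarrow> f y = g y"
  shows "wirt v f x = wirt v g x" "wirt_bar v f x = wirt_bar v g x"
  unfolding wirt_def wirt_bar_def using dir_deriv_cong[OF assms] by auto

lemma wirt_const: "wirt v (\<lambda>_. c) x = 0" "wirt_bar v (\<lambda>_. c) x = 0"
  by (simp_all add: wirt_def wirt_bar_def dir_deriv_const)

lemma wirt_add:
  assumes "f differentiable (at x)" "g differentiable (at x)"
  shows "wirt v (\<lambda>y. f y + g y) x = wirt v f x + wirt v g x"
    "wirt_bar v (\<lambda>y. f y + g y) x = wirt_bar v f x + wirt_bar v g x"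
  by (simp_all add: wirt_def wirt_bar_def dir_deriv_add[OF assms] field_simps)

lemma wirt_mult:
  assumes "f differentiable (at x)" "g differentiable (at x)"
  shows "wirt v (\<lambda>y. f y * g y) x = f x * wirt v g x + wirt v f x * g x"
    "wirt_bar v (\<lambda>y. f y * g y) x = f x * wirt_bar v g x + wirt_bar v f x * g x"
  by (simp_all add: wirt_def wirt_bar_def dir_deriv_mult[OF assms] field_simps)

lemma wirt_cmult:
  assumes "f differentiable (at x)"
  shows "wirt v (\<lambda>y. c * f y) x = c * wirt v f x" "wirt_bar v (\<lambda>y. c * f y) x = c * wirt_bar v f x"
  using wirt_mult[OF differentiable_const assms] by (simp_all add: wirt_const)

lemma wirt_diff:
  assumes "f differentiable (at x)" "g differentiable (at x)"
  shows "wirt v (\<lambda>y. f y - g y) x = wirt v f x - wirt v g x"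
    "wirt_bar v (\<lambda>y. f y - g y) x = wirt_bar v f x - wirt_bar v g x"
proof -
  have "(\<lambda>y. -1 * g y) differentiable (at x)" using assms(2) by (intro differentiable_mult differentiable_const)
  from wirt_add[OF assms(1) this] show "wirt v (\<lambda>y. f y - g y) x = wirt v f x - wirt v g x"
    "wirt_bar v (\<lambda>y. f y - g y) x = wirt_bar v f x - wirt_bar v g x"
    using wirt_cmult[OF assms(2), of _ "-1"] by simp_all
qed

lemma wirt_sum:
  assumes "\<And>i. i \<in> I \<Longrightarrow> f i differentiable (at x)"
  shows "wirt v (\<lambda>y. \<Sum>i\<in>I. f i y) x = (\<Sum>i\<in>I. wirt v (f i) x)"
    "wirt_bar v (\<lambda>y. \<Sum>i\<in>I. f i y) x = (\<Sum>i\<in>I. wirt_bar v (f i) x)"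
  using assms
  by (induction I rule: infinite_finite_induct) (auto simp: wirt_const wirt_add)

lemma wirt_field_compose:
  assumes "f differentiable (at x)" "(\<phi> has_field_derivative d) (at (f x))"
  shows "wirt v (\<lambda>y. \<phi> (f y)) x = d * wirt v f x" "wirt_bar v (\<lambda>y. \<phi> (f y)) x = d * wirt_bar v f x"
  by (simp_all add: wirt_def wirt_bar_def dir_deriv_field_compose[OF assms] field_simps)

lemma wirt_holo:
  assumes "holo_fun_on f S" "open S" "x \<in> S"
  shows "wirt v f x = dir_deriv v f x" "wirt_bar v f x = 0"
  by (simp_all add: wirt_def wirt_bar_def dir_deriv_scalar_mult[OF assms] mult.assoc[symmetric])

lemma wirt_cnj:
  assumes "f differentiable (at x)"
  shows "wirt v (\<lambda>y. cnj (f y)) x = cnj (wirt_bar v f x)" "wirt_bar v (\<lambda>y. cnj (f y)) x = cnj (wirt v f x)"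
  by (simp_all add: wirt_def wirt_bar_def dir_deriv_cnj[OF assms])

lemma wirt_compose:
  assumes "f differentiable (at (s x))" "(s has_derivative s') (at x)" "\<And>c v. s' (c *s v) = c *s s' v"
  shows "wirt v (\<lambda>y. f (s y)) x = wirt (s' v) f (s x)" "wirt_bar v (\<lambda>y. f (s y)) x = wirt_bar (s' v) f (s x)"
  by (simp_all add: wirt_def wirt_bar_def dir_deriv_compose[OF assms(1,2)] assms(3))

lemma wirt_zero: "wirt 0 f x = 0" "wirt_bar 0 f x = 0"
  by (simp_all add: wirt_def wirt_bar_def dir_deriv_def)

lemma wirt_linear:
  assumes "f differentiable (at x)"
  shows "wirt (a + b) f x = wirt a f x + wirt b f x" "wirt_bar (a + b) f x = wirt_bar a f x + wirt_bar b f x"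
    "wirt (c *s a) f x = c * wirt a f x" "wirt_bar (c *s a) f x = cnj c * wirt_bar a f x"
proof -
  have lin: "linear (\<lambda>h. dir_deriv h f x)"
    using differentiable_dir_deriv[OF assms] has_derivative_linear by blast
  have add: "dir_deriv (a + b) f x = dir_deriv a f x + dir_deriv b f x" for a b
    by (rule linear_add[OF lin])
  have sc: "dir_deriv (c *s a) f x = of_real (Re c) * dir_deriv a f x + of_real (Im c) * dir_deriv (\<i> *s a) f x" for c a
  proof -
    have "c *s a = Re c *\<^sub>R a + Im c *\<^sub>R (\<i> *s a)"
      by (simp add: vec_eq_iff complex_eq_iff)
    then have "dir_deriv (c *s a) f x = Re c *\<^sub>R dir_deriv a f x + Im c *\<^sub>R dir_deriv (\<i> *s a) f x"
      by (simp only: linear_add[OF lin] linear_cmul[OF lin])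
    then show ?thesis by (simp only: scaleR_conv_of_real)
  qed
  show "wirt (a + b) f x = wirt a f x + wirt b f x" "wirt_bar (a + b) f x = wirt_bar a f x + wirt_bar b f x"
    by (simp_all add: wirt_def wirt_bar_def add field_simps)
  have i: "\<i> *s (c *s a) = (\<i> * c) *s a" by simp
  show "wirt (c *s a) f x = c * wirt a f x" "wirt_bar (c *s a) f x = cnj c * wirt_bar a f x"
    unfolding wirt_def wirt_bar_def i sc[of c] sc[of "\<i> * c"]
    by (simp_all add: complex_eq_iff algebra_simps)
qed

lemma wirt_expand:
  assumes "f differentiable (at x)"
  shows "wirt v f x = (\<Sum>i\<in>UNIV. v $ i * d_z i f x)" "wirt_bar v f x = (\<Sum>i\<in>UNIV. cnj (v $ i) * d_zbar i f x)"
proof -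
  have "wirt (\<Sum>i\<in>I. (v $ i) *s axis i 1) f x = (\<Sum>i\<in>I. v $ i * d_z i f x)"
    "wirt_bar (\<Sum>i\<in>I. (v $ i) *s axis i 1) f x = (\<Sum>i\<in>I. cnj (v $ i) * d_zbar i f x)" if "finite I" for I
    using that by (induction I) (simp_all add: wirt_zero wirt_linear[OF assms])
  from this[OF finite[of UNIV]] show "wirt v f x = (\<Sum>i\<in>UNIV. v $ i * d_z i f x)"
    "wirt_bar v f x = (\<Sum>i\<in>UNIV. cnj (v $ i) * d_zbar i f x)"
    unfolding basis_expansion .
qed

lemma of_real_ln_eq_Ln: "0 < t \<Longrightarrow> complex_of_real (ln t) = Ln (complex_of_real t)"
  by (simp add: Ln_of_real)

text \<open>On positive reals \<open>ln\<close> agrees with \<open>Ln\<close>, which is holomorphic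
  on the slit plane; the chain rule for holomorphic outer functions thereby covers real
  logarithms.\<close>

lemma
  assumes "open S" "\<And>x. x \<in> S \<Longrightarrow> f x > 0"
  shows Ck_ln: "Ck k (\<lambda>x. complex_of_real (f x)) S \<Longrightarrow> Ck k (\<lambda>x. complex_of_real (ln (f x))) S"
    and wirt_bar_ln: "x \<in> S \<Longrightarrow> (\<lambda>x. complex_of_real (f x)) differentiable (at x) \<Longrightarrow>
      wirt_bar v (\<lambda>x. complex_of_real (ln (f x))) x = wirt_bar v (\<lambda>x. complex_of_real (f x)) x / of_real (f x)"
proof -
  have eq: "Ln (complex_of_real (f y)) = complex_of_real (ln (f y))" if "y \<in> S" for y
    using of_real_ln_eq_Ln[OF assms(2)[OF that]] by simp
  have np: "complex_of_real (f y) \<notin> \<real>\<^sub>\<le>\<^sub>0" if "y \<in> S" for y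
    using assms(2)[OF that] by simp
  show "Ck k (\<lambda>x. complex_of_real (ln (f x))) S" if "Ck k (\<lambda>x. complex_of_real (f x)) S"
  proof (rule Ck_cong[OF Ck_field_compose[OF that assms(1), of Ln "- \<real>\<^sub>\<le>\<^sub>0"]])
    show "Ln holomorphic_on - \<real>\<^sub>\<le>\<^sub>0" by (intro holomorphic_on_Ln) auto
  qed (use assms eq np in \<open>auto simp: open_Compl\<close>)
  assume x: "x \<in> S" and d: "(\<lambda>x. complex_of_real (f x)) differentiable (at x)"
  have D: "(Ln has_field_derivative inverse (complex_of_real (f x))) (at (complex_of_real (f x)))"
    by (rule has_field_derivative_Ln[OF np[OF x]])
  show "wirt_bar v (\<lambda>x. complex_of_real (ln (f x))) x = wirt_bar v (\<lambda>x. complex_of_real (f x)) x / of_real (f x)"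
    using wirt_cong[where v = v, OF assms(1) x eq] wirt_field_compose[where v = v, OF d D]
    by (simp add: divide_inverse mult.commute)
qed


section \<open>The Bergman metric\<close>

lemma wirt_wirt_bar_expand:
  assumes f: "Ck 2 f S" and S: "open S" "x \<in> S"
  shows "wirt v (wirt_bar w f) x = (\<Sum>i\<in>UNIV. \<Sum>j\<in>UNIV. v $ i * cnj (w $ j) * d_z i (d_zbar j f) x)"
proof -
  have f1: "f differentiable (at y)" if "y \<in> S" for y using f that by (simp add: numeral_2_eq_2)
  have "Ck (Suc 0) (wirt_bar u f) S" for u
    using f S(1) by (intro Ck_wirt_bar) (simp add: numeral_2_eq_2)
  then have f2: "wirt_bar u f differentiable (at y)" if "y \<in> S" for y u
    using that by (meson Ck_differentiable)
  have "wirt v (wirt_bar w f) x = (\<Sum>i\<in>UNIV. v $ i * d_z i (wirt_bar w f) x)"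
    by (rule wirt_expand(1)[OF f2[OF S(2)]])
  also have "\<dots> = (\<Sum>i\<in>UNIV. v $ i * (\<Sum>j\<in>UNIV. cnj (w $ j) * d_z i (d_zbar j f) x))"
  proof (intro sum.cong refl arg_cong2[where f = "(*)"])
    fix i
    have "d_z i (wirt_bar w f) x = d_z i (\<lambda>y. \<Sum>j\<in>UNIV. cnj (w $ j) * d_zbar j f y) x"
      by (rule wirt_cong(1)[OF S wirt_expand(2)[OF f1]])
    also have "\<dots> = (\<Sum>j\<in>UNIV. d_z i (\<lambda>y. cnj (w $ j) * d_zbar j f y) x)"
      by (rule wirt_sum(1)) (intro differentiable_mult differentiable_const f2 S(2))
    also have "\<dots> = (\<Sum>j\<in>UNIV. cnj (w $ j) * d_z i (d_zbar j f) x)"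
      by (simp add: wirt_cmult(1)[OF f2[OF S(2)]])
    finally show "d_z i (wirt_bar w f) x = (\<Sum>j\<in>UNIV. cnj (w $ j) * d_z i (d_zbar j f) x)" .
  qed
  finally show ?thesis by (simp add: sum_distrib_left mult.assoc)
qed

context bounded_open_set
begin

lemma \<kappa>_eq_kerc: "complex_of_real (\<kappa> z) = kerc (join z (cnjv z))"
  by (simp add: kerc_def ker_diag(1)[symmetric])

lemma join_cnjv_\<Omega>c: "z \<in> \<Omega> \<Longrightarrow> w \<in> \<Omega> \<Longrightarrow> join z (cnjv w) \<in> \<Omega>c"
  by (simp add: \<Omega>c_def)

lemma Ck_\<kappa>: "Ck k (\<lambda>z. complex_of_real (\<kappa> z)) \<Omega>"
  unfolding \<kappa>_eq_kerc
  by (rule Ck_compose_linear[OF Ck_holo[OF kerc_holo open_\<Omega>c] bounded_linear_join_cnjv open_\<Omega>])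
    (rule join_cnjv_\<Omega>c)

lemma Ck_log_\<kappa>: "Ck k (\<lambda>z. complex_of_real (ln (\<kappa> z))) \<Omega>"
  by (rule Ck_ln[OF open_\<Omega> \<kappa>_pos Ck_\<kappa>])

lemma \<kappa>_differentiable: "z \<in> \<Omega> \<Longrightarrow> (\<lambda>z. complex_of_real (\<kappa> z)) differentiable (at z)"
  by (rule Ck_differentiable[OF Ck_\<kappa>])

text \<open>The real direction \<open>v\<close> moves the point on the slice by
  \<open>join v 0 + join 0 (cnjv v)\<close>; replacing \<open>v\<close> by \<i> v multiplies the
  first summand by \<i> and the second by -\<i>. The combinations defining \<open>wirt\<close> and
  \<open>wirt_bar\<close> each isolate one summand.\<close>

lemma wirt_diag:
  assumes H: "holo_fun_on H \<Omega>c" and z: "z \<in> \<Omega>"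
  shows "wirt v (\<lambda>z. H (join z (cnjv z))) z = dir_deriv (join v 0) H (join z (cnjv z))"
    "wirt_bar v (\<lambda>z. H (join z (cnjv z))) z = dir_deriv (join 0 (cnjv v)) H (join z (cnjv z))"
proof -
  let ?x = "join z (cnjv z)"
  have x: "?x \<in> \<Omega>c" using join_cnjv_\<Omega>c z by blast
  have H': "H differentiable (at ?x)"
    using differentiableI[OF holo_fun_on_has_derivative[OF H open_\<Omega>c x]] .
  have d: "dir_deriv v (\<lambda>z. H (join z (cnjv z))) z = dir_deriv (join v (cnjv v)) H ?x" for v
    by (rule dir_deriv_compose(1)[OF H' bounded_linear_imp_has_derivative[OF bounded_linear_join_cnjv]])
  have lin: "linear (\<lambda>h. dir_deriv h H ?x)" by (rule dir_deriv_linear[OF H open_\<Omega>c x])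
  have s: "join v (cnjv v) = join v 0 + join 0 (cnjv v)"
    "join (\<i> *s v) (cnjv (\<i> *s v)) = \<i> *s join v 0 + (- \<i>) *s join 0 (cnjv v)"
    by (simp_all add: vec_eq_iff join_def split: sum.splits)
  have e: "dir_deriv (join v (cnjv v)) H ?x = dir_deriv (join v 0) H ?x + dir_deriv (join 0 (cnjv v)) H ?x"
    "dir_deriv (join (\<i> *s v) (cnjv (\<i> *s v))) H ?x = \<i> * dir_deriv (join v 0) H ?x - \<i> * dir_deriv (join 0 (cnjv v)) H ?x"
    unfolding s linear_add[OF lin] dir_deriv_scalar_mult[OF H open_\<Omega>c x] by simp_all
  show "wirt v (\<lambda>z. H (join z (cnjv z))) z = dir_deriv (join v 0) H ?x"
    "wirt_bar v (\<lambda>z. H (join z (cnjv z))) z = dir_deriv (join 0 (cnjv v)) H ?x"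
    unfolding wirt_def wirt_bar_def d e by (simp_all add: algebra_simps)
qed

text \<open>Differentiation at a point is continuous under locally uniform convergence, by
  Weierstrass' theorem, so the Riesz argument applies to it.\<close>

lemma dir_deriv_representer:
  assumes "z \<in> \<Omega>"
  obtains k where "k \<in> A2" "\<And>f. f \<in> A2 \<Longrightarrow> dir_deriv v f z = ip f k"
proof (rule A2_Riesz[of "\<lambda>f. dir_deriv v f z"])
  have d: "f differentiable (at z)" if "f \<in> A2" for f
    using differentiableI[OF holo_fun_on_has_derivative[OF A2_holo[OF that] open_\<Omega> assms]] .
  show "dir_deriv v (\<lambda>z. f z + g z) z = dir_deriv v f z + dir_deriv v g z" if "f \<in> A2" "g \<in> A2" for f g
    using dir_deriv_add[OF d d] that by blast
  show "dir_deriv v (\<lambda>z. c * f z) z = c * dir_deriv v f z" if "f \<in> A2" for f c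
    using dir_deriv_mult[OF differentiable_const d[OF that]] by (simp add: dir_deriv_const)
  show "(\<lambda>n. dir_deriv v (F n) z) \<longlonglongrightarrow> dir_deriv v f z"
    if "\<And>n. F n \<in> A2" "f \<in> A2" "loc_uniform_limit \<Omega> F f" for F f
    by (rule uniform_limit_holo(2)[where f = F, OF open_\<Omega> A2_holo[OF that(1)] _ assms])
      (use that(3) loc_uniform_limit_def in blast)
qed (use that in blast)

text \<open>By conjugate symmetry and reproduction, the antiholomorphic derivative of K(., w) along
  \<open>v\<close> at w = z is the representer \<open>k\<close>. Differentiating once more in the
  holomorphic variable gives the derivative of \<open>k\<close> itself along \<open>v\<close> at
  \<open>z\<close>, which is <k, k>.\<close>

lemma \<kappa>_derivs:
  assumes z: "z \<in> \<Omega>" and k: "k \<in> A2" "\<And>f. f \<in> A2 \<Longrightarrow> dir_deriv v f z = ip f k"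
  shows "wirt_bar v (\<lambda>z. complex_of_real (\<kappa> z)) z = k z"
    "wirt v (\<lambda>z. complex_of_real (\<kappa> z)) z = cnj (k z)"
    "wirt v (wirt_bar v (\<lambda>z. complex_of_real (\<kappa> z))) z = of_real (sqn k)"
proof -
  let ?\<delta> = "\<lambda>z. join z (cnjv z)"
  have dker: "dir_deriv (join 0 (cnjv v)) kerc (join \<zeta> (cnjv z)) = k \<zeta>" if "\<zeta> \<in> \<Omega>" for \<zeta>
  proof -
    have "dir_deriv (join 0 (cnjv v)) kerc (join \<zeta> (cnjv z)) = dir_deriv v (\<lambda>w. kerc (join \<zeta> (cnjv w))) z"
      unfolding dir_deriv_def
      by (rule arg_cong[where f = "\<lambda>f. vector_derivative f (at 0)"])
        (auto simp: fun_eq_iff kerc_def parts_linear cnjv_def intro!: arg_cong2[where f = ker])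
    also have "\<dots> = dir_deriv v (\<lambda>w. cnj (ker \<zeta> w)) z"
      by (simp add: kerc_def ker_cnj[of _ \<zeta>])
    also have "\<dots> = cnj (dir_deriv v (ker \<zeta>) z)"
      by (rule dir_deriv_cnj[OF differentiableI[OF holo_fun_on_has_derivative[OF A2_holo[OF ker_reproducing(1)] open_\<Omega> z]]])
    also have "\<dots> = k \<zeta>" by (simp only: k(2)[OF ker_reproducing(1)] ip_cnj[of k "ker \<zeta>", symmetric]
          ker_reproducing(2)[OF k(1), symmetric])
    finally show ?thesis .
  qed
  have l1: "?\<delta> z + t *\<^sub>R join v 0 = join (z + t *\<^sub>R v) (cnjv z)" for t
    by (simp add: vec_eq_iff join_def split: sum.splits)
  have H: "holo_fun_on (dir_deriv (join 0 (cnjv v)) kerc) \<Omega>c"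
    by (rule holo_fun_on_dir_deriv[OF kerc_holo open_\<Omega>c])
  have wb: "wirt_bar v (\<lambda>z. complex_of_real (\<kappa> z)) \<zeta> = dir_deriv (join 0 (cnjv v)) kerc (?\<delta> \<zeta>)" if "\<zeta> \<in> \<Omega>" for \<zeta>
    unfolding \<kappa>_eq_kerc by (rule wirt_diag(2)[OF kerc_holo that])
  show b: "wirt_bar v (\<lambda>z. complex_of_real (\<kappa> z)) z = k z"
    using wb[OF z] dker[OF z] by simp
  show "wirt v (\<lambda>z. complex_of_real (\<kappa> z)) z = cnj (k z)"
    using wirt_cnj(1)[OF \<kappa>_differentiable[OF z], of v] b by simp
  have "wirt v (wirt_bar v (\<lambda>z. complex_of_real (\<kappa> z))) z =
      wirt v (\<lambda>\<zeta>. dir_deriv (join 0 (cnjv v)) kerc (?\<delta> \<zeta>)) z"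
    by (rule wirt_cong(1)[OF open_\<Omega> z wb])
  also have "\<dots> = dir_deriv (join v 0) (dir_deriv (join 0 (cnjv v)) kerc) (?\<delta> z)"
    by (rule wirt_diag(1)[OF H z])
  also have "\<dots> = dir_deriv v (\<lambda>\<zeta>. dir_deriv (join 0 (cnjv v)) kerc (join \<zeta> (cnjv z))) z"
    by (simp add: dir_deriv_def[of "join v 0"] dir_deriv_def[of v] l1)
  also have "\<dots> = dir_deriv v k z" by (rule dir_deriv_cong[OF open_\<Omega> z dker])
  also have "\<dots> = of_real (sqn k)" using k ip_self by simp
  finally show "wirt v (wirt_bar v (\<lambda>z. complex_of_real (\<kappa> z))) z = of_real (sqn k)" .
qed

text \<open>The quotient rule. The numerator is the Gram determinant of \<open>k\<close> and K_z, as
  \<open>k z\<close> = <k, K_z> and \<kappa>(z) = <K_z, K_z>.\<close>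

lemma Levi_form:
  assumes z: "z \<in> \<Omega>" and k: "k \<in> A2" "\<And>f. f \<in> A2 \<Longrightarrow> dir_deriv v f z = ip f k"
  shows "wirt v (wirt_bar v (\<lambda>z. complex_of_real (ln (\<kappa> z)))) z =
    of_real ((sqn k * \<kappa> z - (cmod (k z))\<^sup>2) / (\<kappa> z)\<^sup>2)"
proof -
  let ?K = "\<lambda>z. complex_of_real (\<kappa> z)"
  have D: "wirt_bar v ?K z = k z" "wirt v ?K z = cnj (k z)" "wirt v (wirt_bar v ?K) z = of_real (sqn k)"
    using \<kappa>_derivs[OF z k] by simp_all
  have \<kappa>z: "\<kappa> z > 0" by (rule \<kappa>_pos[OF z])
  have nz: "?K z \<noteq> 0" using \<kappa>z by simp
  have inv: "(inverse has_field_derivative - (inverse (?K z) ^ 2)) (at (?K z))"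
    using DERIV_inverse[OF nz] by (simp add: numeral_2_eq_2)
  have dK: "?K differentiable (at z)" by (rule \<kappa>_differentiable[OF z])
  have dB: "wirt_bar v ?K differentiable (at z)"
    using Ck_wirt_bar[OF Ck_\<kappa> open_\<Omega>, of "Suc 0" v] z by (rule Ck_differentiable)
  have "wirt v (wirt_bar v (\<lambda>z. complex_of_real (ln (\<kappa> z)))) z = wirt v (\<lambda>y. wirt_bar v ?K y * inverse (?K y)) z"
    by (rule wirt_cong(1)[OF open_\<Omega> z])
      (simp add: wirt_bar_ln[OF open_\<Omega> \<kappa>_pos _ \<kappa>_differentiable] divide_inverse)
  also have "\<dots> = wirt_bar v ?K z * (- (inverse (?K z) ^ 2) * wirt v ?K z) + wirt v (wirt_bar v ?K) z * inverse (?K z)"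
    using wirt_mult(1)[OF dB dir_deriv_field_compose(2)[OF dK inv], of v] wirt_field_compose(1)[OF dK inv, of v] by simp
  also have "\<dots> = (of_real (sqn k) * ?K z - k z * cnj (k z)) / (?K z)\<^sup>2"
    using D nz by (simp add: field_simps power2_eq_square)
  finally show ?thesis
    by (simp only: complex_norm_square[symmetric] of_real_divide of_real_diff of_real_mult of_real_power)
qed

text \<open>Equality in the Cauchy-Schwarz inequality would make \<open>k\<close> a multiple of K_z,
  and the derivative along \<open>v\<close> would then vanish on every element that vanishes at
  \<open>z\<close>. The function x_i - z_i, for an index with v_i different from 0, refutes
  this.\<close>

lemma Levi_form_nonzero:
  assumes z: "z \<in> \<Omega>" and v: "v \<noteq> 0"
  shows "wirt v (wirt_bar v (\<lambda>z. complex_of_real (ln (\<kappa> z)))) z \<noteq> 0"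
proof
  assume 0: "wirt v (wirt_bar v (\<lambda>z. complex_of_real (ln (\<kappa> z)))) z = 0"
  let ?K = "\<lambda>z. complex_of_real (\<kappa> z)"
  obtain k where k: "k \<in> A2" "\<And>f. f \<in> A2 \<Longrightarrow> dir_deriv v f z = ip f k"
    using dir_deriv_representer[OF z] by blast
  have \<kappa>z: "\<kappa> z > 0" by (rule \<kappa>_pos[OF z])
  have eq: "sqn k * \<kappa> z = (cmod (k z))\<^sup>2"
    using trans[OF Levi_form[OF z k, symmetric] 0] \<kappa>z unfolding of_real_eq_0_iff by simp
  \<comment> \<open>The coefficient <k, K_z> / <K_z, K_z> of the orthogonal projection of
    \<open>k\<close> to the line spanned by K_z.\<close>
  define \<beta> where "\<beta> = k z / ?K z"
  have b: "(\<lambda>x. \<beta> * ker z x) \<in> A2" by (rule A2_cmult[OF ker_reproducing(1)])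
  have "cnj \<beta> * k z = of_real ((cmod (k z))\<^sup>2 / \<kappa> z)"
    using \<kappa>z by (simp add: \<beta>_def complex_norm_square mult.commute del: of_real_power)
  moreover have "ip k (\<lambda>x. \<beta> * ker z x) = cnj \<beta> * k z"
    using ker_reproducing(2)[OF k(1)] by (simp add: ip_cmult_right)
  moreover have "(cmod \<beta>)\<^sup>2 * \<kappa> z = (cmod (k z))\<^sup>2 / \<kappa> z"
    using \<kappa>z by (simp add: \<beta>_def norm_divide power_divide power2_eq_square)
  ultimately have "sqn (\<lambda>x. k x - \<beta> * ker z x) = sqn k - (cmod (k z))\<^sup>2 / \<kappa> z"
    using sqn_diff[OF k(1) b] sqn_cmult[of \<beta> "ker z"] ker_diag(2)[of z] by simp
  also have "\<dots> = 0" using eq \<kappa>z by (simp add: field_simps)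
  finally have "k x = \<beta> * ker z x" for x
    using sqn_zero_imp[OF A2_diff[OF k(1) b], of x] by simp
  then have k_fun: "k = (\<lambda>x. \<beta> * ker z x)" by blast
  obtain i where i: "v $ i \<noteq> 0" using v by (auto simp: vec_eq_iff)
  define f where "f x = (if x \<in> \<Omega> then x $ i - z $ i else 0)" for x
  have lin: "holo_fun_on (\<lambda>x. x $ i - z $ i) \<Omega>"
    by (intro holo_fun_on_diff holo_fun_on_component holo_fun_on_const open_\<Omega>)
  obtain B where B: "\<And>x. x \<in> \<Omega> \<Longrightarrow> norm x \<le> B" using bounded_\<Omega> bounded_iff by blast
  have "cmod (x $ i - z $ i) \<le> 2 * B" if "x \<in> \<Omega>" for x
  proof -
    have "cmod (x $ i - z $ i) \<le> cmod (x $ i) + cmod (z $ i)" by (rule norm_triangle_ineq4)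
    also have "\<dots> \<le> norm x + norm z" by (intro add_mono Finite_Cartesian_Product.norm_nth_le)
    also have "\<dots> \<le> 2 * B" using B[OF that] B[OF z] by simp
    finally show ?thesis .
  qed
  from A2_bounded[OF lin this] have f: "f \<in> A2" by (simp add: f_def[abs_def])
  have "dir_deriv v f z = dir_deriv v (\<lambda>x. x $ i - z $ i) z"
    by (rule dir_deriv_cong[OF open_\<Omega> z]) (simp add: f_def)
  also have "\<dots> = v $ i"
    by (rule dir_deriv_eq) (auto intro!: derivative_eq_intros bounded_linear_imp_has_derivative bounded_linear_vec_nth)
  finally have "v $ i = ip f k" using k(2)[OF f] by simp
  also have "ip f k = cnj \<beta> * f z"
    using ker_reproducing(2)[OF f, of z] ip_cmult_right[of f \<beta> "ker z"] k_fun by simp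
  also have "f z = 0" by (simp add: f_def)
  finally show False using i by simp
qed

definition hess :: "complex ^ 'n \<Rightarrow> complex ^ 'n ^ 'n" where
  "hess x = (\<chi> i j. d_z i (d_zbar j (\<lambda>z. complex_of_real (ln (\<kappa> z)))) x)"

text \<open>A null vector of the transpose is a direction in which the Levi form, the sum of v_i
  conj(v_j) H_ij, vanishes.\<close>

lemma det_hess_nonzero:
  assumes "z \<in> \<Omega>"
  shows "det (hess z) \<noteq> 0"
proof
  assume "det (hess z) = 0"
  then have "\<not> invertible (transpose (hess z))" by (simp add: invertible_det_nz)
  then obtain v where v: "transpose (hess z) *v v = 0" "v \<noteq> 0"
    using matrix_left_invertible_ker[of "transpose (hess z)"] by (auto simp: invertible_left_inverse)
  have "(\<Sum>i\<in>UNIV. v $ i * hess z $ i $ j) = 0" for j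
    using v(1) by (simp add: vec_eq_iff matrix_vector_mult_def transpose_def mult.commute)
  then have "(\<Sum>j\<in>UNIV. cnj (v $ j) * (\<Sum>i\<in>UNIV. v $ i * hess z $ i $ j)) = 0" by simp
  moreover have "wirt v (wirt_bar v (\<lambda>z. complex_of_real (ln (\<kappa> z)))) z =
      (\<Sum>j\<in>UNIV. cnj (v $ j) * (\<Sum>i\<in>UNIV. v $ i * hess z $ i $ j))"
    unfolding wirt_wirt_bar_expand[OF Ck_log_\<kappa> open_\<Omega> assms, of v v] sum_distrib_left
    by (subst sum.swap, intro sum.cong refl) (simp add: hess_def)
  ultimately show False using Levi_form_nonzero[OF assms v(2)] by simp
qed

end


section \<open>Holomorphic involutions\<close>

lemma complex_linearI:
  assumes "linear f" "\<And>c v. f (c *s v) = c *s f v"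
  shows "Vector_Spaces.linear (*s) (*s) (f :: complex ^ 'n \<Rightarrow> complex ^ 'm)"
  using assms by (simp add: Vector_Spaces.linear_iff linear_add vec.vector_space_axioms)

lemma linear_norm_le_sum_Basis:
  fixes L :: "'a::euclidean_space \<Rightarrow> 'b::real_normed_vector"
  assumes "linear L"
  shows "norm (L v) \<le> (\<Sum>b\<in>Basis. norm (L b)) * norm v"
proof -
  have "L v = (\<Sum>b\<in>Basis. (v \<bullet> b) *\<^sub>R L b)"
    using linear_sum[OF assms, of "\<lambda>b. (v \<bullet> b) *\<^sub>R b" Basis]
    by (simp add: euclidean_representation linear_cmul[OF assms])
  also have "norm \<dots> \<le> (\<Sum>b\<in>Basis. norm (L b) * norm v)"
    by (intro sum_norm_le) (auto simp: mult.commute[of "\<bar>_\<bar>"] intro!: mult_left_mono Basis_le_norm)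
  finally show ?thesis by (simp add: sum_distrib_right)
qed

locale holo_involution = bounded_open_set \<Omega> for \<Omega> :: "(complex ^ 'n) set" +
  fixes s :: "complex ^ 'n \<Rightarrow> complex ^ 'n" and s' :: "complex ^ 'n \<Rightarrow> complex ^ 'n \<Rightarrow> complex ^ 'n"
  assumes s': "x \<in> \<Omega> \<Longrightarrow> (s has_derivative s' x) (at x)"
    and s'_scale: "x \<in> \<Omega> \<Longrightarrow> s' x (c *s v) = c *s s' x v"
    and s_in: "x \<in> \<Omega> \<Longrightarrow> s x \<in> \<Omega>"
    and s_s: "x \<in> \<Omega> \<Longrightarrow> s (s x) = x"
begin

definition J :: "complex ^ 'n \<Rightarrow> complex" where
  "J x = det (matrix (s' x))"

lemma linear_s': "x \<in> \<Omega> \<Longrightarrow> linear (s' x)"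
  using s' has_derivative_linear by blast

lemma s'_nth:
  assumes "x \<in> \<Omega>"
  shows "((\<lambda>y. s y $ l) has_derivative (\<lambda>h. s' x h $ l)) (at x)" "s' x v $ l = dir_deriv v (\<lambda>y. s y $ l) x"
proof -
  show *: "((\<lambda>y. s y $ l) has_derivative (\<lambda>h. s' x h $ l)) (at x)"
    using bounded_linear.has_derivative[OF bounded_linear_vec_nth s'[OF assms]] .
  show "s' x v $ l = dir_deriv v (\<lambda>y. s y $ l) x"
    using dir_deriv_eq[OF *] by simp
qed

lemma s_nth_holo: "holo_fun_on (\<lambda>y. s y $ l) \<Omega>"
  by (rule holo_fun_onI[OF open_\<Omega> s'_nth(1)]) (auto simp: s'_scale)

lemma s'_nth_holo: "holo_fun_on (\<lambda>x. s' x v $ l) \<Omega>"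
  by (rule holo_fun_on_cong[OF holo_fun_on_dir_deriv[OF s_nth_holo open_\<Omega>] open_\<Omega>]) (simp add: s'_nth(2))

lemma J_holo: "holo_fun_on J \<Omega>"
  unfolding J_def[abs_def]
  by (rule holo_fun_on_det[OF _ open_\<Omega>]) (simp add: matrix_def s'_nth_holo)

lemma s'_s': "x \<in> \<Omega> \<Longrightarrow> s' (s x) (s' x v) = v"
proof -
  assume x: "x \<in> \<Omega>"
  have "((\<lambda>y. s (s y)) has_derivative (\<lambda>h. s' (s x) (s' x h))) (at x)"
    by (rule has_derivative_compose[OF s'[OF x] s'[OF s_in[OF x]]])
  then have "((\<lambda>y. y) has_derivative (\<lambda>h. s' (s x) (s' x h))) (at x)"
    by (rule has_derivative_transform_within_open[OF _ open_\<Omega> x]) (simp add: s_s)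
  from has_derivative_unique[OF this has_derivative_ident] show ?thesis by metis
qed

lemma J_J: "x \<in> \<Omega> \<Longrightarrow> J (s x) * J x = 1"
proof -
  assume x: "x \<in> \<Omega>"
  have l1: "Vector_Spaces.linear (*s) (*s) (s' x)" and l2: "Vector_Spaces.linear (*s) (*s) (s' (s x))"
    by (intro complex_linearI linear_s' s'_scale x s_in)+
  have "matrix (s' (s x)) ** matrix (s' x) *v v = v" for v
    by (simp add: matrix_vector_mul_assoc[symmetric] matrix_works[OF l1] matrix_works[OF l2] s'_s'[OF x])
  then have "matrix (s' (s x)) ** matrix (s' x) = mat 1"
    by (metis matrix_eq matrix_vector_mul_lid)
  then show ?thesis unfolding J_def det_mul[symmetric] by simp
qed

lemma J_nonzero: "x \<in> \<Omega> \<Longrightarrow> J x \<noteq> 0"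
  using J_J by fastforce

text \<open>The operator induced on the Bergman space by the involution. The factor \<open>J\<close>
  absorbs the real Jacobian |J|^2 of the substitution, which makes the operator unitary.\<close>

definition U :: "(complex ^ 'n \<Rightarrow> complex) \<Rightarrow> complex ^ 'n \<Rightarrow> complex" where
  "U f z = (if z \<in> \<Omega> then f (s z) * J z else 0)"

lemma change_of_variables:
  fixes g :: "complex ^ 'n \<Rightarrow> 'b::{banach, second_countable_topology}"
  assumes "continuous_on \<Omega> g"
  shows "set_integrable lborel \<Omega> (\<lambda>x. (cmod (J x))\<^sup>2 *\<^sub>R g (s x)) \<longleftrightarrow> set_integrable lborel \<Omega> g"
    and "(LINT x:\<Omega>|lborel. (cmod (J x))\<^sup>2 *\<^sub>R g (s x)) = (LINT x:\<Omega>|lborel. g x)"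
proof -
  have inj: "inj_on s \<Omega>" by (metis inj_onI s_s)
  have im: "s ` \<Omega> = \<Omega>" using s_in s_s by (auto simp: image_iff) metis
  note c = holo_change_of_variables[OF open_\<Omega> s' s'_scale inj _ im finite_\<Omega> assms, folded J_def]
  show "set_integrable lborel \<Omega> (\<lambda>x. (cmod (J x))\<^sup>2 *\<^sub>R g (s x)) \<longleftrightarrow> set_integrable lborel \<Omega> g"
    "(LINT x:\<Omega>|lborel. (cmod (J x))\<^sup>2 *\<^sub>R g (s x)) = (LINT x:\<Omega>|lborel. g x)"
    using c holo_fun_on_continuous_on[OF J_holo open_\<Omega>] by blast+
qed

lemma U_A2: "f \<in> A2 \<Longrightarrow> U f \<in> A2"
proof -
  assume f: "f \<in> A2"
  have "holo_fun_on (\<lambda>x. f (s x) * J x) \<Omega>"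
    by (intro holo_fun_on_mult J_holo open_\<Omega> holo_fun_on_compose[OF A2_holo[OF f] open_\<Omega> s' s'_scale] s_in)
  then have h: "holo_fun_on (U f) \<Omega>"
    by (rule holo_fun_on_cong[OF _ open_\<Omega>]) (simp add: U_def)
  have "set_integrable lborel \<Omega> (\<lambda>x. (cmod (J x))\<^sup>2 *\<^sub>R (cmod (f (s x)))\<^sup>2)"
    using change_of_variables(1)[of "\<lambda>x. (cmod (f x))\<^sup>2"] A2_int[OF f] A2_cont[OF f]
    by (simp add: continuous_on_power continuous_on_norm)
  then have "set_integrable lborel \<Omega> (\<lambda>x. (cmod (U f x))\<^sup>2)"
    by (rule set_integrable_cong[THEN iffD1, rotated -1])
      (auto simp: U_def norm_mult power_mult_distrib mult.commute)
  then show ?thesis using h by (simp add: bergman_space_def U_def)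
qed

lemma U_ip: "f \<in> A2 \<Longrightarrow> g \<in> A2 \<Longrightarrow> ip (U f) (U g) = ip f g"
proof -
  assume fg: "f \<in> A2" "g \<in> A2"
  have "ip f g = (LINT x:\<Omega>|lborel. (cmod (J x))\<^sup>2 *\<^sub>R (f (s x) * cnj (g (s x))))"
    unfolding ip_def using fg
    by (intro change_of_variables(2)[of "\<lambda>z. f z * cnj (g z)", symmetric] continuous_intros A2_cont)
  also have "\<dots> = ip (U f) (U g)"
    unfolding ip_def using open_\<Omega>
    by (intro set_lebesgue_integral_cong)
      (auto simp: U_def scaleR_conv_of_real complex_norm_square simp del: of_real_power)
  finally show ?thesis by simp
qed

lemma U_U: "f \<in> A2 \<Longrightarrow> U (U f) = f"
proof
  fix z assume f: "f \<in> A2"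
  show "U (U f) z = f z"
  proof (cases "z \<in> \<Omega>")
    case True
    then show ?thesis using J_J[OF True] by (simp add: U_def s_in s_s mult.assoc)
  qed (use A2_off[OF f] in \<open>auto simp: U_def\<close>)
qed

text \<open>With w = s z and \<open>U\<close> unitary and its own inverse, <U K_w, K_z> = <K_w, U
  K_z>. The reproducing property evaluates the left side to K(w, w) J(z) and the right side to the
  conjugate of K(z, z) J(w); finally J(w) J(z) = 1.\<close>

lemma \<kappa>_transform:
  assumes z: "z \<in> \<Omega>"
  shows "\<kappa> (s z) * (cmod (J z))\<^sup>2 = \<kappa> z"
proof -
  let ?k = "ker (s z)"
  have k: "?k \<in> A2" "ker z \<in> A2" by (rule ker_reproducing)+
  have "?k (s z) * J z = U ?k z" using z by (simp add: U_def)
  also have "\<dots> = ip (U ?k) (ker z)" by (rule ker_reproducing(2)[OF U_A2[OF k(1)]])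
  also have "\<dots> = ip ?k (U (ker z))"
    using U_ip[OF U_A2[OF k(1)] k(2)] U_U[OF k(1)] by simp
  also have "\<dots> = cnj (U (ker z) (s z))"
    using ker_reproducing(2)[OF U_A2[OF k(2)], of "s z"] ip_cnj[of ?k "U (ker z)"] by simp
  also have "U (ker z) (s z) = of_real (\<kappa> z) * J (s z)"
    using z by (simp add: U_def s_in s_s ker_diag(1))
  finally have "of_real (\<kappa> (s z)) * (J z * cnj (J z)) = of_real (\<kappa> z) * cnj (J (s z) * J z)"
    by (simp add: ker_diag(1) mult.assoc[symmetric])
  then have "complex_of_real (\<kappa> (s z) * (cmod (J z))\<^sup>2) = of_real (\<kappa> z)"
    unfolding J_J[OF z] complex_norm_square[symmetric] by simp
  then show ?thesis using of_real_eq_iff by blast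
qed

text \<open>The antiholomorphic derivative of log (J conj J) is the conjugate of dJ / J, and a
  holomorphic derivative annihilates the conjugate of a holomorphic function.\<close>

lemma pluriharmonic_log_J:
  assumes x: "x \<in> \<Omega>"
  shows "wirt v (wirt_bar w (\<lambda>z. complex_of_real (ln ((cmod (J z))\<^sup>2)))) x = 0"
proof -
  have pos: "(cmod (J z))\<^sup>2 > 0" if "z \<in> \<Omega>" for z using J_nonzero[OF that] by simp
  have dJ: "J differentiable (at z)" if "z \<in> \<Omega>" for z
    using differentiableI[OF holo_fun_on_has_derivative[OF J_holo open_\<Omega> that]] .
  have dcJ: "(\<lambda>z. cnj (J z)) differentiable (at z)" if "z \<in> \<Omega>" for z
    using differentiableI[OF has_derivative_cnj[OF differentiable_dir_deriv[OF dJ[OF that]]]] .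
  have sq: "complex_of_real ((cmod (J z))\<^sup>2) = J z * cnj (J z)" for z by (rule complex_norm_square)
  have dsq: "(\<lambda>z. complex_of_real ((cmod (J z))\<^sup>2)) differentiable (at z)" if "z \<in> \<Omega>" for z
    unfolding sq using dJ[OF that] dcJ[OF that] by (rule differentiable_mult)
  define q where "q z = dir_deriv w J z * inverse (J z)" for z
  have wb: "wirt_bar w (\<lambda>z. complex_of_real (ln ((cmod (J z))\<^sup>2))) z = cnj (q z)" if z: "z \<in> \<Omega>" for z
  proof -
    have "wirt_bar w (\<lambda>z. complex_of_real (ln ((cmod (J z))\<^sup>2))) z =
        wirt_bar w (\<lambda>z. complex_of_real ((cmod (J z))\<^sup>2)) z / of_real ((cmod (J z))\<^sup>2)"
      by (rule wirt_bar_ln[OF open_\<Omega> pos z dsq[OF z]])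
    also have "\<dots> = J z * cnj (dir_deriv w J z) / (J z * cnj (J z))"
      unfolding sq wirt_mult(2)[OF dJ[OF z] dcJ[OF z]] wirt_cnj(2)[OF dJ[OF z]] wirt_holo[OF J_holo open_\<Omega> z] by simp
    also have "\<dots> = cnj (q z)" using J_nonzero[OF z] by (simp add: q_def field_simps)
    finally show ?thesis .
  qed
  have inv: "(inverse has_field_derivative - (inverse (J x) ^ Suc (Suc 0))) (at (J x))"
    using DERIV_inverse[OF J_nonzero[OF x]] .
  have dD: "dir_deriv w J differentiable (at x)"
    using differentiableI[OF holo_fun_on_has_derivative[OF holo_fun_on_dir_deriv[OF J_holo open_\<Omega>] open_\<Omega> x]] .
  have dI: "(\<lambda>z. inverse (J z)) differentiable (at x)" by (rule dir_deriv_field_compose(2)[OF dJ[OF x] inv])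
  have dq: "q differentiable (at x)" unfolding q_def[abs_def] using dD dI by (rule differentiable_mult)
  have "wirt v (wirt_bar w (\<lambda>z. complex_of_real (ln ((cmod (J z))\<^sup>2)))) x = wirt v (\<lambda>z. cnj (q z)) x"
    by (rule wirt_cong(1)[OF open_\<Omega> x wb])
  also have "\<dots> = cnj (wirt_bar v q x)" by (rule wirt_cnj(1)[OF dq])
  also have "wirt_bar v q x = 0"
    unfolding q_def[abs_def] wirt_mult(2)[OF dD dI] wirt_field_compose(2)[OF dJ[OF x] inv]
      wirt_holo(2)[OF J_holo open_\<Omega> x] wirt_holo(2)[OF holo_fun_on_dir_deriv[OF J_holo open_\<Omega>] open_\<Omega> x]
    by simp
  finally show ?thesis by simp
qed

text \<open>\<open>\<kappa>_transform\<close> says that log \<kappa> is its own pullback under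
  \<open>s\<close> plus log |J|^2, whose Hessian is zero. The Hessian is thus pulled back as a
  Hermitian form, to M^T H(s x) conj(M) with M the matrix of \<open>s' x\<close>.\<close>

lemma det_hess_transform:
  assumes x: "x \<in> \<Omega>"
  shows "det (hess x) = of_real ((cmod (J x))\<^sup>2) * det (hess (s x))"
proof -
  let ?L = "\<lambda>z. complex_of_real (ln (\<kappa> z))"
  let ?P = "\<lambda>z. complex_of_real (ln ((cmod (J z))\<^sup>2))"
  let ?S = "\<lambda>l j y. s' y (axis j 1) $ l"
  have C: "Ck k ?L \<Omega>" for k by (rule Ck_log_\<kappa>)
  have dL: "?L differentiable (at z)" if "z \<in> \<Omega>" for z using Ck_differentiable[OF C that] .
  have dLb: "wirt_bar w ?L differentiable (at z)" if "z \<in> \<Omega>" for z w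
    using Ck_differentiable[OF Ck_wirt_bar[OF C open_\<Omega>] that] .
  have L: "?L z = ?L (s z) + ?P z" if "z \<in> \<Omega>" for z
    unfolding \<kappa>_transform[OF that, symmetric] using \<kappa>_pos[OF s_in[OF that]] J_nonzero[OF that]
    by (simp add: ln_mult)
  have dLs: "(\<lambda>z. ?L (s z)) differentiable (at z)" if "z \<in> \<Omega>" for z
    by (rule dir_deriv_compose(2)[OF dL[OF s_in[OF that]] s'[OF that]])
  have sq: "complex_of_real ((cmod (J z))\<^sup>2) = J z * cnj (J z)" for z by (rule complex_norm_square)
  have P: "Ck k ?P \<Omega>" for k
  proof (rule Ck_ln[OF open_\<Omega>])
    show "Ck k (\<lambda>z. complex_of_real ((cmod (J z))\<^sup>2)) \<Omega>"
      unfolding sq by (intro Ck_mult Ck_cnj Ck_holo J_holo open_\<Omega>)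
  qed (simp add: J_nonzero)
  have dP: "?P differentiable (at z)" if "z \<in> \<Omega>" for z using Ck_differentiable[OF P that] .
  have dPb: "wirt_bar w ?P differentiable (at x)" for w
    using Ck_differentiable[OF Ck_wirt_bar[OF P open_\<Omega>] x] .
  have dS: "?S l j differentiable (at x)" for l j
    using differentiableI[OF holo_fun_on_has_derivative[OF s'_nth_holo open_\<Omega> x]] .
  have dcS: "(\<lambda>y. cnj (?S l j y)) differentiable (at x)" for l j
    using differentiableI[OF has_derivative_cnj[OF differentiable_dir_deriv[OF dS]]] .
  have dLbs: "(\<lambda>y. d_zbar l ?L (s y)) differentiable (at x)" for l
    by (rule dir_deriv_compose(2)[OF dLb[OF s_in[OF x]] s'[OF x]])
  have b: "d_zbar j (\<lambda>z. ?L (s z)) y = (\<Sum>l\<in>UNIV. cnj (?S l j y) * d_zbar l ?L (s y))" if y: "y \<in> \<Omega>" for j y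
    by (rule trans[OF wirt_compose(2)[OF dL[OF s_in[OF y]] s'[OF y] s'_scale[OF y]] wirt_expand(2)[OF dL[OF s_in[OF y]]]])
  have dsum: "(\<lambda>y. \<Sum>l\<in>UNIV. cnj (?S l j y) * d_zbar l ?L (s y)) differentiable (at x)" for j
    by (intro differentiable_sum ballI differentiable_mult dcS dLbs finite)
  have entry: "hess x $ i $ j = (\<Sum>l\<in>UNIV. (\<Sum>k\<in>UNIV. ?S k i x * hess (s x) $ k $ l) * cnj (?S l j x))" for i j
  proof -
    have "hess x $ i $ j = d_z i (d_zbar j ?L) x" by (simp add: hess_def)
    also have "\<dots> = d_z i (\<lambda>y. (\<Sum>l\<in>UNIV. cnj (?S l j y) * d_zbar l ?L (s y)) + d_zbar j ?P y) x"
    proof (rule wirt_cong(1)[OF open_\<Omega> x])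
      fix y assume y: "y \<in> \<Omega>"
      have "d_zbar j ?L y = d_zbar j (\<lambda>z. ?L (s z) + ?P z) y"
        by (rule wirt_cong(2)[OF open_\<Omega> y L])
      also have "\<dots> = d_zbar j (\<lambda>z. ?L (s z)) y + d_zbar j ?P y"
        by (rule wirt_add(2)[OF dLs[OF y] dP[OF y]])
      finally show "d_zbar j ?L y = (\<Sum>l\<in>UNIV. cnj (?S l j y) * d_zbar l ?L (s y)) + d_zbar j ?P y"
        by (simp only: b[OF y])
    qed
    also have "\<dots> = d_z i (\<lambda>y. \<Sum>l\<in>UNIV. cnj (?S l j y) * d_zbar l ?L (s y)) x"
      unfolding wirt_add(1)[OF dsum dPb] pluriharmonic_log_J[OF x] by simp
    also have "\<dots> = (\<Sum>l\<in>UNIV. d_z i (\<lambda>y. cnj (?S l j y) * d_zbar l ?L (s y)) x)"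
      by (rule wirt_sum(1)) (intro differentiable_mult dcS dLbs)
    also have "\<dots> = (\<Sum>l\<in>UNIV. (\<Sum>k\<in>UNIV. ?S k i x * hess (s x) $ k $ l) * cnj (?S l j x))"
    proof (intro sum.cong refl)
      fix l
      have "d_z i (\<lambda>y. cnj (?S l j y) * d_zbar l ?L (s y)) x =
          cnj (?S l j x) * wirt (s' x (axis i 1)) (d_zbar l ?L) (s x)"
        by (simp only: wirt_mult(1)[OF dcS dLbs] wirt_cnj(1)[OF dS] wirt_holo(2)[OF s'_nth_holo open_\<Omega> x]
            wirt_compose(1)[OF dLb[OF s_in[OF x]] s'[OF x] s'_scale[OF x]]) simp
      also have "wirt (s' x (axis i 1)) (d_zbar l ?L) (s x) = (\<Sum>k\<in>UNIV. ?S k i x * hess (s x) $ k $ l)"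
        by (rule trans[OF wirt_expand(1)[OF dLb[OF s_in[OF x]]]]) (simp add: hess_def)
      finally show "d_z i (\<lambda>y. cnj (?S l j y) * d_zbar l ?L (s y)) x =
          (\<Sum>k\<in>UNIV. ?S k i x * hess (s x) $ k $ l) * cnj (?S l j x)" by (simp only: mult.commute)
    qed
    finally show ?thesis .
  qed
  let ?M = "matrix (s' x)"
  have "hess x = transpose ?M ** hess (s x) ** (\<chi> i j. cnj (?M $ i $ j))"
    by (simp add: vec_eq_iff matrix_matrix_mult_def transpose_def entry matrix_def)
  moreover have "det (\<chi> i j. cnj (?M $ i $ j)) = cnj (J x)" by (simp add: J_def det_def)
  ultimately have "det (hess x) = J x * det (hess (s x)) * cnj (J x)"
    by (simp add: det_mul det_transpose J_def)
  then show ?thesis by (simp only: complex_norm_square mult_ac)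
qed

text \<open>
  The map \<open>\<phi> = (id + A s) / 2\<close> with \<open>A = ds(p)\<close> conjugates \<open>s\<close> to \<open>A\<close> near \<open>p\<close>, so a fixed vector of \<open>A\<close>
  would produce fixed points of \<open>s\<close> arbitrarily close to \<open>p\<close>.
\<close>

lemma involution_derivative:
  assumes p: "p isolated_in {x \<in> \<Omega>. s x = x}"
  shows "s' p v = - v"
proof (rule ccontr)
  obtain T where T: "open T" "T \<inter> {x \<in> \<Omega>. s x = x} = {p}" and p': "p \<in> \<Omega>" "s p = p"
    using p unfolding isolated_in_def by auto
  assume neq: "s' p v \<noteq> - v"
  define A where "A = s' p"
  have linA: "linear A" unfolding A_def by (rule linear_s'[OF p'(1)])
  have blA: "bounded_linear A" using linA linear_conv_bounded_linear by blast
  have AA: "A (A h) = h" for h using s'_s'[OF p'(1), of h] p'(2) by (simp add: A_def)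
  \<comment> \<open>Fixed by \<open>A\<close> because \<open>A\<close> is an involution, and nonzero
    exactly because \<open>A v\<close> is not \<open>- v\<close>.\<close>
  define u where "u = v + A v"
  have u: "u \<noteq> 0" "A u = u" using neq by (auto simp: u_def A_def[symmetric] linear_add[OF linA] AA eq_neg_iff_add_eq_0 add.commute)
  define \<phi> where "\<phi> x = (1 / 2) *\<^sub>R (x + A (s x))" for x
  define \<phi>' where "\<phi>' x h = (1 / 2) *\<^sub>R (h + A (s' x h))" for x h
  have d\<phi>: "(\<phi> has_derivative \<phi>' x) (at x)" if "x \<in> \<Omega>" for x
    unfolding \<phi>_def[abs_def] \<phi>'_def[abs_def]
    by (intro has_derivative_scaleR_right has_derivative_add has_derivative_ident
        bounded_linear.has_derivative[OF blA s'[OF that]])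
  have \<phi>'p: "\<phi>' p = id" using AA by (auto simp: \<phi>'_def A_def[symmetric] fun_eq_iff)
  have cont_s': "continuous_on \<Omega> (\<lambda>x. s' x b)" for b
  proof -
    have "continuous_on \<Omega> (\<lambda>x. \<chi> l. s' x b $ l)"
      by (intro continuous_on_vec_lambda holo_fun_on_continuous_on[OF s'_nth_holo open_\<Omega>])
    then show ?thesis by simp
  qed
  \<comment> \<open>Dominates the operator norm of \<open>\<phi>' x - \<phi>' p\<close> and is
    continuous with value 0 at \<open>p\<close>; local injectivity of \<open>\<phi>\<close> needs
    this closeness of derivatives.\<close>
  define N where "N x = (\<Sum>b\<in>Basis. norm (\<phi>' x b - \<phi>' p b))" for x
  have contN: "continuous_on \<Omega> N"
    unfolding N_def \<phi>'_def by (intro continuous_intros bounded_linear.continuous_on[OF blA] cont_s')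
  have ons: "\<exists>d>0. \<forall>x. dist p x < d \<longrightarrow> onorm (\<lambda>v. \<phi>' x v - \<phi>' p v) < e" if e: "e > 0" for e
  proof -
    have "isCont N p" using contN open_\<Omega> p'(1) by (simp add: continuous_on_eq_continuous_at)
    then obtain d1 where d1: "d1 > 0" "\<And>x. dist p x < d1 \<Longrightarrow> dist (N x) (N p) < e"
      using e unfolding continuous_at_eps_delta by (metis dist_commute)
    obtain d2 where d2: "d2 > 0" "ball p d2 \<subseteq> \<Omega>" using open_\<Omega> p'(1) open_contains_ball by meson
    have "onorm (\<lambda>v. \<phi>' x v - \<phi>' p v) < e" if x: "dist p x < min d1 d2" for x
    proof -
      have "x \<in> \<Omega>" using x d2 by auto
      then have "linear (\<lambda>v. \<phi>' x v - \<phi>' p v)"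
        using d\<phi> p'(1) by (intro linear_compose_sub has_derivative_linear) auto
      then have "onorm (\<lambda>v. \<phi>' x v - \<phi>' p v) \<le> N x"
        unfolding N_def by (intro onorm_le linear_norm_le_sum_Basis)
      moreover have "N p = 0" by (simp add: N_def)
      ultimately show ?thesis using d1(2)[of x] x by (simp add: dist_real_def)
    qed
    then show ?thesis using d1(1) d2(1) by (intro exI[of _ "min d1 d2"]) auto
  qed
  obtain r where r: "r > 0" "ball p r \<subseteq> \<Omega>" "inj_on \<phi> (ball p r)"
  proof (rule has_derivative_locally_injective[of p \<Omega> id \<phi>' \<phi>, OF p'(1) open_\<Omega> _ _ d\<phi>])
    show "bounded_linear (id :: complex ^ 'n \<Rightarrow> _)" unfolding id_def by (rule bounded_linear_ident)
    show "id \<circ> \<phi>' p = id" by (simp add: \<phi>'p)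
  qed (use ons in auto)
  have "isCont s p" using has_derivative_continuous[OF s'[OF p'(1)]] .
  then obtain d where d: "d > 0" "\<And>x. dist x p < d \<Longrightarrow> dist (s x) (s p) < r"
    using r(1) unfolding continuous_at_eps_delta by metis
  have "p \<in> T" using T(2) by blast
  then obtain t where t: "t > 0" "ball p t \<subseteq> T" using T(1) openE by blast
  \<comment> \<open>The radius \<open>r\<close> keeps \<open>x\<close> where \<open>\<phi>\<close>
    is injective, \<open>d\<close> keeps \<open>s x\<close> there as well, and \<open>t\<close>
    keeps \<open>x\<close> in the neighbourhood \<open>T\<close> that contains no fixed point
    besides \<open>p\<close>.\<close>
  define \<epsilon> where "\<epsilon> = min (min r d) t"
  have \<epsilon>: "\<epsilon> > 0" "\<epsilon> \<le> r" "\<epsilon> \<le> d" "\<epsilon> \<le> t" using r(1) d(1) t(1) by (auto simp: \<epsilon>_def)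
  have "\<phi> p \<in> interior (\<phi> ` ball p \<epsilon>)"
  proof (rule sussmann_open_mapping[OF open_\<Omega> _ p'(1) d\<phi>[OF p'(1)]])
    show "continuous_on \<Omega> \<phi>"
      using d\<phi> by (meson continuous_at_imp_continuous_on has_derivative_continuous)
    show "bounded_linear (id :: complex ^ 'n \<Rightarrow> _)" unfolding id_def by (rule bounded_linear_ident)
    show "\<phi>' p \<circ> id = id" by (simp add: \<phi>'p)
    show "ball p \<epsilon> \<subseteq> \<Omega>" using r(2) \<epsilon>(2) by (meson order_trans subset_ball)
    show "p \<in> interior (ball p \<epsilon>)" using \<epsilon>(1) by (simp add: interior_open)
  qed
  then obtain e where e: "e > 0" "ball (\<phi> p) e \<subseteq> \<phi> ` ball p \<epsilon>"
    by (meson mem_interior)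
  define \<tau> where "\<tau> = e / (2 * norm u)"
  have \<tau>: "\<tau> > 0" "norm (\<tau> *\<^sub>R u) < e" using e(1) u(1) by (auto simp: \<tau>_def)
  then have "\<phi> p + \<tau> *\<^sub>R u \<in> ball (\<phi> p) e" by (simp add: dist_norm)
  then have "\<phi> p + \<tau> *\<^sub>R u \<in> \<phi> ` ball p \<epsilon>" using e(2) by blast
  then obtain x where x: "x \<in> ball p \<epsilon>" "\<phi> x = \<phi> p + \<tau> *\<^sub>R u" by (metis imageE)
  have x\<Omega>: "x \<in> \<Omega>" using x(1) \<epsilon>(2) r(2) by auto
  \<comment> \<open>The conjugation relation. As \<open>A\<close> fixes \<phi>(p) + \<tau> u, it
    gives \<phi>(s x) = \<phi>(x), so injectivity makes \<open>x\<close> a fixed point of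
    \<open>s\<close>; it differs from \<open>p\<close> because \<tau> u is not zero.\<close>
  have "A (\<phi> y) = \<phi> (s y)" if "y \<in> \<Omega>" for y
    by (simp add: \<phi>_def linear_add[OF linA] linear_cmul[OF linA] AA s_s[OF that] add.commute)
  then have "\<phi> (s x) = A (\<phi> p + \<tau> *\<^sub>R u)" "A (\<phi> p) = \<phi> p"
    using x(2) x\<Omega> p' by metis+
  then have "\<phi> (s x) = \<phi> x" by (simp add: linear_add[OF linA] linear_cmul[OF linA] u(2) x(2))
  moreover have "s x \<in> ball p r" "x \<in> ball p r"
    using d(2)[of x] x(1) \<epsilon> p'(2) by (auto simp: dist_commute)
  ultimately have "s x = x" using r(3) by (simp add: inj_on_def)
  moreover have "x \<in> T" using t(2) x(1) \<epsilon>(4) by auto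
  ultimately have "x = p" using T(2) x\<Omega> by blast
  then show False using x(2) \<tau>(1) u(1) by simp
qed

end


section \<open>Proportionality of the Bergman volume form and the kernel\<close>

context bounded_open_set
begin

lemma Levi_form_real:
  assumes z: "z \<in> \<Omega>"
  shows "Im (wirt v (wirt_bar v (\<lambda>z. complex_of_real (ln (\<kappa> z)))) z) = 0"
proof -
  obtain k where k: "k \<in> A2" "\<And>f. f \<in> A2 \<Longrightarrow> dir_deriv v f z = ip f k"
    using dir_deriv_representer[OF z] by blast
  show ?thesis using arg_cong[where f = Im, OF Levi_form[OF z k]] by simp
qed

text \<open>Polarization: a sesquilinear form that is real on the diagonal is Hermitian. The
  diagonal values are Levi forms; the vectors v + w and \<i> v + w give the imaginary and the real
  part of the symmetry.\<close>

lemma hess_hermitian: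
  assumes z: "z \<in> \<Omega>"
  shows "hess z $ i $ j = cnj (hess z $ j $ i)"
proof -
  let ?L = "\<lambda>z. complex_of_real (ln (\<kappa> z))"
  define B where "B v w = wirt v (wirt_bar w ?L) z" for v w
  have f1: "?L differentiable (at y)" if "y \<in> \<Omega>" for y using Ck_differentiable[OF Ck_log_\<kappa> that] .
  have f2: "wirt_bar u ?L differentiable (at z)" for u
    using Ck_differentiable[OF Ck_wirt_bar[OF Ck_log_\<kappa> open_\<Omega>] z] .
  have B1: "B (v + v') w = B v w + B v' w" "B (c *s v) w = c * B v w" for v v' w c
    unfolding B_def by (rule wirt_linear[OF f2])+
  have B2: "B v (w + w') = B v w + B v w'" for v w w'
  proof -
    have "B v (w + w') = wirt v (\<lambda>y. wirt_bar w ?L y + wirt_bar w' ?L y) z"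
      unfolding B_def by (rule wirt_cong(1)[OF open_\<Omega> z]) (rule wirt_linear(2)[OF f1])
    then show ?thesis unfolding B_def by (simp only: wirt_add(1)[OF f2 f2])
  qed
  have B3: "B v (c *s w) = cnj c * B v w" for v w c
  proof -
    have "B v (c *s w) = wirt v (\<lambda>y. cnj c * wirt_bar w ?L y) z"
      unfolding B_def by (rule wirt_cong(1)[OF open_\<Omega> z]) (rule wirt_linear(4)[OF f1])
    then show ?thesis unfolding B_def by (simp only: wirt_cmult(1)[OF f2])
  qed
  have real: "Im (B v v) = 0" for v unfolding B_def by (rule Levi_form_real[OF z])
  have 1: "Im (B v w + B w v) = 0" for v w
    using real[of "v + w"] real[of v] real[of w] by (simp add: B1 B2)
  have "B v w = cnj (B w v)" for v w
    using 1[of v w] 1[of "\<i> *s v" w] by (simp add: B1 B3 complex_eq_iff)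
  from this[of "axis i 1" "axis j 1"] show ?thesis by (simp add: hess_def B_def)
qed

lemma det_hess_real:
  assumes "z \<in> \<Omega>"
  shows "cnj (det (hess z)) = det (hess z)"
proof -
  have "cnj (det (hess z)) = det (\<chi> i j. cnj (hess z $ i $ j))" by (simp add: det_def)
  also have "(\<chi> i j. cnj (hess z $ i $ j)) = transpose (hess z)"
    by (simp add: vec_eq_iff transpose_def hess_hermitian[OF assms, symmetric])
  finally show ?thesis by simp
qed

lemma Ck_hess: "Ck k (\<lambda>x. hess x $ i $ j) \<Omega>"
  unfolding hess_def by (simp add: Ck_wirt[OF Ck_wirt_bar[OF Ck_log_\<kappa> open_\<Omega>] open_\<Omega>])

lemma det_hess_proportional:
  assumes "connected \<Omega>" "\<Omega> \<noteq> {}"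
    and sym: "\<And>p. p \<in> \<Omega> \<Longrightarrow> \<exists>s s'. holo_involution \<Omega> s s' \<and> p isolated_in {x \<in> \<Omega>. s x = x}"
  obtains c :: real where "c \<noteq> 0" "\<And>z. z \<in> \<Omega> \<Longrightarrow> det (hess z) = of_real (c * \<kappa> z)"
proof -
  define h where "h z = det (hess z) * inverse (complex_of_real (\<kappa> z))" for z
  have C: "Ck (Suc 0) h \<Omega>"
    unfolding h_def[abs_def]
  proof (rule Ck_mult[OF Ck_det[OF Ck_hess open_\<Omega>] _ open_\<Omega>])
    show "Ck (Suc 0) (\<lambda>x. inverse (complex_of_real (\<kappa> x))) \<Omega>"
      by (rule Ck_field_compose[OF Ck_\<kappa> open_\<Omega>, of inverse "- {0}"])
        (use \<kappa>_pos in \<open>force intro!: holomorphic_intros\<close>)+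
  qed
  have dh: "h differentiable (at p)" if "p \<in> \<Omega>" for p by (rule Ck_differentiable[OF C that])
  have "dir_deriv v h p = 0" if p: "p \<in> \<Omega>" for p v
  proof -
    obtain s s' where s: "holo_involution \<Omega> s s'" "p isolated_in {x \<in> \<Omega>. s x = x}" using sym[OF p] by blast
    then interpret holo_involution \<Omega> s s' by simp
    have sp: "s p = p" using s(2) by (simp add: isolated_in_def)
    have inv: "h (s x) = h x" if x: "x \<in> \<Omega>" for x
    proof -
      have "complex_of_real (\<kappa> x) = of_real (\<kappa> (s x)) * of_real ((cmod (J x))\<^sup>2)"
        using \<kappa>_transform[OF x] by (metis of_real_mult)
      then show ?thesis
        unfolding h_def det_hess_transform[OF x] using J_nonzero[OF x] by (simp add: field_simps)
    qed
    have "dir_deriv v h p = dir_deriv v (\<lambda>x. h (s x)) p"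
      by (rule dir_deriv_cong[OF open_\<Omega> p]) (simp add: inv)
    also have "\<dots> = dir_deriv (s' p v) h (s p)"
      by (rule dir_deriv_compose(1)[OF _ s'[OF p]]) (simp add: sp dh p)
    also have "\<dots> = dir_deriv (- v) h p" by (simp only: involution_derivative[OF s(2)] sp)
    also have "\<dots> = - dir_deriv v h p"
      using linear_neg[OF has_derivative_linear[OF differentiable_dir_deriv[OF dh[OF p]]]] .
    finally show ?thesis by simp
  qed
  then have "\<forall>x\<in>\<Omega> - {}. (h has_derivative (\<lambda>_. 0)) (at x within \<Omega>)"
    using differentiable_dir_deriv[OF dh] by (auto intro: has_derivative_at_withinI)
  moreover have "continuous_on \<Omega> h"
    using dh differentiable_imp_continuous_within by (auto intro!: continuous_at_imp_continuous_on)
  ultimately have "h constant_on \<Omega>"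
    by (intro has_derivative_zero_connected_constant_on[OF assms(1) open_\<Omega>, of "{}"]) auto
  then obtain c where c: "\<And>z. z \<in> \<Omega> \<Longrightarrow> h z = c" unfolding constant_on_def by blast
  have hz: "det (hess z) = c * of_real (\<kappa> z)" if "z \<in> \<Omega>" for z
    using c[OF that] \<kappa>_pos[OF that] by (simp add: h_def field_simps)
  obtain z0 where z0: "z0 \<in> \<Omega>" using assms(2) by blast
  \<comment> \<open>A Hermitian matrix has real determinant, so the constant is real; strict
    Cauchy-Schwarz, through the nondegenerate Hessian, keeps it from vanishing.\<close>
  have "cnj c = c"
    using det_hess_real[OF z0] \<kappa>_pos[OF z0] by (simp add: hz[OF z0])
  then have cr: "c = of_real (Re c)" by (simp add: complex_eq_iff)
  moreover have "c \<noteq> 0" using det_hess_nonzero[OF z0] hz[OF z0] by auto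
  ultimately have "Re c \<noteq> 0" by (metis of_real_0)
  then show thesis using that[of "Re c"] hz cr by (metis of_real_mult)
qed

end

lemma bounded_symmetric_domainD:
  assumes "bounded_symmetric_domain (\<Omega> :: (complex ^ 'n) set)"
  shows "open \<Omega>" "bounded \<Omega>" "connected \<Omega>" "\<Omega> \<noteq> {}"
    "p \<in> \<Omega> \<Longrightarrow> \<exists>s s'. holo_involution \<Omega> s s' \<and> p isolated_in {x \<in> \<Omega>. s x = x}"
proof -
  have [simp]: "coord_space UNIV = (UNIV :: (complex ^ 'n) set)" by (simp add: coord_space_def)
  show o: "open \<Omega>" and b: "bounded \<Omega>" and "connected \<Omega>" "\<Omega> \<noteq> {}"
    using assms by (auto simp: bounded_symmetric_domain_in_def bounded_domain_in_def)
  assume p: "p \<in> \<Omega>"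
  then obtain s where s: "biholo_map s \<Omega> \<Omega>" "\<And>x. x \<in> \<Omega> \<Longrightarrow> s (s x) = x" "p isolated_in {x \<in> \<Omega>. s x = x}"
    using assms unfolding bounded_symmetric_domain_in_def by blast
  then have "\<forall>x\<in>\<Omega>. \<exists>f'. (s has_derivative f') (at x) \<and> (\<forall>c v. f' (c *s v) = c *s f' v)"
    using o at_within_open unfolding biholo_map_def holo_map_on_def by (metis (no_types, lifting))
  then obtain s' where s': "\<And>x. x \<in> \<Omega> \<Longrightarrow> (s has_derivative s' x) (at x) \<and> (\<forall>c v. s' x (c *s v) = c *s s' x v)"
    by metis
  have "s x \<in> \<Omega>" if "x \<in> \<Omega>" for x
    using s(1) that unfolding biholo_map_def by (meson bij_betwE)
  then have "holo_involution \<Omega> s s'"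
    using o b s(2) s' by unfold_locales auto
  then show "\<exists>s s'. holo_involution \<Omega> s s' \<and> p isolated_in {x \<in> \<Omega>. s x = x}" using s(3) by blast
qed


section \<open>The Hessian of a Hartogs potential\<close>

definition block ::
  "('a::finite \<Rightarrow> 'a \<Rightarrow> 'c) \<Rightarrow> ('a \<Rightarrow> 'b::finite \<Rightarrow> 'c) \<Rightarrow> ('b \<Rightarrow> 'a \<Rightarrow> 'c) \<Rightarrow> ('b \<Rightarrow> 'b \<Rightarrow> 'c) \<Rightarrow> 'c ^ ('a + 'b) ^ ('a + 'b)" where
  "block A B C D = (\<chi> i j. case i of
      Inl a \<Rightarrow> (case j of Inl a' \<Rightarrow> A a a' | Inr b \<Rightarrow> B a b)
    | Inr b \<Rightarrow> (case j of Inl a \<Rightarrow> C b a | Inr b' \<Rightarrow> D b b'))"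

lemma block_nth [simp]:
  "block A B C D $ Inl a $ Inl a' = A a a'" "block A B C D $ Inl a $ Inr b = B a b"
  "block A B C D $ Inr b $ Inl a = C b a" "block A B C D $ Inr b $ Inr b' = D b b'"
  by (simp_all add: block_def)

lemma matrix_eq_blockI:
  fixes M N :: "'c ^ ('a::finite + 'b::finite) ^ ('a + 'b)"
  assumes "\<And>i j. M $ Inl i $ Inl j = N $ Inl i $ Inl j" "\<And>i j. M $ Inl i $ Inr j = N $ Inl i $ Inr j"
    "\<And>i j. M $ Inr i $ Inl j = N $ Inr i $ Inl j" "\<And>i j. M $ Inr i $ Inr j = N $ Inr i $ Inr j"
  shows "M = N"
proof -
  have "M $ i $ j = N $ i $ j" for i j using assms by (cases i; cases j) auto
  then show ?thesis by (simp add: vec_eq_iff)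
qed

lemma sum_if_delta:
  fixes f :: "'a::finite \<Rightarrow> 'c::comm_ring_1"
  shows "(\<Sum>k\<in>UNIV. f k * (if k = i then c else 0)) = f i * c" "(\<Sum>k\<in>UNIV. (if i = k then c else 0) * f k) = c * f i"
  by (simp_all add: if_distrib[of "\<lambda>x. x * y" for y] if_distrib[of "\<lambda>x. y * x" for y] cong: if_cong)

lemma det_scale: "det (\<chi> i j. c * A $ i $ j) = c ^ CARD('n) * det (A :: 'c::comm_ring_1 ^ 'n ^ 'n)"
proof -
  have "det (\<chi> i. c *s A $ i) = (\<Prod>i\<in>(UNIV :: 'n set). c) * det (\<chi> i. A $ i)"
    by (rule det_rows_mul)
  moreover have "(\<chi> i. c *s A $ i) = (\<chi> i j. c * A $ i $ j)" by (simp add: vec_eq_iff)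
  ultimately show ?thesis by simp
qed

context
  fixes P :: "complex ^ 'd ^ 'd" and a b :: "'d \<Rightarrow> complex" and v w :: "'e::finite \<Rightarrow> complex" and T U :: complex
  assumes T: "T \<noteq> 0" and U: "U = T + (\<Sum>c\<in>UNIV. w c * v c)"
begin

text \<open>The metric at one point as a function of independent data: \<open>P\<close>,
  \<open>a\<close> and \<open>b\<close> stand for the Hessian and the two kinds of first derivatives
  of \<psi>, \<open>w\<close> for the fibre coordinates, \<open>v\<close> for their conjugates,
  \<open>T\<close> for t and \<open>U\<close> for u. The factors \<open>U\<close> beside
  \<open>a\<close> and \<open>b\<close> come from differentiating u = exp (- \<psi>).\<close>

definition hartogs_matrix :: "complex ^ ('d + 'e) ^ ('d + 'e)" where
  "hartogs_matrix = block (\<lambda>i j. U * (P $ i $ j - a i * b j) / T + (U * a i) * (U * b j) / T\<^sup>2)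
    (\<lambda>i c. U * a i * w c / T\<^sup>2) (\<lambda>c j. v c * (U * b j) / T\<^sup>2)
    (\<lambda>c c'. (if c = c' then 1 / T else 0) + v c * w c' / T\<^sup>2)"

text \<open>Completing squares as a factorisation \<open>N ** R\<close> with \<open>R\<close>
  unipotent: the terms in \<open>a\<close> and \<open>b\<close> combine to U (U - T) a_i b_j / T^2,
  which is the product of the off-diagonal blocks of \<open>N\<close> and \<open>R\<close>. What
  remains on the diagonal of \<open>N\<close> is U / T times \<open>P\<close>, and a rank-one
  perturbation \<open>W\<close> of a scalar matrix.\<close>

lemma det_hartogs_matrix:
  "det hartogs_matrix = U ^ (CARD('d) + 1) * det P / T ^ (CARD('d + 'e) + 1)"
proof -
  define W :: "complex ^ 'e ^ 'e" where "W = (\<chi> c c'. (if c = c' then 1 / T else 0) + v c * w c' / T\<^sup>2)"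
  define N where "N = block (\<lambda>i j. U / T * P $ i $ j) (\<lambda>i c. a i * w c * U / T\<^sup>2) (\<lambda>_ _. 0)
    (\<lambda>c c'. (if c = c' then 1 / T else 0) + v c * w c' / T\<^sup>2)"
  define R :: "complex ^ ('d + 'e) ^ ('d + 'e)" where
    "R = block (\<lambda>i j. if i = j then 1 else 0) (\<lambda>_ _. 0) (\<lambda>c j. v c * b j) (\<lambda>c c'. if c = c' then 1 else 0)"
  define s where "s = (\<Sum>c\<in>UNIV. w c * v c)"
  have s: "(\<Sum>c\<in>UNIV. x * w c * y * (v c * z)) = x * y * z * s" for x y z
    by (simp add: s_def sum_distrib_left mult_ac)
  have U': "U = T + s" by (simp add: U s_def)
  have "hartogs_matrix = N ** R"
  proof (rule matrix_eq_blockI)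
    fix i j
    have "(N ** R) $ Inl i $ Inl j = U / T * P $ i $ j + (\<Sum>c\<in>UNIV. a i * w c * (U / T\<^sup>2) * (v c * b j))"
      by (simp add: matrix_matrix_mult_def sum_UNIV_Plus N_def R_def if_distrib[of "\<lambda>x. y * x" for y]
          if_distrib[of "\<lambda>x. x / y" for y] cong: if_cong)
    also have "\<dots> = U / T * P $ i $ j + a i * (U / T\<^sup>2) * b j * s" by (simp only: s)
    also have "\<dots> = U * (P $ i $ j - a i * b j) / T + (U * a i) * (U * b j) / T\<^sup>2"
      using T by (simp add: U' field_simps power2_eq_square)
    also have "\<dots> = hartogs_matrix $ Inl i $ Inl j" by (simp add: hartogs_matrix_def)
    finally show "hartogs_matrix $ Inl i $ Inl j = (N ** R) $ Inl i $ Inl j" by simp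
  next
    fix i j
    show "hartogs_matrix $ Inl i $ Inr j = (N ** R) $ Inl i $ Inr j"
      by (simp add: matrix_matrix_mult_def sum_UNIV_Plus N_def R_def hartogs_matrix_def mult_ac
          if_distrib[of "\<lambda>x. y * x" for y] if_distrib[of "\<lambda>x. x / y" for y] cong: if_cong)
  next
    fix i j
    have "(N ** R) $ Inr i $ Inl j = (\<Sum>c\<in>UNIV. (if i = c then 1 / T else 0) * (v c * b j)) +
        (\<Sum>c\<in>UNIV. v i * w c * (1 / T\<^sup>2) * (v c * b j))"
      by (simp add: matrix_matrix_mult_def sum_UNIV_Plus N_def R_def distrib_right sum.distrib)
    also have "\<dots> = 1 / T * (v i * b j) + v i * (1 / T\<^sup>2) * b j * s" by (simp only: s sum_if_delta)
    also have "\<dots> = v i * (U * b j) / T\<^sup>2"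
      using T by (simp add: U' field_simps power2_eq_square)
    also have "\<dots> = hartogs_matrix $ Inr i $ Inl j" by (simp add: hartogs_matrix_def)
    finally show "hartogs_matrix $ Inr i $ Inl j = (N ** R) $ Inr i $ Inl j" by simp
  next
    fix i j
    show "hartogs_matrix $ Inr i $ Inr j = (N ** R) $ Inr i $ Inr j"
      by (simp add: matrix_matrix_mult_def sum_UNIV_Plus N_def R_def hartogs_matrix_def
          if_distrib[of "\<lambda>x. y * x" for y] cong: if_cong)
  qed
  moreover have "det R = 1"
  proof -
    have one: "(\<chi> i j. if i = j then 1 else 0) = (mat 1 :: complex ^ 'm ^ 'm)" for dummy :: "'m::finite"
      by (simp add: mat_def)
    have "det (transpose R) = det (\<chi> i j. if j = i then 1 else 0 :: complex ^ 'd ^ 'd) *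
        det (\<chi> i j. if j = i then 1 else 0 :: complex ^ 'e ^ 'e)"
      by (subst det_block_triangular) (simp_all add: R_def transpose_def)
    then show ?thesis by (simp add: eq_commute[of "_ :: 'd"] eq_commute[of "_ :: 'e"] one)
  qed
  moreover have "det N = (U / T) ^ CARD('d) * det P * det W"
  proof -
    have "det N = det (\<chi> i j. U / T * P $ i $ j) * det W"
      by (subst det_block_triangular) (simp_all add: N_def W_def)
    then show ?thesis by (simp only: det_scale)
  qed
  \<comment> \<open>After extracting 1 / T from every row, the rank-one update contributes 1 + (U -
    T) / T = U / T.\<close>
  moreover have "det W = (1 / T) ^ CARD('e) * (U / T)"
  proof -
    define W1 :: "complex ^ 'e ^ 'e" where
      "W1 = (\<chi> c c'. of_bool (c = c') + (\<chi> c. v c / T) $ c * (\<chi> c. w c) $ c')"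
    have "W = (\<chi> c c'. 1 / T * W1 $ c $ c')"
      using T by (simp add: W_def W1_def vec_eq_iff field_simps power2_eq_square)
    then have "det W = (1 / T) ^ CARD('e) * det W1" by (simp only: det_scale)
    also have "det W1 = 1 + (\<Sum>c\<in>UNIV. w c * (v c / T))"
      unfolding W1_def det_rank_one_update by simp
    also have "1 + (\<Sum>c\<in>UNIV. w c * (v c / T)) = U / T"
      using T by (simp add: U add_divide_distrib sum_divide_distrib)
    finally show ?thesis .
  qed
  ultimately show ?thesis
    using T by (simp add: det_mul power_divide power_add field_simps)
qed

text \<open>The explicit solution Y of g Y = E, where E is the Hessian of \<psi> extended by zero
  blocks. It exhibits g^(-1) E, so that its trace can be read off the diagonal.\<close>

definition hartogs_quotient :: "complex ^ ('d + 'e) ^ ('d + 'e)" where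
  "hartogs_quotient = block (\<lambda>i j. if i = j then T / U else 0) (\<lambda>_ _. 0) (\<lambda>c j. - (T / U) * v c * b j) (\<lambda>_ _. 0)"

lemma hartogs_matrix_quotient:
  assumes "U \<noteq> 0"
  shows "hartogs_matrix ** hartogs_quotient = block (\<lambda>i j. P $ i $ j) (\<lambda>_ _. 0) (\<lambda>_ _. 0) (\<lambda>_ _. 0)"
proof -
  define s where "s = (\<Sum>c\<in>UNIV. w c * v c)"
  have s: "(\<Sum>c\<in>UNIV. x * w c * (y * v c * z)) = x * y * z * s" for x y z
    by (simp add: s_def sum_distrib_left mult_ac)
  have s2: "s = U - T" by (simp add: U s_def)
  have dl: "(\<Sum>k\<in>UNIV. f k * (if k = j then c else 0)) = f j * c" for f :: "'d \<Rightarrow> complex" and j c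
    by (rule sum_if_delta)
  show ?thesis
  proof (rule matrix_eq_blockI)
    fix i j
    have "(hartogs_matrix ** hartogs_quotient) $ Inl i $ Inl j =
      (U * (P $ i $ j - a i * b j) / T + (U * a i) * (U * b j) / T\<^sup>2) * (T / U) +
      (\<Sum>c\<in>UNIV. U * a i / T\<^sup>2 * w c * (- (T / U) * v c * b j))"
      using assms by (simp add: matrix_matrix_mult_def sum_UNIV_Plus hartogs_matrix_def hartogs_quotient_def dl sum_negf)
    also have "\<dots> = P $ i $ j"
      unfolding s s2 using T assms by (simp add: field_simps power2_eq_square)
    finally show "(hartogs_matrix ** hartogs_quotient) $ Inl i $ Inl j = block (\<lambda>i j. P $ i $ j) (\<lambda>_ _. 0) (\<lambda>_ _. 0) (\<lambda>_ _. 0) $ Inl i $ Inl j"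
      by simp
  next
    fix i j
    have "(hartogs_matrix ** hartogs_quotient) $ Inr i $ Inl j =
      v i * (U * b j) / T\<^sup>2 * (T / U) + ((\<Sum>c\<in>UNIV. (if i = c then 1 / T else 0) * (- (T / U) * v c * b j)) +
      (\<Sum>c\<in>UNIV. v i / T\<^sup>2 * w c * (- (T / U) * v c * b j)))"
      using assms by (simp add: matrix_matrix_mult_def sum_UNIV_Plus hartogs_matrix_def hartogs_quotient_def
          distrib_right sum.distrib[symmetric] left_diff_distrib mult_ac
          if_distrib[of "\<lambda>x. y * x" for y] if_distrib[of "\<lambda>x. x / y" for y] cong: if_cong)
    also have "\<dots> = 0"
      unfolding s s2 sum_if_delta using T assms by (simp add: field_simps power2_eq_square)
    finally show "(hartogs_matrix ** hartogs_quotient) $ Inr i $ Inl j = block (\<lambda>i j. P $ i $ j) (\<lambda>_ _. 0) (\<lambda>_ _. 0) (\<lambda>_ _. 0) $ Inr i $ Inl j"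
      by simp
  qed (simp_all add: matrix_matrix_mult_def sum_UNIV_Plus hartogs_quotient_def)
qed

lemma trace_hartogs_quotient: "trace hartogs_quotient = of_nat CARD('d) * (T / U)"
  by (simp add: trace_def sum_UNIV_Plus hartogs_quotient_def)

end


section \<open>Curvature of Hartogs domains\<close>

lemma ln_abs_real: "ln \<bar>x\<bar> = ln (x :: real)"
  by (cases "x \<ge> 0") (auto simp: ln_minus)

lemma matrix_inv_mult_left:
  fixes A :: "'c::field ^ 'n ^ 'n"
  assumes "det A \<noteq> 0"
  shows "matrix_inv A ** (A ** B) = B"
proof -
  have "\<exists>A'. A ** A' = mat 1 \<and> A' ** A = mat 1"
    using assms invertible_det_nz invertible_def by blast
  then have "matrix_inv A ** A = mat 1"
    unfolding matrix_inv_def by (metis (mono_tags, lifting) someI_ex)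
  then show ?thesis by (simp add: matrix_mul_assoc)
qed

lemma Ck_continuous_on: "Ck (Suc k) f S \<Longrightarrow> continuous_on S f"
  by (intro continuous_at_imp_continuous_on ballI differentiable_imp_continuous_within Ck_differentiable)

text \<open>All geometry of the base is condensed into the Monge-Ampere equation
  \<open>det_\<psi>\<close>. For a Cartan-Hartogs domain it expresses that det (H (log K)) is
  proportional to K, with \<open>a\<close> = p / \<mu>.\<close>

locale hartogs =
  fixes \<Omega> :: "(complex ^ 'd) set" and \<psi> :: "complex ^ 'd \<Rightarrow> real"
    and M :: "(complex ^ ('d::finite + 'e::finite)) set" and \<Phi> :: "complex ^ ('d + 'e) \<Rightarrow> real"
    and c a :: real
  assumes open_\<Omega>: "open \<Omega>" and \<Omega>_ne: "\<Omega> \<noteq> {}"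
    and Ck_\<psi>: "Ck k (\<lambda>z. complex_of_real (\<psi> z)) \<Omega>"
    and M_def: "M = {x. z_part x \<in> \<Omega> \<and> (norm (w_part x))\<^sup>2 < exp (- \<psi> (z_part x))}"
    and \<Phi>_eq: "x \<in> M \<Longrightarrow> \<Phi> x = - ln (exp (- \<psi> (z_part x)) - (norm (w_part x))\<^sup>2)"
    and det_\<psi>: "z \<in> \<Omega> \<Longrightarrow> det (potential_metric \<psi> z) = of_real (c * exp (a * \<psi> z))"
    and c_nz: "c \<noteq> 0"
begin

abbreviation g where "g \<equiv> potential_metric \<Phi>"

definition u :: "complex ^ ('d + 'e) \<Rightarrow> real" where "u x = exp (- \<psi> (z_part x))"

definition t :: "complex ^ ('d + 'e) \<Rightarrow> real" where "t x = u x - (norm (w_part x))\<^sup>2"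

definition \<psi>c :: "complex ^ ('d + 'e) \<Rightarrow> complex" where "\<psi>c x = of_real (\<psi> (z_part x))"

text \<open>First derivatives of \<psi> pulled back from the base. Extending them, and the Hessian
  below, by 0 to the fibre directions lets one formula describe the metric for all pairs of
  indices.\<close>

definition A :: "'d + 'e \<Rightarrow> complex ^ ('d + 'e) \<Rightarrow> complex" where
  "A k x = (case k of Inl i \<Rightarrow> d_z i (\<lambda>z. complex_of_real (\<psi> z)) (z_part x) | Inr _ \<Rightarrow> 0)"

definition B :: "'d + 'e \<Rightarrow> complex ^ ('d + 'e) \<Rightarrow> complex" where
  "B k x = (case k of Inl i \<Rightarrow> d_zbar i (\<lambda>z. complex_of_real (\<psi> z)) (z_part x) | Inr _ \<Rightarrow> 0)"

definition E :: "complex ^ ('d + 'e) \<Rightarrow> complex ^ ('d + 'e) ^ ('d + 'e)" where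
  "E x = block (\<lambda>i j. potential_metric \<psi> (z_part x) $ i $ j) (\<lambda>_ _. 0) (\<lambda>_ _. 0) (\<lambda>_ _. 0)"

text \<open>The derivative of the squared norm of the fibre part with respect to the conjugate
  coordinates; its conjugate is the derivative with respect to the coordinates.\<close>

definition \<omega> :: "'d + 'e \<Rightarrow> complex ^ ('d + 'e) \<Rightarrow> complex" where
  "\<omega> k x = (case k of Inl _ \<Rightarrow> 0 | Inr b \<Rightarrow> x $ Inr b)"

lemma t_pos: "x \<in> M \<Longrightarrow> t x > 0"
  by (simp add: M_def t_def u_def)

lemma u_pos: "u x > 0"
  by (simp add: u_def)

lemma z_in: "x \<in> M \<Longrightarrow> z_part x \<in> \<Omega>"
  by (simp add: M_def)

lemma open_M: "open M"
proof -
  have 1: "open {x :: complex ^ ('d + 'e). z_part x \<in> \<Omega>}"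
    using open_parts[OF open_\<Omega> open_UNIV] by simp
  have "continuous_on \<Omega> (\<lambda>z. complex_of_real (\<psi> z))"
    by (rule Ck_continuous_on[OF Ck_\<psi>])
  then have "continuous_on \<Omega> (\<lambda>z. Re (complex_of_real (\<psi> z)))" by (rule continuous_on_Re)
  then have c: "continuous_on \<Omega> \<psi>" by simp
  have "continuous_on {x :: complex ^ ('d + 'e). z_part x \<in> \<Omega>} t"
    unfolding t_def[abs_def] u_def
    by (intro continuous_intros linear_continuous_on[OF bounded_linear_w_part]
        continuous_on_compose2[OF c linear_continuous_on[OF bounded_linear_z_part]]) auto
  then have "open ({x :: complex ^ ('d + 'e). z_part x \<in> \<Omega>} \<inter> t -` {0<..})"
    by (rule continuous_open_preimage[OF _ 1]) simp
  also have "{x :: complex ^ ('d + 'e). z_part x \<in> \<Omega>} \<inter> t -` {0<..} = M"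
    by (auto simp: M_def t_def u_def)
  finally show ?thesis .
qed

lemma z_part_axis: "z_part (axis (Inl i) 1) = axis i 1" "z_part (axis (Inr b) 1) = 0"
  by (auto simp: z_part_def axis_def vec_eq_iff)

lemma z_part_derivative: "(z_part has_derivative z_part) (at x)"
  by (rule bounded_linear_imp_has_derivative[OF bounded_linear_z_part])

lemma wirt_z_part:
  assumes "f differentiable (at (z_part x))"
  shows "wirt v (\<lambda>x. f (z_part x)) x = wirt (z_part v) f (z_part x)"
    "wirt_bar v (\<lambda>x. f (z_part x)) x = wirt_bar (z_part v) f (z_part x)"
  using wirt_compose[OF assms z_part_derivative parts_linear(3)] by auto

lemma Ck_z_part: "(\<And>k. Ck k f \<Omega>) \<Longrightarrow> Ck k (\<lambda>x. f (z_part x)) M"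
  by (rule Ck_compose_linear[OF _ bounded_linear_z_part open_M z_in])

lemma Ck_\<psi>c: "Ck k \<psi>c M"
  unfolding \<psi>c_def[abs_def] by (rule Ck_z_part[OF Ck_\<psi>])

lemma \<psi>_differentiable: "z \<in> \<Omega> \<Longrightarrow> (\<lambda>z. complex_of_real (\<psi> z)) differentiable (at z)"
  by (rule Ck_differentiable[OF Ck_\<psi>])

lemma \<psi>c_derivs:
  assumes x: "x \<in> M"
  shows "d_z k \<psi>c x = A k x" "d_zbar k \<psi>c x = B k x" "d_z k (B l) x = E x $ k $ l"
    "B l differentiable (at x)" "\<psi>c differentiable (at x)"
proof -
  note d = \<psi>_differentiable[OF z_in[OF x]]
  show "d_z k \<psi>c x = A k x" "d_zbar k \<psi>c x = B k x"
    unfolding \<psi>c_def[abs_def] wirt_z_part[OF d]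
    by (cases k; simp add: A_def B_def z_part_axis wirt_zero)+
  have d2: "d_zbar i (\<lambda>z. complex_of_real (\<psi> z)) differentiable (at (z_part x))" for i
    by (rule Ck_differentiable[OF Ck_wirt_bar[OF Ck_\<psi> open_\<Omega>] z_in[OF x]])
  show "B l differentiable (at x)"
    by (cases l) (simp_all add: B_def[abs_def] dir_deriv_compose(2)[OF d2 z_part_derivative])
  show "d_z k (B l) x = E x $ k $ l"
  proof (cases l)
    case (Inl j)
    show ?thesis
      unfolding Inl B_def[abs_def] sum.case wirt_z_part(1)[OF d2]
      by (cases k) (simp_all add: z_part_axis wirt_zero E_def potential_metric_def)
  next
    case (Inr b)
    show ?thesis
      unfolding Inr B_def[abs_def] sum.case wirt_const
      by (cases k) (simp_all add: E_def)
  qed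
  show "\<psi>c differentiable (at x)" by (rule Ck_differentiable[OF Ck_\<psi>c x])
qed

lemma norm_w_part: "complex_of_real ((norm (w_part x))\<^sup>2) = (\<Sum>b\<in>UNIV. x $ Inr b * cnj (x $ Inr b))"
proof -
  have "(norm (w_part x))\<^sup>2 = (\<Sum>b\<in>UNIV. (cmod (x $ Inr b))\<^sup>2)"
    by (simp add: norm_vec_def L2_set_def sum_nonneg w_part_def)
  then show ?thesis by (simp only: of_real_sum complex_norm_square)
qed

lemma component_differentiable: "(\<lambda>x :: complex ^ ('d + 'e). x $ k) differentiable (at x)"
  "(\<lambda>x :: complex ^ ('d + 'e). cnj (x $ k)) differentiable (at x)"
  using differentiableI[OF bounded_linear.has_derivative[OF bounded_linear_vec_nth has_derivative_ident]]
    differentiableI[OF has_derivative_cnj[OF bounded_linear.has_derivative[OF bounded_linear_vec_nth has_derivative_ident]]]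
  by blast+

lemma wirt_component: "d_z k (\<lambda>x. x $ l) x = (if k = l then 1 else 0)" "d_zbar k (\<lambda>x. x $ l) x = 0"
  for x :: "complex ^ ('d + 'e)"
proof -
  have h: "holo_fun_on (\<lambda>x :: complex ^ ('d + 'e). x $ l) UNIV" by (rule holo_fun_on_component) simp
  have "dir_deriv v (\<lambda>x :: complex ^ ('d + 'e). x $ l) x = v $ l" for v
    by (rule dir_deriv_eq[OF bounded_linear_imp_has_derivative[OF bounded_linear_vec_nth]])
  then show "d_z k (\<lambda>x. x $ l) x = (if k = l then 1 else 0)" "d_zbar k (\<lambda>x. x $ l) x = 0"
    using wirt_holo[OF h open_UNIV UNIV_I] by (simp_all add: axis_def)
qed

lemma \<omega>_derivs:
  "d_z k (\<lambda>x. complex_of_real ((norm (w_part x))\<^sup>2)) x = cnj (\<omega> k x)"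
  "d_zbar k (\<lambda>x. complex_of_real ((norm (w_part x))\<^sup>2)) x = \<omega> k x"
  "d_z k (\<omega> l) x = (case l of Inl _ \<Rightarrow> 0 | Inr b \<Rightarrow> if k = l then 1 else 0)"
  "\<omega> l differentiable (at x)" "(\<lambda>x. complex_of_real ((norm (w_part x))\<^sup>2)) differentiable (at x)"
  for x :: "complex ^ ('d + 'e)"
proof -
  note c = component_differentiable
  show "(\<lambda>x. complex_of_real ((norm (w_part x))\<^sup>2)) differentiable (at x)"
    unfolding norm_w_part by (intro differentiable_sum ballI finite differentiable_mult c)
  have "d_z k (\<lambda>x. complex_of_real ((norm (w_part x))\<^sup>2)) x = (\<Sum>b\<in>UNIV. (if k = Inr b then cnj (x $ Inr b) else 0))"
    unfolding norm_w_part
    by (subst wirt_sum(1), intro differentiable_mult c)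
      (simp add: wirt_mult(1)[OF c] wirt_cnj[OF c(1)] wirt_component if_distrib[of "\<lambda>x. x * y" for y] cong: if_cong)
  also have "\<dots> = cnj (\<omega> k x)" by (cases k) (simp_all add: \<omega>_def)
  finally show "d_z k (\<lambda>x. complex_of_real ((norm (w_part x))\<^sup>2)) x = cnj (\<omega> k x)" .
  have "d_zbar k (\<lambda>x. complex_of_real ((norm (w_part x))\<^sup>2)) x = (\<Sum>b\<in>UNIV. (if k = Inr b then x $ Inr b else 0))"
    unfolding norm_w_part
    by (subst wirt_sum(2), intro differentiable_mult c)
      (simp add: wirt_mult(2)[OF c] wirt_cnj[OF c(1)] wirt_component if_distrib[of cnj] if_distrib[of "\<lambda>x. y * x" for y] cong: if_cong)
  also have "\<dots> = \<omega> k x" by (cases k) (simp_all add: \<omega>_def)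
  finally show "d_zbar k (\<lambda>x. complex_of_real ((norm (w_part x))\<^sup>2)) x = \<omega> k x" .
  show "d_z k (\<omega> l) x = (case l of Inl _ \<Rightarrow> 0 | Inr b \<Rightarrow> if k = l then 1 else 0)"
    by (cases l) (simp_all add: \<omega>_def[abs_def] wirt_const wirt_component)
  show "\<omega> l differentiable (at x)"
    by (cases l) (simp_all add: \<omega>_def[abs_def] c)
qed

lemma u_derivs:
  assumes x: "x \<in> M"
  shows "d_z k (\<lambda>x. complex_of_real (u x)) x = - (of_real (u x) * A k x)"
    "d_zbar k (\<lambda>x. complex_of_real (u x)) x = - (of_real (u x) * B k x)"
    "(\<lambda>x. complex_of_real (u x)) differentiable (at x)"
proof -
  have u: "complex_of_real (u x) = exp (- \<psi>c x)" for x
    by (simp only: u_def \<psi>c_def of_real_minus[symmetric] exp_of_real)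
  have e: "((\<lambda>y. exp (- y)) has_field_derivative - exp (- y)) (at y)" for y :: complex
    by (auto intro!: derivative_eq_intros)
  note d = \<psi>c_derivs(5)[OF x]
  show "d_z k (\<lambda>x. complex_of_real (u x)) x = - (of_real (u x) * A k x)"
    "d_zbar k (\<lambda>x. complex_of_real (u x)) x = - (of_real (u x) * B k x)"
    "(\<lambda>x. complex_of_real (u x)) differentiable (at x)"
    unfolding u using wirt_field_compose[OF d e] dir_deriv_field_compose(2)[OF d e] \<psi>c_derivs[OF x] by simp_all
qed

lemma t_derivs:
  assumes x: "x \<in> M"
  shows "d_z k (\<lambda>x. complex_of_real (t x)) x = - (of_real (u x) * A k x + cnj (\<omega> k x))"
    "d_zbar k (\<lambda>x. complex_of_real (t x)) x = - (of_real (u x) * B k x + \<omega> k x)"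
    "(\<lambda>x. complex_of_real (t x)) differentiable (at x)"
proof -
  have t: "complex_of_real (t x) = complex_of_real (u x) - complex_of_real ((norm (w_part x))\<^sup>2)" for x
    by (simp add: t_def)
  note d = u_derivs(3)[OF x] \<omega>_derivs(5)
  show "d_z k (\<lambda>x. complex_of_real (t x)) x = - (of_real (u x) * A k x + cnj (\<omega> k x))"
    "d_zbar k (\<lambda>x. complex_of_real (t x)) x = - (of_real (u x) * B k x + \<omega> k x)"
    "(\<lambda>x. complex_of_real (t x)) differentiable (at x)"
    unfolding t wirt_diff[OF d] u_derivs[OF x] \<omega>_derivs using differentiable_diff[OF d] by simp_all
qed

lemma Ck_ln_t: "Ck k (\<lambda>x. complex_of_real (ln (t x))) M"
proof (rule Ck_ln[OF open_M t_pos])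
  have u: "Ck k (\<lambda>x. complex_of_real (u x)) M"
  proof (rule Ck_cong[OF Ck_field_compose[OF Ck_\<psi>c open_M, of "\<lambda>y. exp (- y)" UNIV] open_M])
    show "exp (- \<psi>c x) = complex_of_real (u x)" for x by (simp only: u_def \<psi>c_def of_real_minus[symmetric] exp_of_real)
  qed (auto intro!: holomorphic_intros)
  have w: "Ck k (\<lambda>x. complex_of_real ((norm (w_part x))\<^sup>2)) M"
    unfolding norm_w_part
    by (intro Ck_sum Ck_mult Ck_cnj Ck_holo holo_fun_on_component open_M)
  show "Ck k (\<lambda>x. complex_of_real (t x)) M"
    using Ck_diff[OF u w open_M] by (simp add: t_def)
qed

text \<open>Differentiating - log t twice gives - t_kl / t + t_k t_l / t^2, subscripts denoting
  derivatives in the k-th coordinate and the l-th conjugate one. Here - t_kl equals u (\<psi>_kl -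
  \<psi>_k \<psi>_l), plus 1 if k and l are the same fibre index.\<close>

lemma g_entry:
  assumes x: "x \<in> M"
  shows "g x $ k $ l = (of_real (u x) * (E x $ k $ l - A k x * B l x) + (case l of Inl _ \<Rightarrow> 0 | Inr b \<Rightarrow> if k = l then 1 else 0)) / of_real (t x)
    + (of_real (u x) * A k x + cnj (\<omega> k x)) * (of_real (u x) * B l x + \<omega> l x) / (of_real (t x))\<^sup>2"
proof -
  let ?t = "\<lambda>x. complex_of_real (t x)"
  let ?h = "\<lambda>y. of_real (u y) * B l y + \<omega> l y"
  have bar: "d_zbar l (\<lambda>y. complex_of_real (\<Phi> y)) y = ?h y * inverse (?t y)" if y: "y \<in> M" for y
  proof -
    have dln: "(\<lambda>y. complex_of_real (ln (t y))) differentiable (at y)"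
      by (rule Ck_differentiable[OF Ck_ln_t y])
    have "d_zbar l (\<lambda>y. complex_of_real (\<Phi> y)) y = d_zbar l (\<lambda>y. -1 * complex_of_real (ln (t y))) y"
      by (rule wirt_cong(2)[OF open_M y]) (simp add: \<Phi>_eq t_def u_def)
    also have "\<dots> = - (d_zbar l ?t y / ?t y)"
      by (simp only: wirt_cmult(2)[OF dln] wirt_bar_ln[OF open_M t_pos y t_derivs(3)[OF y]]) simp
    finally show ?thesis unfolding t_derivs(2)[OF y]
      by (simp only: divide_inverse minus_mult_left[symmetric] minus_minus)
  qed
  have t0: "?t x \<noteq> 0" using t_pos[OF x] by simp
  have inv: "(inverse has_field_derivative - (inverse (?t x) ^ Suc (Suc 0))) (at (?t x))"
    using DERIV_inverse[OF t0] .
  note dt = t_derivs(3)[OF x] and du = u_derivs(3)[OF x] and dB = \<psi>c_derivs(4)[OF x] and d\<omega> = \<omega>_derivs(4)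
  have duB: "(\<lambda>y. of_real (u y) * B l y) differentiable (at x)" by (rule differentiable_mult[OF du dB])
  have dh: "?h differentiable (at x)" by (rule differentiable_add[OF duB d\<omega>])
  have dinv: "(\<lambda>y. inverse (?t y)) differentiable (at x)" by (rule dir_deriv_field_compose(2)[OF dt inv])
  have "g x $ k $ l = d_z k (\<lambda>y. ?h y * inverse (?t y)) x"
    unfolding potential_metric_def using wirt_cong(1)[OF open_M x bar] by simp
  also have "\<dots> = ?h x * (inverse (?t x) ^ Suc (Suc 0) * (of_real (u x) * A k x + cnj (\<omega> k x)))
     + (of_real (u x) * E x $ k $ l - of_real (u x) * A k x * B l x + (case l of Inl _ \<Rightarrow> 0 | Inr b \<Rightarrow> if k = l then 1 else 0)) * inverse (?t x)"
    unfolding wirt_mult(1)[OF dh dinv] wirt_field_compose(1)[OF dt inv] t_derivs(1)[OF x]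
      wirt_add(1)[OF duB d\<omega>] wirt_mult(1)[OF du dB] u_derivs(1)[OF x] \<psi>c_derivs(3)[OF x] \<omega>_derivs(3)
    by (simp add: algebra_simps)
  finally show ?thesis using t0 by (simp add: field_simps power2_eq_square)
qed


lemma g_hartogs_matrix:
  assumes x: "x \<in> M"
  shows "g x = hartogs_matrix (potential_metric \<psi> (z_part x)) (\<lambda>i. A (Inl i) x) (\<lambda>j. B (Inl j) x)
    (\<lambda>b. cnj (x $ Inr b)) (\<lambda>b. x $ Inr b) (of_real (t x)) (of_real (u x))"
    (is "_ = ?G")
    and "complex_of_real (t x) \<noteq> 0"
    and "complex_of_real (u x) = of_real (t x) + (\<Sum>b\<in>UNIV. x $ Inr b * cnj (x $ Inr b))"
proof -
  show T: "complex_of_real (t x) \<noteq> 0" using t_pos[OF x] by simp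
  show U: "complex_of_real (u x) = of_real (t x) + (\<Sum>b\<in>UNIV. x $ Inr b * cnj (x $ Inr b))"
    unfolding norm_w_part[symmetric] by (simp add: t_def)
  show "g x = ?G"
    unfolding hartogs_matrix_def[OF T U]
    by (rule matrix_eq_blockI)
      (simp_all add: g_entry[OF x] E_def \<omega>_def A_def B_def)
qed

lemma det_g:
  assumes x: "x \<in> M"
  shows "det (g x) = of_real (u x ^ (CARD('d) + 1) * (c * exp (a * \<psi> (z_part x))) / t x ^ (CARD('d + 'e) + 1))"
proof -
  note h = g_hartogs_matrix[OF x]
  have "det (g x) = of_real (u x) ^ (CARD('d) + 1) * det (potential_metric \<psi> (z_part x)) / of_real (t x) ^ (CARD('d + 'e) + 1)"
    unfolding h(1) by (rule det_hartogs_matrix[OF h(2,3)])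
  then show ?thesis unfolding det_\<psi>[OF z_in[OF x]] by simp
qed

lemma det_g_nonzero: "x \<in> M \<Longrightarrow> det (g x) \<noteq> 0"
  unfolding det_g of_real_eq_0_iff using t_pos[of x] u_pos[of x] c_nz by simp

text \<open>The coefficient of the Hessian of \<psi> in the Ricci tensor: d + 1 is the exponent of u
  = exp (- \<psi>) in det g, and \<open>a\<close> is contributed by the Monge-Ampere
  equation.\<close>

definition defect :: real where "defect = real CARD('d) + 1 - a"

text \<open>Since \<open>ln (- x) = ln x\<close> in Isabelle, the sign of the constant \<open>c\<close> does not matter.\<close>

lemma ln_det_g:
  assumes x: "x \<in> M"
  shows "ln (Re (det (g x))) = ln \<bar>c\<bar> + (- defect) * \<psi> (z_part x) + (real CARD('d + 'e) + 1) * \<Phi> x"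
proof -
  have tp: "t x > 0" and up: "u x > 0" using t_pos[OF x] u_pos by auto
  have "ln (Re (det (g x))) = ln (u x ^ (CARD('d) + 1) * (c * exp (a * \<psi> (z_part x))) / t x ^ (CARD('d + 'e) + 1))"
    unfolding det_g[OF x] Re_complex_of_real ..
  also have "\<dots> = ln \<bar>u x ^ (CARD('d) + 1) * (c * exp (a * \<psi> (z_part x))) / t x ^ (CARD('d + 'e) + 1)\<bar>"
    by (rule ln_abs_real[symmetric])
  also have "\<bar>u x ^ (CARD('d) + 1) * (c * exp (a * \<psi> (z_part x))) / t x ^ (CARD('d + 'e) + 1)\<bar> =
      u x ^ (CARD('d) + 1) * (\<bar>c\<bar> * exp (a * \<psi> (z_part x))) / t x ^ (CARD('d + 'e) + 1)"
    using tp up by (simp add: abs_mult)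
  also have "ln \<dots> = (real CARD('d) + 1) * ln (u x) + (ln \<bar>c\<bar> + a * \<psi> (z_part x)) - (real CARD('d + 'e) + 1) * ln (t x)"
    using tp up c_nz by (simp add: ln_div ln_mult ln_realpow del: power_Suc power_Suc2 add: algebra_simps)
  also have "ln (u x) = - \<psi> (z_part x)" by (simp add: u_def)
  also have "ln (t x) = - \<Phi> x" using \<Phi>_eq[OF x] by (simp add: t_def u_def)
  finally show ?thesis by (simp add: defect_def algebra_simps)
qed

text \<open>In the formula for log det g the mixed second derivative kills the constant, sends
  \<psi> to \<open>E\<close>, and sends \<Phi>, being the potential of \<open>g\<close>, back to
  \<open>g\<close> itself.\<close>

lemma ricci_g:
  assumes x: "x \<in> M"
  shows "ricci_tensor g x $ k $ l = of_real defect * E x $ k $ l - of_real (real CARD('d + 'e) + 1) * g x $ k $ l"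
proof -
  let ?\<Phi> = "\<lambda>y. complex_of_real (\<Phi> y)"
  have C: "Ck k ?\<Phi> M" for k
    by (rule Ck_cong[OF Ck_cmult[OF Ck_ln_t open_M, of k "-1"] open_M]) (simp add: \<Phi>_eq t_def u_def)
  have d\<Phi>: "?\<Phi> differentiable (at y)" and db\<Phi>: "d_zbar l ?\<Phi> differentiable (at y)" if "y \<in> M" for y
    using Ck_differentiable[OF C that] Ck_differentiable[OF Ck_wirt_bar[OF C open_M] that] by auto
  let ?p = "complex_of_real (- defect)" and ?q = "complex_of_real (real CARD('d + 'e) + 1)"
  have dm: "(\<lambda>y. ?p * \<psi>c y) differentiable (at y)" "(\<lambda>y. ?q * ?\<Phi> y) differentiable (at y)"
    "(\<lambda>y. ?p * \<psi>c y + ?q * ?\<Phi> y) differentiable (at y)" if "y \<in> M" for y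
    by (intro differentiable_add differentiable_mult differentiable_const \<psi>c_derivs(5)[OF that] d\<Phi>[OF that])+
  have 1: "d_zbar l (\<lambda>y. complex_of_real (ln (Re (det (g y))))) y = ?p * B l y + ?q * d_zbar l ?\<Phi> y"
    if y: "y \<in> M" for y
  proof -
    have "d_zbar l (\<lambda>y. complex_of_real (ln (Re (det (g y))))) y =
        d_zbar l (\<lambda>y. of_real (ln \<bar>c\<bar>) + (?p * \<psi>c y + ?q * ?\<Phi> y)) y"
      by (rule wirt_cong(2)[OF open_M y]) (simp add: ln_det_g \<psi>c_def)
    also have "\<dots> = ?p * B l y + ?q * d_zbar l ?\<Phi> y"
      by (simp only: wirt_add(2)[OF differentiable_const dm(3)[OF y]] wirt_const wirt_add(2)[OF dm(1,2)[OF y]]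
          wirt_cmult(2)[OF \<psi>c_derivs(5)[OF y]] wirt_cmult(2)[OF d\<Phi>[OF y]] \<psi>c_derivs(2)[OF y] add_0)
    finally show ?thesis .
  qed
  have dm2: "(\<lambda>y. ?p * B l y) differentiable (at x)" "(\<lambda>y. ?q * d_zbar l ?\<Phi> y) differentiable (at x)"
    by (intro differentiable_mult differentiable_const \<psi>c_derivs(4)[OF x] db\<Phi>[OF x])+
  have "ricci_tensor g x $ k $ l = - d_z k (d_zbar l (\<lambda>y. complex_of_real (ln (Re (det (g y)))))) x"
    by (simp add: ricci_tensor_def)
  also have "\<dots> = - d_z k (\<lambda>y. ?p * B l y + ?q * d_zbar l ?\<Phi> y) x"
    by (rule arg_cong[where f = uminus], rule wirt_cong(1)[OF open_M x 1])
  also have "\<dots> = - (?p * E x $ k $ l + ?q * g x $ k $ l)"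
    by (simp only: wirt_add(1)[OF dm2] wirt_cmult(1)[OF \<psi>c_derivs(4)[OF x]] wirt_cmult(1)[OF db\<Phi>[OF x]]
        \<psi>c_derivs(3)[OF x]) (simp add: potential_metric_def)
  finally show ?thesis by simp
qed

lemma scalar_curvature_g:
  assumes x: "x \<in> M"
  shows "scalar_curvature g x = of_real (defect * real CARD('d) * (t x / u x) - (real CARD('d + 'e) + 1) * real CARD('d + 'e))"
proof -
  note h = g_hartogs_matrix[OF x]
  have U0: "complex_of_real (u x) \<noteq> 0" using u_pos[of x] by simp
  define Y where "Y = hartogs_quotient (\<lambda>j. B (Inl j) x) (\<lambda>b. cnj (x $ Inr b)) (of_real (t x)) (of_real (u x))"
  have gY: "g x ** Y = E x"
    unfolding h(1) Y_def E_def by (rule hartogs_matrix_quotient[OF h(2,3) U0])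
  have trY: "trace Y = of_nat CARD('d) * (of_real (t x) / of_real (u x))"
    unfolding Y_def by (rule trace_hartogs_quotient[OF h(2,3)])
  \<comment> \<open>The Ricci endomorphism g^(-1) Ric: since g Y = E, it is a combination of Y and
    the identity, and the scalar curvature is its trace.\<close>
  define Z where "Z = (\<chi> i j. of_real defect * Y $ i $ j - of_real (real CARD('d + 'e) + 1) * mat 1 $ i $ j :: complex ^ ('d + 'e) ^ ('d + 'e))"
  have "ricci_tensor g x = g x ** Z"
  proof -
    have "(g x ** Z) $ i $ j = of_real defect * (g x ** Y) $ i $ j - of_real (real CARD('d + 'e) + 1) * (g x ** mat 1) $ i $ j" for i j
      by (simp only: matrix_matrix_mult_def Z_def vec_lambda_beta right_diff_distrib sum_subtractf sum_distrib_left mult.left_commute)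
    then show ?thesis by (simp add: vec_eq_iff ricci_g[OF x] gY)
  qed
  then have "scalar_curvature g x = trace Z"
    unfolding scalar_curvature_def by (simp only: matrix_inv_mult_left[OF det_g_nonzero[OF x]])
  also have "\<dots> = of_real defect * trace Y - of_real (real CARD('d + 'e) + 1) * trace (mat 1 :: complex ^ ('d + 'e) ^ ('d + 'e))"
    by (simp add: Z_def trace_def sum_subtractf sum_distrib_left)
  finally show ?thesis unfolding trY trace_I by simp
qed

section \<open>Constant scalar curvature and the Einstein condition\<close>

lemma zero_section:
  obtains x where "x \<in> M" "w_part x = 0"
proof -
  obtain z where z: "z \<in> \<Omega>" using \<Omega>_ne by blast
  show thesis using that[of "join z 0"] z by (simp add: M_def)
qed

lemma off_zero_section:
  obtains x where "x \<in> M" "w_part x \<noteq> 0"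
proof -
  obtain z where z: "z \<in> \<Omega>" using \<Omega>_ne by blast
  \<comment> \<open>Half of the radius exp (- \<psi>(z) / 2) of the fibre over \<open>z\<close>,
    along an arbitrary axis; \<open>undefined\<close> merely names some index of the nonempty
    type.\<close>
  define w :: "complex ^ 'e" where "w = axis undefined (of_real (exp (- \<psi> z / 2) / 2))"
  have "norm (axis k r) = cmod r" for k :: 'e and r :: complex
    by (simp add: norm_vec_def L2_set_def axis_def if_distrib[of norm] if_distrib[of "\<lambda>x. x\<^sup>2"] cong: if_cong)
  then have nw: "norm w = exp (- \<psi> z / 2) / 2" by (simp add: w_def norm_divide)
  have "(norm w)\<^sup>2 = exp (- \<psi> z) / 4"
    unfolding nw by (simp add: power2_eq_square exp_add[symmetric])
  then have "(norm w)\<^sup>2 < exp (- \<psi> z)" using exp_gt_zero[of "- \<psi> z"] by linarith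
  then have "join z w \<in> M" using z by (simp add: M_def)
  moreover have "w \<noteq> 0" using nw by (metis divide_eq_0_iff exp_not_eq_zero norm_zero zero_neq_numeral)
  ultimately show thesis using that[of "join z w"] by simp
qed

theorem scalar_curvature_constant_iff: "scalar_curvature g constant_on M \<longleftrightarrow> defect = 0"
proof
  assume "defect = 0"
  then show "scalar_curvature g constant_on M"
    unfolding constant_on_def using scalar_curvature_g by (intro exI[of _ "of_real (- (real CARD('d + 'e) + 1) * real CARD('d + 'e))"])
      (simp add: algebra_simps)
next
  assume "scalar_curvature g constant_on M"
  then obtain y where y: "\<And>x. x \<in> M \<Longrightarrow> scalar_curvature g x = y" unfolding constant_on_def by blast
  obtain x1 where x1: "x1 \<in> M" "w_part x1 = 0" by (rule zero_section)
  obtain x2 where x2: "x2 \<in> M" "w_part x2 \<noteq> 0" by (rule off_zero_section)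
  have "complex_of_real (defect * real CARD('d) * (t x1 / u x1) - (real CARD('d + 'e) + 1) * real CARD('d + 'e)) =
      of_real (defect * real CARD('d) * (t x2 / u x2) - (real CARD('d + 'e) + 1) * real CARD('d + 'e))"
    using scalar_curvature_g[OF x1(1)] scalar_curvature_g[OF x2(1)] y[OF x1(1)] y[OF x2(1)] by simp
  then have "defect * real CARD('d) * (t x1 / u x1) = defect * real CARD('d) * (t x2 / u x2)"
    unfolding of_real_eq_iff by simp
  \<comment> \<open>The ratio t / u = 1 - |w|^2 / u separates the zero section from all other
    points.\<close>
  moreover have "t x1 / u x1 = 1" using x1(2) u_pos[of x1] by (simp add: t_def)
  ultimately have "defect * real CARD('d) * (1 - t x2 / u x2) = 0" by (simp only: mult_1_right right_diff_distrib)
  moreover have "t x2 / u x2 < 1" using x2(2) u_pos[of x2] by (simp add: t_def)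
  ultimately show "defect = 0" by force
qed

text \<open>For the forward direction, a point of the zero section suffices. In a fibre direction
  \<open>E\<close> vanishes while \<open>g\<close> does not, so the Einstein constant must be -(n +
  1). Comparing the base directions leaves \<open>defect\<close> times the Hessian of \<psi> equal
  to 0, and that Hessian has nonzero determinant.\<close>

theorem kaehler_einstein_iff: "kaehler_einstein_on g M \<longleftrightarrow> defect = 0"
proof
  assume "defect = 0"
  then show "kaehler_einstein_on g M"
    unfolding kaehler_einstein_on_def using ricci_g by (intro exI[of _ "- (real CARD('d + 'e) + 1)"])
      (simp add: algebra_simps)
next
  assume "kaehler_einstein_on g M"
  then obtain y :: real where y: "\<And>x i j. x \<in> M \<Longrightarrow> ricci_tensor g x $ i $ j = of_real y * g x $ i $ j"
    unfolding kaehler_einstein_on_def by blast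
  obtain x where x: "x \<in> M" "w_part x = 0" by (rule zero_section)
  have xb: "x $ Inr b = 0" for b using x(2) by (simp add: w_part_def vec_eq_iff)
  fix b0 :: 'e
  have "g x $ Inr b0 $ Inr b0 \<noteq> 0"
    using t_pos[OF x(1)] by (simp add: g_entry[OF x(1)] E_def A_def \<omega>_def xb)
  moreover have "- of_real (real CARD('d + 'e) + 1) * g x $ Inr b0 $ Inr b0 = of_real y * g x $ Inr b0 $ Inr b0"
  proof -
    have "E x $ Inr b0 $ Inr b0 = 0" by (simp add: E_def)
    then show ?thesis
      using trans[OF ricci_g[OF x(1), symmetric] y[OF x(1)], of "Inr b0" "Inr b0"]
      by (simp only: mult_zero_right diff_0 minus_mult_left)
  qed
  ultimately have yn: "complex_of_real y = - of_real (real CARD('d + 'e) + 1)" using mult_right_cancel by metis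
  have E0: "of_real defect * E x $ i $ j = 0" for i j
    using y[OF x(1), of i j] ricci_g[OF x(1), of i j] by (simp add: yn algebra_simps)
  show "defect = 0"
  proof (rule ccontr)
    assume "defect \<noteq> 0"
    then have "potential_metric \<psi> (z_part x) $ i $ j = 0" for i j
      using E0[of "Inl i" "Inl j"] by (simp add: E_def)
    then have "potential_metric \<psi> (z_part x) = 0" by (simp add: vec_eq_iff)
    then have "det (potential_metric \<psi> (z_part x)) = 0"
      using det_0[where 'n = 'd and 'a = complex] by (simp add: mat_0)
    then show False using det_\<psi>[OF z_in[OF x(1)]] c_nz by simp
  qed
qed

end


section \<open>Cartan-Hartogs domains\<close>

context bounded_open_set
begin

lemma potential_metric_log_\<kappa>:
  assumes z: "z \<in> \<Omega>"
  shows "potential_metric (\<lambda>z. l * (b + ln (\<kappa> z))) z = (\<chi> i j. of_real l * hess z $ i $ j)"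
proof -
  let ?L = "\<lambda>z. complex_of_real (ln (\<kappa> z))"
  have d1: "?L differentiable (at y)" if "y \<in> \<Omega>" for y using Ck_differentiable[OF Ck_log_\<kappa> that] .
  have d2: "d_zbar j ?L differentiable (at z)" for j
    using Ck_differentiable[OF Ck_wirt_bar[OF Ck_log_\<kappa> open_\<Omega>] z] .
  have 1: "d_zbar j (\<lambda>y. complex_of_real (l * (b + ln (\<kappa> y)))) y = of_real l * d_zbar j ?L y"
    if y: "y \<in> \<Omega>" for j y
  proof -
    have "(\<lambda>y. complex_of_real (l * (b + ln (\<kappa> y)))) = (\<lambda>y. of_real l * (of_real b + ?L y))" by simp
    then show ?thesis
      by (simp only: wirt_cmult(2)[OF differentiable_add[OF differentiable_const d1[OF y]]]
          wirt_add(2)[OF differentiable_const d1[OF y]] wirt_const add_0)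
  qed
  have "d_z i (d_zbar j (\<lambda>y. complex_of_real (l * (b + ln (\<kappa> y))))) z = of_real l * hess z $ i $ j" for i j
    using wirt_cong(1)[where v = "axis i 1", OF open_\<Omega> z 1] wirt_cmult(1)[where v = "axis i 1", OF d2]
    by (simp add: hess_def)
  then show ?thesis by (simp add: potential_metric_def vec_eq_iff)
qed

lemma measure_pos: "\<Omega> \<noteq> {} \<Longrightarrow> measure lborel \<Omega> > 0"
proof -
  assume "\<Omega> \<noteq> {}"
  then obtain x r where r: "r > 0" "cball x r \<subseteq> \<Omega>" using open_\<Omega> open_contains_cball by blast
  have "0 < measure lborel (ball x r)" by (rule measure_ball(2)[OF r(1)])
  also have "\<dots> \<le> measure lborel \<Omega>"
  proof (rule measure_mono_fmeasurable)
    show "ball x r \<subseteq> \<Omega>" using r(2) by auto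
    show "\<Omega> \<in> fmeasurable lborel" using finite_\<Omega> open_\<Omega> by (intro fmeasurableI) auto
  qed simp
  finally show ?thesis .
qed

end

theorem theorem1p4:
  fixes \<Omega> :: "(complex ^ 'd) set" and \<mu> :: real and p :: nat
    and M :: "(complex ^ ('d::finite + 'd0::finite)) set"
    and g :: "complex ^ ('d::finite + 'd0::finite) \<Rightarrow> complex ^ ('d + 'd0) ^ ('d + 'd0)"
  assumes "irreducible_bsd \<Omega>"
    and "harish_chandra_realization \<Omega>"
    and "p = genus \<Omega>"
    and "\<mu> > 0"
    and "M = cartan_hartogs \<Omega> \<mu>"
    and "g = ch_metric \<Omega> \<mu>"
  shows "(scalar_curvature g constant_on M \<longleftrightarrow> kaehler_einstein_on g M) \<and>
         (kaehler_einstein_on g M \<longleftrightarrow> \<mu> = real p / (real CARD('d) + 1))"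
proof -
  have bsd: "bounded_symmetric_domain \<Omega>" using assms(1) by (simp add: irreducible_bsd_def)
  note D = bounded_symmetric_domainD[OF bsd]
  interpret bounded_open_set \<Omega> using D(1,2) by unfold_locales
  obtain c where c: "c \<noteq> 0" "\<And>z. z \<in> \<Omega> \<Longrightarrow> det (hess z) = of_real (c * \<kappa> z)"
    using det_hess_proportional[OF D(3,4,5)] by blast
  \<comment> \<open>The genus is 2 plus a natural number by its very definition, so the exponent -1
    / p of the generic norm is a genuine one.\<close>
  have "p \<ge> 2" using assms(3) by (simp add: genus_def Let_def)
  then have p: "real p > 0" by simp
  define V where "V = measure lborel \<Omega>"
  have V: "V > 0" unfolding V_def by (rule measure_pos[OF D(4)])
  define l where "l = \<mu> / real p"
  have l: "l > 0" using p \<open>\<mu> > 0\<close> by (simp add: l_def)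
  \<comment> \<open>Chosen so that the \<mu>-th power of the generic norm, (V K) to the power -
    \<mu> / p, equals exp (- \<psi>).\<close>
  define \<psi> where "\<psi> z = l * (ln V + ln (\<kappa> z))" for z
  have gn: "generic_norm \<Omega> z powr \<mu> = exp (- \<psi> z)" if "z \<in> \<Omega>" for z
  proof -
    have "generic_norm \<Omega> z powr \<mu> = (V * \<kappa> z) powr (- l)"
      by (simp add: generic_norm_def \<kappa>_def V_def powr_powr l_def assms(3))
    also have "\<dots> = exp (- \<psi> z)"
      using V \<kappa>_pos[OF that] by (simp add: powr_def \<psi>_def ln_mult)
    finally show ?thesis .
  qed
  \<comment> \<open>Scaling log K by \<open>l\<close> multiplies the d-dimensional determinant by
    l^d, giving l^d c K; and K = exp ((p / \<mu>) \<psi>) / V. These are the origins of the two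
    constants.\<close>
  have "hartogs \<Omega> \<psi> M (ch_potential \<Omega> \<mu>) (l ^ CARD('d) * c / V) (real p / \<mu>)"
  proof
    show "open \<Omega>" "\<Omega> \<noteq> {}" by (rule D)+
    show "Ck k (\<lambda>z. complex_of_real (\<psi> z)) \<Omega>" for k
    proof (rule Ck_cong[OF Ck_cmult[OF Ck_add[OF Ck_const Ck_log_\<kappa>]]])
      show "of_real l * (of_real (ln V) + of_real (ln (\<kappa> x))) = complex_of_real (\<psi> x)" for x
        by (simp add: \<psi>_def)
    qed (rule open_\<Omega>)+
    show M: "M = {x. z_part x \<in> \<Omega> \<and> (norm (w_part x))\<^sup>2 < exp (- \<psi> (z_part x))}"
      unfolding assms(5) cartan_hartogs_def using gn by auto
    show "ch_potential \<Omega> \<mu> x = - ln (exp (- \<psi> (z_part x)) - (norm (w_part x))\<^sup>2)" if "x \<in> M" for x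
      using that unfolding M ch_potential_def by (simp add: gn)
    show "det (potential_metric \<psi> z) = of_real (l ^ CARD('d) * c / V * exp (real p / \<mu> * \<psi> z))"
      if z: "z \<in> \<Omega>" for z
    proof -
      have "real p / \<mu> * \<psi> z = ln V + ln (\<kappa> z)"
        using l p \<open>\<mu> > 0\<close> by (simp add: \<psi>_def l_def)
      then have "exp (real p / \<mu> * \<psi> z) = V * \<kappa> z"
        using V \<kappa>_pos[OF z] by (simp add: exp_add)
      moreover have "det (potential_metric \<psi> z) = of_real l ^ CARD('d) * det (hess z)"
        unfolding \<psi>_def[abs_def] potential_metric_log_\<kappa>[OF z] by (rule det_scale)
      ultimately show ?thesis using V by (simp add: c(2)[OF z])
    qed
    show "l ^ CARD('d) * c / V \<noteq> 0" using l c(1) V by simp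
  qed
  then interpret H: hartogs \<Omega> \<psi> M "ch_potential \<Omega> \<mu>" "l ^ CARD('d) * c / V" "real p / \<mu>" .
  have "H.defect = 0 \<longleftrightarrow> \<mu> = real p / (real CARD('d) + 1)"
    using \<open>\<mu> > 0\<close> by (simp add: H.defect_def field_simps)
  then show ?thesis
    using H.scalar_curvature_constant_iff H.kaehler_einstein_iff by (simp add: assms(6) ch_metric_def)
qed

end
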